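(* There exists a universal constant $C\in(0,\infty)$ with the following property. Let $n\in\mathbb{N}$, let $X_1,\ldots,X_n\subseteq\ell_1$ be finite, and let $S=X_1\times\cdots\times X_n\subseteq\ell_2^n(\ell_1)$, with $|S|\ge3$. Then $$c_1(S)\le C\,\sqrt[4]{\log|S|}\cdot\sqrt{\log\log|S|}.$$ In particular $c_1(S)\le(\log|S|)^{\frac14+o(1)}$, where $o(1)$ denotes a quantity depending only on $|S|$ that tends to $0$ as $|S|\to\infty$.
   Context: $\mathbb{N}=\{1,2,3,\ldots\}$, $|S|$ is the cardinality of $S$, and $\log$ is the natural logarithm. $\ell_1$ is the Banach space of absolutely summable real sequences. $\ell_2^n(\ell_1)$ is the set $(\ell_1)^n$ with the metric $\big(\sum_{j=1}^n\|x_j-y_j\|_1^2\big)^{1/2}$, and $S$ carries the restricted metric. $L_1$ denotes $L_1(0,1)$ (real-valued functions, Lebesgue measure). For a metric space $(X,d_X)$, $c_1(X)$ is the infimum over those $D\in[1,\infty)$ for which there exist $s\in(0,\infty)$ and $f:X\to L_1$ with $s\,d_X(x,y)\le\|f(x)-f(y)\|_1\le D s\,d_X(x,y)$ for all $x,y\in X$ (with $c_1(X)=\infty$ if no such $D$ exists). *)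

theory Defs
  imports "HOL-Analysis.Analysis"
begin

definition ell1 :: "(nat \<Rightarrow> real) set" where
  "ell1 = {x. (\<lambda>i. \<bar>x i\<bar>) summable_on UNIV}"

definition ell1_norm :: "(nat \<Rightarrow> real) \<Rightarrow> real" where
  "ell1_norm x = (\<Sum>\<^sub>\<infinity>i. \<bar>x i\<bar>)"

definition ell1_dist :: "(nat \<Rightarrow> real) \<Rightarrow> (nat \<Rightarrow> real) \<Rightarrow> real" where
  "ell1_dist x y = ell1_norm (\<lambda>i. x i - y i)"

text \<open>Elements of the n-fold power of \<^const>\<open>ell1\<close> are functions on the index set 1..n,
  extended by \<^const>\<open>undefined\<close> outside it (see \<^const>\<open>PiE\<close>).\<close>

definition ell2_ell1 :: "nat \<Rightarrow> (nat \<Rightarrow> nat \<Rightarrow> real) set" where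
  "ell2_ell1 n = {1..n} \<rightarrow>\<^sub>E ell1"

definition ell2_ell1_dist :: "nat \<Rightarrow> (nat \<Rightarrow> nat \<Rightarrow> real) \<Rightarrow> (nat \<Rightarrow> nat \<Rightarrow> real) \<Rightarrow> real" where
  "ell2_ell1_dist n x y = sqrt (\<Sum>j=1..n. (ell1_dist (x j) (y j))\<^sup>2)"

text \<open>\<open>L1\<close> consists of integrable functions rather than of their classes modulo
  almost everywhere equality, so \<open>L1_dist\<close> is only a pseudometric on it. A map into the
  space of classes is given by any choice of representatives, with the same distances.\<close>

definition L1 :: "(real \<Rightarrow> real) set" where
  "L1 = {g. integrable (lebesgue_on {0<..<1}) g}"

definition L1_dist :: "(real \<Rightarrow> real) \<Rightarrow> (real \<Rightarrow> real) \<Rightarrow> real" where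
  "L1_dist g h = (LINT t|lebesgue_on {0<..<1}. \<bar>g t - h t\<bar>)"

text \<open>The space is given by its carrier and its distance, as in \<^locale>\<open>Metric_space\<close>.
  In \<^typ>\<open>ereal\<close> the infimum of the empty set is \<open>\<infinity>\<close>.\<close>

definition c1 :: "'a set \<Rightarrow> ('a \<Rightarrow> 'a \<Rightarrow> real) \<Rightarrow> ereal" where
  "c1 X d = Inf {ereal D | D. 1 \<le> D \<and>
     (\<exists>s>0. \<exists>f :: 'a \<Rightarrow> real \<Rightarrow> real. f ` X \<subseteq> L1 \<and>
        (\<forall>x\<in>X. \<forall>y\<in>X. s * d x y \<le> L1_dist (f x) (f y) \<and> L1_dist (f x) (f y) \<le> D * s * d x y))}"

lemma ell1_diff_summable:
  assumes "x \<in> ell1" "y \<in> ell1"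
  shows "(\<lambda>i. \<bar>x i - y i\<bar>) summable_on UNIV"
proof (rule summable_on_comparison_test)
  show "(\<lambda>i. \<bar>x i\<bar> + \<bar>y i\<bar>) summable_on UNIV"
    using assms by (auto simp: ell1_def intro: summable_on_add)
qed auto

lemma Metric_space_ell1: "Metric_space ell1 ell1_dist"
proof
  show "0 \<le> ell1_dist x y" for x y
    by (simp add: ell1_dist_def ell1_norm_def infsum_nonneg)
  show "ell1_dist x y = ell1_dist y x" for x y
    by (simp add: ell1_dist_def ell1_norm_def abs_minus_commute)
  show "ell1_dist x y = 0 \<longleftrightarrow> x = y" if "x \<in> ell1" "y \<in> ell1" for x y
  proof
    assume "ell1_dist x y = 0"
    then have "\<bar>x i - y i\<bar> = 0" for i
      using nonneg_infsum_le_0D[OF _ ell1_diff_summable[OF that], of i]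
      by (simp add: ell1_dist_def ell1_norm_def)
    then show "x = y"
      by auto
  qed (simp add: ell1_dist_def ell1_norm_def)
  show "ell1_dist x z \<le> ell1_dist x y + ell1_dist y z"
    if "x \<in> ell1" "y \<in> ell1" "z \<in> ell1" for x y z
  proof -
    have "(\<Sum>\<^sub>\<infinity>i. \<bar>x i - z i\<bar>) \<le> (\<Sum>\<^sub>\<infinity>i. \<bar>x i - y i\<bar> + \<bar>y i - z i\<bar>)"
      using that by (intro infsum_mono summable_on_add ell1_diff_summable) auto
    also have "\<dots> = (\<Sum>\<^sub>\<infinity>i. \<bar>x i - y i\<bar>) + (\<Sum>\<^sub>\<infinity>i. \<bar>y i - z i\<bar>)"
      using that by (intro infsum_add ell1_diff_summable)
    finally show ?thesis
      by (simp add: ell1_dist_def ell1_norm_def)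
  qed
qed

lemma Metric_space_ell2_ell1: "Metric_space (ell2_ell1 n) (ell2_ell1_dist n)"
proof -
  interpret Metric_space ell1 ell1_dist
    by (rule Metric_space_ell1)
  show ?thesis
  proof
    show "0 \<le> ell2_ell1_dist n x y" for x y
      by (simp add: ell2_ell1_dist_def sum_nonneg)
    show "ell2_ell1_dist n x y = ell2_ell1_dist n y x" for x y
      by (simp add: ell2_ell1_dist_def commute)
    show "ell2_ell1_dist n x y = 0 \<longleftrightarrow> x = y" if "x \<in> ell2_ell1 n" "y \<in> ell2_ell1 n" for x y
    proof -
      have "ell2_ell1_dist n x y = 0 \<longleftrightarrow> (\<forall>j\<in>{1..n}. ell1_dist (x j) (y j) = 0)"
        unfolding ell2_ell1_dist_def real_sqrt_eq_0_iff
        by (subst sum_nonneg_eq_0_iff) simp_all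
      also have "\<dots> \<longleftrightarrow> (\<forall>j\<in>{1..n}. x j = y j)"
        using that zero by (metis PiE_mem ell2_ell1_def)
      also have "\<dots> \<longleftrightarrow> x = y"
        using that unfolding ell2_ell1_def by (blast intro: PiE_ext[of x _ _ y])
      finally show ?thesis .
    qed
    show "ell2_ell1_dist n x z \<le> ell2_ell1_dist n x y + ell2_ell1_dist n y z"
      if "x \<in> ell2_ell1 n" "y \<in> ell2_ell1 n" "z \<in> ell2_ell1 n" for x y z
    proof -
      have "ell2_ell1_dist n x z
          \<le> L2_set (\<lambda>j. ell1_dist (x j) (y j) + ell1_dist (y j) (z j)) {1..n}"
        unfolding ell2_ell1_dist_def L2_set_def[symmetric]
        using that by (intro L2_set_mono triangle) (auto simp: ell2_ell1_def PiE_iff)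
      also have "\<dots> \<le> ell2_ell1_dist n x y + ell2_ell1_dist n y z"
        unfolding ell2_ell1_dist_def L2_set_def[symmetric] by (rule L2_set_triangle_ineq)
      finally show ?thesis .
    qed
  qed
qed

end

theory Submission
  imports Defs
begin

text \<open>
  A product of finite subsets of \<open>\<ell>\<^sub>1\<close> is embedded by treating its large and its small factors
  differently. Let \<open>L = log |S|\<close> and \<open>l = 1 + log L\<close>, and call a factor large if the logarithm of
  its cardinality exceeds \<open>K = \<surd>L / l\<close>. The logarithms of the cardinalities add up to \<open>L\<close>, so there are
  at most \<open>\<surd>L l\<close> large factors, and replacing the \<open>\<ell>\<^sub>2\<close>-sum of their metrics by the \<open>\<ell>\<^sub>1\<close>-sum, which
  is an \<open>L\<^sub>1\<close> metric, costs the square root of their number, that is \<open>(\<surd>L l)\<^bsup>1/2\<^esup>\<close>. A small factor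
  embeds into Hilbert space with distortion \<open>O(\<surd>K log K)\<close>, so the \<open>\<ell>\<^sub>2\<close>-sum of the small factors does as well, and a
  Hilbert space embeds into \<open>L\<^sub>1\<close> with bounded distortion by Khintchine's inequality. With the above
  \<open>K\<close> both costs are \<open>O((\<surd>L l)\<^bsup>1/2\<^esup>)\<close> (\<open>c1_product_le\<close>).

  The substance is the embedding of the small factors, the theorem of Arora, Lee and Naor that a
  metric of negative type on \<open>m\<close> points, that is, the square of a Euclidean metric, has
  Euclidean distortion \<open>O(\<surd>(log m) log log m)\<close> (\<open>euclidean_embedding\<close>). Metrics of \<open>\<ell>\<^sub>1\<close> are of negative type because
  \<open>|a - b|\<close> on the line is. The proof has two layers.

  At one scale \<open>\<Delta>\<close>, points are projected on a random sign vector. Points at distance about \<open>\<Delta>\<close> have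
  projections about \<open>\<surd>\<Delta>\<close> apart. Pairs at distance less than \<open>\<sigma>\<close> whose projections are nevertheless of
  the order \<open>\<surd>\<Delta>\<close> apart are bad, and a maximal fractional matching of bad pairs shows which points
  have to be discarded. If much weight was matched, one could walk along bad pairs for \<open>p \<approx> \<Delta> / \<sigma>\<close>
  steps, gaining about \<open>\<surd>\<Delta>\<close> in projection each time, whereas among \<open>4\<^sup>g\<close> points within distance \<open>\<Delta>\<close> the
  expected largest gain is \<open>O(\<surd>(g \<Delta>))\<close>. Hence \<open>\<sigma>\<close> can be taken as a constant times \<open>\<Delta> / \<surd>g\<close>
  (\<open>sign_avg_chaining\<close>, \<open>few_saturated\<close>). What remains splits into sets whose distance functions
  separate each pair at distance about \<open>\<Delta>\<close> by \<open>\<sigma>\<close> with constant probability (\<open>random_zero_sets\<close>).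

  Simply adding up all scales would cost too much. A scale is therefore used near a point only for those
  \<open>t\<close> for which the ball around the point reaches \<open>2\<^sup>t\<close> points at a radius comparable to \<open>\<Delta>\<close>, up to factors \<open>O(\<surd>g)\<close>.
  For fixed \<open>t\<close> only \<open>O(log log m)\<close> scales qualify, while a pair around which the balls
  grow by \<open>2\<^sup>g\<close> is seen by about \<open>g\<close> values of \<open>t\<close>, and each contributes \<open>\<Delta>\<^sup>2 / g\<close> to the square
  of its distance (\<open>single_scale_embedding\<close>, \<open>euclidean_embedding\<close>).
\<close>

section \<open>Averages over signs\<close>

text \<open>A pattern is a total function, so that a coordinate can be reset by a function update;
  positions from \<open>n\<close> on hold 0.\<close>

primrec signs :: "nat \<Rightarrow> (nat \<Rightarrow> real) list" where
  "signs 0 = [\<lambda>_. 0]"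
| "signs (Suc n) = map (\<lambda>e. e(n := 1)) (signs n) @ map (\<lambda>e. e(n := -1)) (signs n)"

definition sign_avg :: "nat \<Rightarrow> ((nat \<Rightarrow> real) \<Rightarrow> real) \<Rightarrow> real" where
  "sign_avg n F = (\<Sum>e\<leftarrow>signs n. F e) / 2 ^ n"

lemma length_signs [simp]: "length (signs n) = 2 ^ n"
  by (induction n) auto

lemma signs_pm_one: "e \<in> set (signs n) \<Longrightarrow> i < n \<Longrightarrow> e i = 1 \<or> e i = -1"
proof (induction n arbitrary: e)
  case (Suc n)
  then obtain e' c where "e' \<in> set (signs n)" "e = e'(n := c)" "c = 1 \<or> c = -1"
    by auto
  then show ?case
    using Suc.IH[of e'] Suc.prems(2) by (cases "i = n") auto
qed simp

lemma sign_avg_0 [simp]: "sign_avg 0 F = F (\<lambda>_. 0)"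
  by (simp add: sign_avg_def)

lemma sign_avg_Suc:
  "sign_avg (Suc n) F = (sign_avg n (\<lambda>e. F (e(n := 1))) + sign_avg n (\<lambda>e. F (e(n := -1)))) / 2"
  by (simp add: sign_avg_def comp_def field_simps)

lemma sign_avg_const [simp]: "sign_avg n (\<lambda>_. c) = c"
  by (induction n) (auto simp: sign_avg_Suc)

lemma sign_avg_add: "sign_avg n (\<lambda>e. F e + G e) = sign_avg n F + sign_avg n G"
  by (simp add: sign_avg_def sum_list_addf add_divide_distrib)

lemma sign_avg_cmult: "sign_avg n (\<lambda>e. c * F e) = c * sign_avg n F"
  by (simp add: sign_avg_def sum_list_const_mult)

lemma sign_avg_divide: "sign_avg n (\<lambda>e. F e / c) = sign_avg n F / c"
  using sign_avg_cmult[of n "1 / c" F] by simp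

lemma sign_avg_diff: "sign_avg n (\<lambda>e. F e - G e) = sign_avg n F - sign_avg n G"
  using sign_avg_add[of n F "\<lambda>e. - 1 * G e"] sign_avg_cmult[of n "-1" G] by simp

lemma sign_avg_sum: "sign_avg n (\<lambda>e. \<Sum>x\<in>A. F x e) = (\<Sum>x\<in>A. sign_avg n (F x))"
  by (induction A rule: infinite_finite_induct) (auto simp: sign_avg_add)

lemma sign_avg_mono:
  assumes "\<And>e. e \<in> set (signs n) \<Longrightarrow> F e \<le> G e"
  shows "sign_avg n F \<le> sign_avg n G"
  using assms by (auto simp: sign_avg_def intro!: divide_right_mono sum_list_mono)

lemma sign_avg_nonneg: "(\<And>e. 0 \<le> F e) \<Longrightarrow> 0 \<le> sign_avg n F"
  using sign_avg_mono[of n "\<lambda>_. 0" F] by simp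

lemma exists_ge_sign_avg: "\<exists>e. sign_avg n F \<le> F e"
proof (rule ccontr)
  assume "\<nexists>e. sign_avg n F \<le> F e"
  then have less: "F e < sign_avg n F" for e by (simp add: not_le)
  have "sum_list (map F (signs n)) < sum_list (map (\<lambda>_. sign_avg n F) (signs n))"
    using less by (intro sum_list_strict_mono) (auto simp flip: length_0_conv)
  then have "sign_avg n F < sign_avg n F"
    unfolding sign_avg_def[of n F] by (simp add: sum_list_triv field_simps)
  then show False by simp
qed

lemma sign_avg_neg: "sign_avg n (\<lambda>e. F (\<lambda>i. - e i)) = sign_avg n F"
proof (induction n arbitrary: F)
  case (Suc n)
  have eq: "(\<lambda>i. - (e(n := c)) i) = (\<lambda>i. - e i)(n := - c)" for e :: "nat \<Rightarrow> real" and c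
    by auto
  show ?case
    using Suc[of "\<lambda>e. F (e(n := 1))"] Suc[of "\<lambda>e. F (e(n := -1))"]
    by (simp add: sign_avg_Suc eq del: fun_upd_apply)
qed simp

lemma sign_avg_resample:
  assumes "i < n"
  shows "sign_avg n F = sign_avg n (\<lambda>e. (F (e(i := 1)) + F (e(i := -1))) / 2)"
  using assms
proof (induction n arbitrary: F)
  case (Suc n)
  show ?case
  proof (cases "i = n")
    case True
    then show ?thesis
      by (simp add: sign_avg_Suc sign_avg_add sign_avg_divide field_simps del: fun_upd_apply)
  next
    case False
    with Suc.prems have "i < n" by simp
    then show ?thesis
      using Suc.IH[of "\<lambda>e. F (e(n := 1))"] Suc.IH[of "\<lambda>e. F (e(n := -1))"] False
      by (simp add: sign_avg_Suc fun_upd_twist[of i n] del: fun_upd_apply)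
  qed
qed simp

lemma sign_avg_power2_le: "(sign_avg n F)\<^sup>2 \<le> sign_avg n (\<lambda>e. (F e)\<^sup>2)"
proof -
  define m where "m = sign_avg n F"
  have "0 \<le> sign_avg n (\<lambda>e. (F e - m)\<^sup>2)"
    by (intro sign_avg_nonneg) auto
  also have "(\<lambda>e. (F e - m)\<^sup>2) = (\<lambda>e. ((F e)\<^sup>2 + m\<^sup>2) - (2 * m) * F e)"
    by (auto simp: power2_diff)
  also have "sign_avg n \<dots> = sign_avg n (\<lambda>e. (F e)\<^sup>2) + m\<^sup>2 - 2 * m * m"
    unfolding sign_avg_diff sign_avg_add sign_avg_cmult m_def by simp
  finally show ?thesis by (simp add: power2_eq_square m_def)
qed

abbreviation sgn_form :: "nat \<Rightarrow> (nat \<Rightarrow> real) \<Rightarrow> (nat \<Rightarrow> real) \<Rightarrow> real" where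
  "sgn_form n a e \<equiv> (\<Sum>i<n. a i * e i)"

lemma sgn_form_upd [simp]: "sgn_form n a (e(n := c)) = sgn_form n a e"
  by (intro sum.cong) auto

lemma sign_avg_second_moment: "sign_avg n (\<lambda>e. (sgn_form n a e)\<^sup>2) = (\<Sum>i<n. (a i)\<^sup>2)"
proof (induction n)
  case (Suc n)
  have "sign_avg (Suc n) (\<lambda>e. (sgn_form (Suc n) a e)\<^sup>2)
      = sign_avg n (\<lambda>e. ((sgn_form n a e + a n)\<^sup>2 + (sgn_form n a e - a n)\<^sup>2) / 2)"
    by (simp add: sign_avg_Suc sign_avg_add sign_avg_divide)
  also have "\<dots> = sign_avg n (\<lambda>e. (sgn_form n a e)\<^sup>2 + (a n)\<^sup>2)"
    by (intro arg_cong[of _ _ "sign_avg n"] ext) (simp add: power2_sum power2_diff field_simps)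
  finally show ?case by (simp add: sign_avg_add Suc)
qed simp

text \<open>A fourth moment of the order of the squared second moment keeps a random sum from being
  concentrated at 0; \<open>sign_avg_spread\<close> and \<open>sign_avg_abs_ge\<close> extract this.\<close>

lemma sign_avg_fourth_moment:
  "sign_avg n (\<lambda>e. (sgn_form n a e) ^ 4) \<le> 3 * (\<Sum>i<n. (a i)\<^sup>2)\<^sup>2"
proof (induction n)
  case (Suc n)
  let ?A = "\<Sum>i<n. (a i)\<^sup>2"
  have "sign_avg (Suc n) (\<lambda>e. (sgn_form (Suc n) a e) ^ 4)
      = sign_avg n (\<lambda>e. ((sgn_form n a e + a n) ^ 4 + (sgn_form n a e - a n) ^ 4) / 2)"
    by (simp add: sign_avg_Suc sign_avg_add sign_avg_divide)
  also have "\<dots> = sign_avg n (\<lambda>e. ((sgn_form n a e) ^ 4 + (6 * (a n)\<^sup>2) * (sgn_form n a e)\<^sup>2) + (a n) ^ 4)"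
  proof -
    have "((x + y) ^ 4 + (x - y) ^ 4) / 2 = (x ^ 4 + (6 * y\<^sup>2) * x\<^sup>2) + y ^ 4" for x y :: real
      by (simp add: field_simps power4_eq_xxxx power2_eq_square)
    then show ?thesis by presburger
  qed
  also have "\<dots> \<le> 3 * ?A\<^sup>2 + 6 * (a n)\<^sup>2 * ?A + (a n) ^ 4"
    using Suc by (simp add: sign_avg_add sign_avg_cmult sign_avg_second_moment)
  also have "\<dots> \<le> 3 * (?A + (a n)\<^sup>2)\<^sup>2"
  proof -
    have "3 * (?A + (a n)\<^sup>2)\<^sup>2 = 3 * ?A\<^sup>2 + 6 * (a n)\<^sup>2 * ?A + 3 * (a n) ^ 4"
      by algebra
    then show ?thesis by simp
  qed
  finally show ?case by simp
qed simp

lemma cosh_le_exp_half_square: "cosh (x :: real) \<le> exp (x\<^sup>2 / 2)"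
proof -
  have main: "cosh y \<le> exp (y\<^sup>2 / 2)" if "0 \<le> y" for y :: real
  proof -
    let ?f = "\<lambda>y::real. y\<^sup>2 / 2 - ln (cosh y)"
    have "?f 0 \<le> ?f y"
    proof (rule DERIV_nonneg_imp_nondecreasing[OF that])
      fix z :: real assume z: "0 \<le> z" "z \<le> y"
      have "(?f has_real_derivative (z - tanh z)) (at z)"
        using cosh_real_pos[of z]
        by (auto intro!: derivative_eq_intros simp: tanh_def field_simps)
      moreover have "tanh z \<le> z"
      proof -
        have "(\<lambda>w. w - tanh w) 0 \<le> (\<lambda>w. w - tanh w) z"
        proof (rule DERIV_nonneg_imp_nondecreasing[OF z(1)])
          fix w :: real
          have "((\<lambda>w. w - tanh w) has_real_derivative (tanh w)\<^sup>2) (at w)"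
            using cosh_real_pos[of w] by (auto intro!: derivative_eq_intros)
          then show "\<exists>D. ((\<lambda>w. w - tanh w) has_real_derivative D) (at w) \<and> 0 \<le> D"
            by (meson zero_le_power2)
        qed
        then show ?thesis by simp
      qed
      ultimately show "\<exists>D. (?f has_real_derivative D) (at z) \<and> 0 \<le> D"
        by (meson diff_ge_0_iff_ge)
    qed
    then have "ln (cosh y) \<le> y\<^sup>2 / 2" by simp
    then show ?thesis
      using cosh_real_pos[of y] by (metis exp_le_cancel_iff exp_ln)
  qed
  show ?thesis
    using main[of x] main[of "-x"] by (cases "0 \<le> x") auto
qed

text \<open>The signs are independent, and a single sign with coefficient \<open>c\<close> contributes \<open>cosh (l c)\<close>.\<close>

lemma sign_avg_exp_le:
  "sign_avg n (\<lambda>e. exp (l * sgn_form n a e)) \<le> exp (l\<^sup>2 * (\<Sum>i<n. (a i)\<^sup>2) / 2)"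
proof (induction n)
  case (Suc n)
  have "sign_avg (Suc n) (\<lambda>e. exp (l * sgn_form (Suc n) a e))
      = sign_avg n (\<lambda>e. cosh (l * a n) * exp (l * sgn_form n a e))"
  proof -
    have "(exp (l * (s + c)) + exp (l * (s - c))) / 2 = cosh (l * c) * exp (l * s)" for s c
      by (simp add: cosh_def ring_distribs exp_add exp_diff exp_minus inverse_eq_divide)
    then have "cosh (l * a n) * exp (l * sgn_form n a e)
        = (exp (l * (sgn_form n a e + a n)) + exp (l * (sgn_form n a e - a n))) / 2" for e
      by presburger
    then show ?thesis by (simp only:) (simp add: sign_avg_Suc sign_avg_add sign_avg_divide)
  qed
  also have "\<dots> = cosh (l * a n) * sign_avg n (\<lambda>e. exp (l * sgn_form n a e))"
    by (simp add: sign_avg_cmult)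
  also have "\<dots> \<le> exp ((l * a n)\<^sup>2 / 2) * exp (l\<^sup>2 * (\<Sum>i<n. (a i)\<^sup>2) / 2)"
    by (intro mult_mono cosh_le_exp_half_square Suc) (auto intro!: sign_avg_nonneg)
  also have "\<dots> = exp (l\<^sup>2 * (\<Sum>i<Suc n. (a i)\<^sup>2) / 2)"
    by (simp add: power_mult_distrib ring_distribs add_divide_distrib flip: exp_add)
  finally show ?case .
qed simp

lemma exp_sign_avg_le: "exp (sign_avg n F) \<le> sign_avg n (\<lambda>e. exp (F e))"
proof -
  let ?m = "sign_avg n F"
  have "sign_avg n (\<lambda>e. exp ?m * (1 + (F e - ?m))) \<le> sign_avg n (\<lambda>e. exp (F e))"
  proof (rule sign_avg_mono)
    fix e
    have "exp ?m * (1 + (F e - ?m)) \<le> exp ?m * exp (F e - ?m)"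
      by (intro mult_left_mono exp_ge_add_one_self) auto
    then show "exp ?m * (1 + (F e - ?m)) \<le> exp (F e)" by (simp flip: exp_add)
  qed
  then show ?thesis by (simp add: sign_avg_cmult sign_avg_add sign_avg_diff)
qed

text \<open>By convexity the exponential may be moved inside the average, and there the largest exponential is
  at most the sum of all. The best \<open>l\<close> is of order \<open>\<surd>(ln |V| / s)\<close>.\<close>

lemma sign_avg_Max_le:
  assumes V: "finite V" "V \<noteq> {}" and s: "\<And>v. v \<in> V \<Longrightarrow> (\<Sum>i<n. (a v i)\<^sup>2) \<le> s" and l: "0 < l"
  shows "sign_avg n (\<lambda>e. MAX v\<in>V. sgn_form n (a v) e) \<le> ln (card V) / l + l * s / 2"
proof -
  let ?M = "\<lambda>e. MAX v\<in>V. sgn_form n (a v) e"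
  have "exp (l * sign_avg n ?M) = exp (sign_avg n (\<lambda>e. l * ?M e))"
    by (simp add: sign_avg_cmult)
  also have "\<dots> \<le> sign_avg n (\<lambda>e. exp (l * ?M e))" by (rule exp_sign_avg_le)
  also have "\<dots> \<le> sign_avg n (\<lambda>e. \<Sum>v\<in>V. exp (l * sgn_form n (a v) e))"
  proof (rule sign_avg_mono)
    fix e
    have "?M e \<in> (\<lambda>v. sgn_form n (a v) e) ` V"
      using V by (intro Max_in) auto
    then obtain v where v: "v \<in> V" "?M e = sgn_form n (a v) e" by auto
    then show "exp (l * ?M e) \<le> (\<Sum>v\<in>V. exp (l * sgn_form n (a v) e))"
      using V by (auto intro!: member_le_sum[where i = v and f = "\<lambda>v. exp (l * sgn_form n (a v) e)"])
  qed
  also have "\<dots> \<le> (\<Sum>v\<in>V. exp (l\<^sup>2 * s / 2))"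
    unfolding sign_avg_sum
  proof (rule sum_mono)
    fix v assume "v \<in> V"
    then have "l\<^sup>2 * (\<Sum>i<n. (a v i)\<^sup>2) / 2 \<le> l\<^sup>2 * s / 2"
      by (intro divide_right_mono mult_left_mono s) auto
    then show "sign_avg n (\<lambda>e. exp (l * sgn_form n (a v) e)) \<le> exp (l\<^sup>2 * s / 2)"
      using sign_avg_exp_le[of n l "a v"] by (meson exp_le_cancel_iff order_trans)
  qed
  also have "\<dots> = exp (ln (card V) + l\<^sup>2 * s / 2)"
    using V by (simp add: exp_add card_gt_0_iff)
  finally have "l * sign_avg n ?M \<le> ln (card V) + l\<^sup>2 * s / 2" by simp
  then show ?thesis using l by (simp add: field_simps power2_eq_square)
qed

text \<open>The Efron-Stein inequality. Conditioning on the last sign splits the variance into the mean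
  conditional variance, to which induction applies, and the variance of the conditional mean,
  which is a quarter of the squared difference of two averages.\<close>

lemma sign_avg_variance_le:
  "sign_avg n (\<lambda>e. (F e - sign_avg n F)\<^sup>2)
    \<le> (\<Sum>i<n. sign_avg n (\<lambda>e. (F (e(i := 1)) - F (e(i := -1)))\<^sup>2)) / 4"
proof (induction n arbitrary: F)
  case (Suc n)
  define P where "P = (\<lambda>e. F (e(n := 1)))"
  define N where "N = (\<lambda>e. F (e(n := -1)))"
  define p where "p = sign_avg n P"
  define q where "q = sign_avg n N"
  have m: "sign_avg (Suc n) F = (p + q) / 2"
    by (simp add: sign_avg_Suc P_def N_def p_def q_def)
  have var: "sign_avg n (\<lambda>e. (G e - c)\<^sup>2)
      = sign_avg n (\<lambda>e. (G e - sign_avg n G)\<^sup>2) + (sign_avg n G - c)\<^sup>2" for G c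
  proof -
    let ?g = "sign_avg n G"
    have "(\<lambda>e. (G e - c)\<^sup>2) = (\<lambda>e. (G e - ?g)\<^sup>2 + ((2 * (?g - c)) * (G e - ?g) + (?g - c)\<^sup>2))"
      by (rule ext) algebra
    then have "sign_avg n (\<lambda>e. (G e - c)\<^sup>2)
        = sign_avg n (\<lambda>e. (G e - ?g)\<^sup>2 + ((2 * (?g - c)) * (G e - ?g) + (?g - c)\<^sup>2))" by simp
    also have "\<dots> = sign_avg n (\<lambda>e. (G e - ?g)\<^sup>2) + ((2 * (?g - c)) * (?g - ?g) + (?g - c)\<^sup>2)"
      by (simp only: sign_avg_add sign_avg_cmult sign_avg_diff sign_avg_const)
    finally show ?thesis by simp
  qed
  have "sign_avg (Suc n) (\<lambda>e. (F e - sign_avg (Suc n) F)\<^sup>2)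
      = (sign_avg n (\<lambda>e. (P e - (p + q) / 2)\<^sup>2) + sign_avg n (\<lambda>e. (N e - (p + q) / 2)\<^sup>2)) / 2"
    unfolding m by (simp add: sign_avg_Suc P_def N_def)
  also have "\<dots> = (sign_avg n (\<lambda>e. (P e - p)\<^sup>2) + sign_avg n (\<lambda>e. (N e - q)\<^sup>2)) / 2 + (p - q)\<^sup>2 / 4"
    using var[of P "(p + q) / 2"] var[of N "(p + q) / 2"]
    unfolding p_def[symmetric] q_def[symmetric] by (simp add: power2_eq_square field_simps)
  also have "(p - q)\<^sup>2 \<le> sign_avg n (\<lambda>e. (P e - N e)\<^sup>2)"
    unfolding p_def q_def sign_avg_diff[symmetric] by (rule sign_avg_power2_le)
  also have "sign_avg n (\<lambda>e. (P e - p)\<^sup>2)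
      \<le> (\<Sum>i<n. sign_avg n (\<lambda>e. (P (e(i := 1)) - P (e(i := -1)))\<^sup>2)) / 4"
    unfolding p_def by (rule Suc)
  also have "sign_avg n (\<lambda>e. (N e - q)\<^sup>2)
      \<le> (\<Sum>i<n. sign_avg n (\<lambda>e. (N (e(i := 1)) - N (e(i := -1)))\<^sup>2)) / 4"
    unfolding q_def by (rule Suc)
  also have "((\<Sum>i<n. sign_avg n (\<lambda>e. (P (e(i := 1)) - P (e(i := -1)))\<^sup>2)) / 4
      + (\<Sum>i<n. sign_avg n (\<lambda>e. (N (e(i := 1)) - N (e(i := -1)))\<^sup>2)) / 4) / 2
      = (\<Sum>i<n. sign_avg (Suc n) (\<lambda>e. (F (e(i := 1)) - F (e(i := -1)))\<^sup>2)) / 4"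
  proof -
    have "sign_avg (Suc n) (\<lambda>e. (F (e(i := 1)) - F (e(i := -1)))\<^sup>2)
        = (sign_avg n (\<lambda>e. (P (e(i := 1)) - P (e(i := -1)))\<^sup>2)
         + sign_avg n (\<lambda>e. (N (e(i := 1)) - N (e(i := -1)))\<^sup>2)) / 2" if "i < n" for i
      using that by (simp add: sign_avg_Suc P_def N_def fun_upd_twist)
    then have "(\<Sum>i<n. sign_avg (Suc n) (\<lambda>e. (F (e(i := 1)) - F (e(i := -1)))\<^sup>2))
        = (\<Sum>i<n. (sign_avg n (\<lambda>e. (P (e(i := 1)) - P (e(i := -1)))\<^sup>2)
         + sign_avg n (\<lambda>e. (N (e(i := 1)) - N (e(i := -1)))\<^sup>2)) / 2)"
      by (intro sum.cong) auto
    then show ?thesis by (simp add: sum.distrib flip: sum_divide_distrib)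
  qed
  also have "\<dots> + sign_avg n (\<lambda>e. (P e - N e)\<^sup>2) / 4
      = (\<Sum>i<Suc n. sign_avg (Suc n) (\<lambda>e. (F (e(i := 1)) - F (e(i := -1)))\<^sup>2)) / 4"
    by (simp add: sign_avg_Suc[of n "\<lambda>e. (F (e(n := 1)) - F (e(n := -1)))\<^sup>2"] P_def N_def add_divide_distrib)
  finally show ?case by (simp del: fun_upd_apply)
qed simp

text \<open>The bound does not depend on \<open>|V|\<close>. Flipping sign \<open>i\<close> lowers the maximum by at most \<open>2 |a v i|\<close>,
  where \<open>v\<close> attains it before the flip; so at every pattern the squares of the decreases over all \<open>i\<close>
  add up to at most \<open>4 s\<close>. A pattern and its flip exchange decrease and increase, so the decreases carry half
  of each Efron-Stein term.\<close>

lemma sign_avg_Max_deviation_le: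
  assumes V: "finite V" "V \<noteq> {}" and s: "\<And>v. v \<in> V \<Longrightarrow> (\<Sum>i<n. (a v i)\<^sup>2) \<le> s"
  defines "M \<equiv> \<lambda>e. MAX v\<in>V. sgn_form n (a v) e"
  shows "sign_avg n (\<lambda>e. \<bar>M e - sign_avg n M\<bar>) \<le> sqrt (2 * s)"
proof -
  define flip where "flip = (\<lambda>(i::nat) (e::nat \<Rightarrow> real). e(i := - e i))"
  define G where "G = (\<lambda>i e. (max 0 (M e - M (flip i e)))\<^sup>2)"
  have pair: "sign_avg n (\<lambda>e. (M (e(i := 1)) - M (e(i := -1)))\<^sup>2) = 2 * sign_avg n (G i)"
    if "i < n" for i
  proof -
    have "sign_avg n (G i) = sign_avg n (\<lambda>e. (G i (e(i := 1)) + G i (e(i := -1))) / 2)"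
      by (rule sign_avg_resample[OF that])
    also have "\<dots> = sign_avg n (\<lambda>e. (M (e(i := 1)) - M (e(i := -1)))\<^sup>2 / 2)"
      by (intro arg_cong[of _ _ "sign_avg n"] ext)
         (auto simp: G_def flip_def max_def power2_commute)
    finally show ?thesis by (simp add: sign_avg_divide)
  qed
  have G: "(\<Sum>i<n. G i e) \<le> 4 * s" if e: "e \<in> set (signs n)" for e
  proof -
    have "M e \<in> (\<lambda>v. sgn_form n (a v) e) ` V"
      unfolding M_def using V by (intro Max_in) auto
    then obtain v where v: "v \<in> V" "M e = sgn_form n (a v) e" by auto
    have "G i e \<le> 4 * (a v i)\<^sup>2" if i: "i < n" for i
    proof -
      have "sgn_form n (a v) (flip i e) \<le> M (flip i e)"
        unfolding M_def using V v by (intro Max_ge) auto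
      moreover have "sgn_form n (a v) e - sgn_form n (a v) (flip i e) = 2 * (a v i * e i)"
      proof -
        have "sgn_form n (a v) e - sgn_form n (a v) (flip i e)
            = (\<Sum>j<n. if j = i then 2 * (a v i * e i) else 0)"
          unfolding sum_subtractf[symmetric] flip_def by (intro sum.cong) auto
        then show ?thesis using i by simp
      qed
      ultimately have "M e - M (flip i e) \<le> 2 * (a v i * e i)" using v by simp
      also have "\<dots> \<le> 2 * \<bar>a v i\<bar>"
        using signs_pm_one[OF e i] by auto
      finally have "max 0 (M e - M (flip i e)) \<le> 2 * \<bar>a v i\<bar>" by simp
      then have "G i e \<le> (2 * \<bar>a v i\<bar>)\<^sup>2" unfolding G_def by (intro power_mono) auto
      then show ?thesis by (simp add: power_mult_distrib)
    qed
    then have "(\<Sum>i<n. G i e) \<le> (\<Sum>i<n. 4 * (a v i)\<^sup>2)" by (intro sum_mono) auto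
    also have "\<dots> \<le> 4 * s" using s[OF v(1)] by (simp flip: sum_distrib_left)
    finally show ?thesis .
  qed
  have "(sign_avg n (\<lambda>e. \<bar>M e - sign_avg n M\<bar>))\<^sup>2 \<le> sign_avg n (\<lambda>e. \<bar>M e - sign_avg n M\<bar>\<^sup>2)"
    by (rule sign_avg_power2_le)
  also have "\<dots> \<le> (\<Sum>i<n. sign_avg n (\<lambda>e. (M (e(i := 1)) - M (e(i := -1)))\<^sup>2)) / 4"
    using sign_avg_variance_le[of n M] by simp
  also have "\<dots> = sign_avg n (\<lambda>e. \<Sum>i<n. G i e) / 2"
    by (simp add: pair sign_avg_sum flip: sum_distrib_left)
  also have "\<dots> \<le> sign_avg n (\<lambda>_. 4 * s) / 2"
    by (intro divide_right_mono sign_avg_mono G) auto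
  finally have "(sign_avg n (\<lambda>e. \<bar>M e - sign_avg n M\<bar>))\<^sup>2 \<le> 2 * s" by simp
  then show ?thesis by (rule real_le_rsqrt)
qed

section \<open>Minimax and fractional matchings\<close>

text \<open>A finite minimax theorem: if for every weighting of \<open>P\<close> some \<open>w\<close> is good for a fraction \<open>c\<close> of the
  weight, then some list of such \<open>w\<close>, read as a uniform distribution, is good for every \<open>e\<close> with
  probability at least \<open>c / 4\<close>. The list is chosen greedily while halving the weight of \<open>e\<close> whenever
  the chosen \<open>w\<close> is good for it. The total weight decays like \<open>(1 - c/2)\<^sup>T\<close>, and this is only possible
  if every single weight was halved often.\<close>

lemma multiplicative_weights:
  fixes P :: "'e set" and good :: "'w \<Rightarrow> 'e \<Rightarrow> bool"
  assumes P: "finite P" and c: "0 < c" "c \<le> 1"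
    and step: "\<And>\<nu> :: 'e \<Rightarrow> real. (\<And>e. 0 \<le> \<nu> e) \<Longrightarrow>
      \<exists>w. Q w \<and> c * sum \<nu> P \<le> sum \<nu> {e \<in> P. good w e}"
  shows "\<exists>ws. ws \<noteq> [] \<and> (\<forall>w\<in>set ws. Q w) \<and>
    (\<forall>e\<in>P. c / 4 * length ws \<le> length (filter (\<lambda>w. good w e) ws))"
proof -
  define cnt where "cnt = (\<lambda>ws e. length (filter (\<lambda>w. good w e) ws))"
  have run: "\<exists>ws. length ws = T \<and> (\<forall>w\<in>set ws. Q w) \<and>
      (\<Sum>e\<in>P. (1/2) ^ cnt ws e) \<le> card P * (1 - c/2) ^ T" for T
  proof (induction T)
    case 0
    show ?case by (intro exI[of _ "[]"]) (auto simp: cnt_def)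
  next
    case (Suc T)
    then obtain ws where ws: "length ws = T" "\<forall>w\<in>set ws. Q w"
      "(\<Sum>e\<in>P. (1/2) ^ cnt ws e) \<le> card P * (1 - c/2) ^ T" by auto
    define \<nu> where "\<nu> = (\<lambda>e. (1/2::real) ^ cnt ws e)"
    obtain w where w: "Q w" "c * sum \<nu> P \<le> sum \<nu> {e \<in> P. good w e}"
      using step[of \<nu>] by (auto simp: \<nu>_def)
    have "(\<Sum>e\<in>P. (1/2) ^ cnt (w # ws) e) = (\<Sum>e\<in>P. \<nu> e - (if good w e then \<nu> e / 2 else 0))"
      by (intro sum.cong) (auto simp: cnt_def \<nu>_def)
    also have "\<dots> = sum \<nu> P - sum \<nu> {e \<in> P. good w e} / 2"
      using P unfolding sum_subtractf sum_divide_distrib by (simp add: sum.inter_filter)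
    also have "\<dots> \<le> (1 - c/2) * sum \<nu> P"
      using w(2) by (simp add: algebra_simps)
    also have "\<dots> \<le> (1 - c/2) * (card P * (1 - c/2) ^ T)"
      using ws(3) c unfolding \<nu>_def by (intro mult_left_mono) auto
    finally show ?case
      using ws w by (intro exI[of _ "w # ws"]) (auto simp: algebra_simps)
  qed
  obtain T :: nat where T: "4 * ln (card P) / c + 1 \<le> T"
    using real_arch_simple by blast
  obtain ws where ws: "length ws = T" "\<forall>w\<in>set ws. Q w"
    "(\<Sum>e\<in>P. (1/2) ^ cnt ws e) \<le> card P * (1 - c/2) ^ T" using run by blast
  have "c / 4 * T \<le> cnt ws e" if e: "e \<in> P" for e
  proof -
    have card: "card P > 0" using P e by (auto simp: card_gt_0_iff)
    have "exp (- (ln 2 * cnt ws e)) = (1/2) ^ cnt ws e"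
    proof -
      have "(1/2::real) ^ cnt ws e = exp (ln (1/2)) ^ cnt ws e" by simp
      also have "\<dots> = exp (of_nat (cnt ws e) * ln (1/2))" by (simp add: exp_of_nat_mult)
      finally show ?thesis by (simp add: ln_div mult.commute)
    qed
    also have "\<dots> \<le> (\<Sum>e\<in>P. (1/2) ^ cnt ws e)"
      using P e by (intro member_le_sum) auto
    also have "\<dots> \<le> card P * (1 - c/2) ^ T" by (rule ws)
    also have "\<dots> \<le> exp (ln (card P)) * exp (- (c/2)) ^ T"
      using c card exp_ge_add_one_self[of "- (c/2)"] by (intro mult_mono power_mono) auto
    also have "\<dots> = exp (ln (card P) - c / 2 * T)"
      unfolding exp_of_nat_mult[symmetric] exp_add[symmetric] by (simp add: mult.commute)
    finally have "c / 2 * T - ln (card P) \<le> ln 2 * cnt ws e" by simp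
    also have "\<dots> \<le> 1 * real (cnt ws e)"
      using ln_le_minus_one[of 2] by (intro mult_right_mono) auto
    finally have "c / 2 * T - ln (card P) \<le> cnt ws e" by simp
    moreover have "ln (card P) \<le> c / 4 * T"
    proof -
      have "4 * ln (card P) / c \<le> T" using T by simp
      then show ?thesis using c by (simp add: field_simps)
    qed
    ultimately show ?thesis by simp
  qed
  moreover have "ws \<noteq> []"
  proof -
    have "0 \<le> ln (real (card P))" by (cases "card P = 0") auto
    then have "0 \<le> 4 * ln (card P) / c" using c by simp
    then have "T > 0" using T by linarith
    then show ?thesis using ws(1) by auto
  qed
  ultimately show ?thesis
    using ws by (intro exI[of _ ws]) (auto simp: cnt_def)
qed

text \<open>The edges are added one at a time, each with the largest value that its two endpoints still
  allow, after which one of them is saturated.\<close>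

lemma maximal_fractional_matching:
  fixes w :: "'a \<Rightarrow> real"
  assumes V: "finite V" and w: "\<And>x. x \<in> V \<Longrightarrow> 0 \<le> w x"
    and E: "E \<subseteq> V \<times> V" "\<And>x. (x, x) \<notin> E"
  shows "\<exists>\<mu>. (\<forall>x y. \<mu> x y = \<mu> y x) \<and> (\<forall>x y. 0 \<le> \<mu> x y) \<and>
    (\<forall>x y. \<mu> x y \<noteq> 0 \<longrightarrow> (x, y) \<in> E \<or> (y, x) \<in> E) \<and>
    (\<forall>x\<in>V. (\<Sum>y\<in>V. \<mu> x y) \<le> w x) \<and>
    (\<forall>x y. (x, y) \<in> E \<longrightarrow> (\<Sum>z\<in>V. \<mu> x z) = w x \<or> (\<Sum>z\<in>V. \<mu> y z) = w y)"
proof -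
  have "finite E" using E V by (meson finite_SigmaI finite_subset)
  then show ?thesis using E
  proof (induction E rule: finite_induct)
    case empty
    show ?case using w by (intro exI[of _ "\<lambda>_ _. 0"]) auto
  next
    case (insert ab E)
    obtain a b where ab: "ab = (a, b)" by (cases ab)
    have ab': "a \<in> V" "b \<in> V" "a \<noteq> b" using insert.prems ab by auto
    obtain \<mu> where \<mu>: "\<And>x y. \<mu> x y = \<mu> y x" "\<And>x y. 0 \<le> \<mu> x y"
      "\<And>x y. \<mu> x y \<noteq> 0 \<Longrightarrow> (x, y) \<in> E \<or> (y, x) \<in> E"
      "\<And>x. x \<in> V \<Longrightarrow> (\<Sum>y\<in>V. \<mu> x y) \<le> w x"
      "\<And>x y. (x, y) \<in> E \<Longrightarrow> (\<Sum>z\<in>V. \<mu> x z) = w x \<or> (\<Sum>z\<in>V. \<mu> y z) = w y"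
    proof -
      have "E \<subseteq> V \<times> V" "\<And>x. (x, x) \<notin> E" using insert.prems by auto
      from insert.IH[OF this] show ?thesis using that by metis
    qed
    define r where "r = min (w a - (\<Sum>z\<in>V. \<mu> a z)) (w b - (\<Sum>z\<in>V. \<mu> b z))"
    have r: "0 \<le> r" using \<mu>(4) ab' by (auto simp: r_def)
    define \<mu>' where "\<mu>' = (\<lambda>x y. \<mu> x y + (if x = a \<and> y = b \<or> x = b \<and> y = a then r else 0))"
    have row: "(\<Sum>y\<in>V. \<mu>' x y) = (\<Sum>y\<in>V. \<mu> x y) + (if x = a \<or> x = b then r else 0)" for x
      using V ab' by (auto simp: \<mu>'_def sum.distrib)
    have sat: "(\<Sum>z\<in>V. \<mu>' x z) = w x \<or> (\<Sum>z\<in>V. \<mu>' y z) = w y" if "(x, y) \<in> insert ab E" for x y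
    proof (cases "(x, y) = ab")
      case True
      then show ?thesis using ab by (auto simp: row r_def min_def)
    next
      case False
      have tight: "r = 0" if "(\<Sum>z\<in>V. \<mu> a z) = w a \<or> (\<Sum>z\<in>V. \<mu> b z) = w b"
        using that r unfolding r_def by auto
      have "(\<Sum>z\<in>V. \<mu> x z) = w x \<or> (\<Sum>z\<in>V. \<mu> y z) = w y"
        using False that \<mu>(5) by auto
      then show ?thesis using tight by (auto simp: row)
    qed
    have le: "(\<Sum>y\<in>V. \<mu>' x y) \<le> w x" if "x \<in> V" for x
      using \<mu>(4)[OF that] by (auto simp: row r_def)
    have "\<mu>' x y = \<mu>' y x" for x y
      using \<mu>(1)[of x y] by (auto simp: \<mu>'_def)
    moreover have "0 \<le> \<mu>' x y" for x y
      using \<mu>(2)[of x y] r by (simp add: \<mu>'_def)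
    moreover have "(x, y) \<in> insert ab E \<or> (y, x) \<in> insert ab E" if "\<mu>' x y \<noteq> 0" for x y
      using that \<mu>(3)[of x y] ab by (auto simp: \<mu>'_def split: if_splits)
    ultimately show ?case
      using le sat by (intro exI[of _ \<mu>']) blast
  qed
qed

section \<open>Separated sets in metrics of negative type\<close>

text \<open>The chaining step. Here \<open>u e x\<close> is the projection of \<open>x\<close>, and \<open>H p x e\<close> is the largest gain in
  projection from \<open>x\<close> to a point within distance \<open>p \<sigma>\<close>. Each bad pair in the matching, oriented upwards
  from \<open>x\<close> to \<open>y\<close>, lets \<open>x\<close> first move to \<open>y\<close>, with gain at least \<open>h\<close>, and then use the best move
  from \<open>y\<close>. This replaces \<open>H p x\<close> by \<open>h + H p y\<close>, which would be useless if \<open>y\<close> had systematically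
  worse moves than \<open>x\<close>. That is excluded on average: bad pairs, and hence the matching, are the same for
  \<open>e\<close> and \<open>-e\<close>, but all orientations are reversed, so differences of the means of \<open>H p\<close> cancel.
  The deviations of \<open>H p\<close> from its mean cost \<open>\<surd>(2 p \<sigma>)\<close>, by \<open>sign_avg_Max_deviation_le\<close>.\<close>

lemma sign_avg_chaining:
  fixes d :: "'a \<Rightarrow> 'a \<Rightarrow> real" and f :: "nat \<Rightarrow> 'a \<Rightarrow> real"
  assumes N: "finite N" and w: "\<And>x. x \<in> N \<Longrightarrow> 0 \<le> w x"
    and d: "\<And>x y. x \<in> N \<Longrightarrow> y \<in> N \<Longrightarrow> d x y = (\<Sum>i<n. (f i x - f i y)\<^sup>2)"
    and tri: "\<And>x y z. x \<in> N \<Longrightarrow> y \<in> N \<Longrightarrow> z \<in> N \<Longrightarrow> d x z \<le> d x y + d y z"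
    and pos: "0 < \<sigma>" "0 < h"
  defines "u \<equiv> \<lambda>e x. sgn_form n (\<lambda>i. f i x) e"
  defines "H \<equiv> \<lambda>p x e. MAX y \<in> {y \<in> N. d x y \<le> real p * \<sigma>}. sgn_form n (\<lambda>i. f i y - f i x) e"
  shows "\<exists>sat. (\<forall>e x y. x \<in> N \<longrightarrow> y \<in> N \<longrightarrow> d x y < \<sigma> \<longrightarrow> h \<le> \<bar>u e x - u e y\<bar> \<longrightarrow> x \<in> sat e \<or> y \<in> sat e)
    \<and> (\<forall>p. (\<Sum>x\<in>N. w x * sign_avg n (H p x)) + h / 2 * sign_avg n (\<lambda>e. \<Sum>x\<in>N \<inter> sat e. w x)
          - sqrt (2 * (p * \<sigma>)) * (\<Sum>x\<in>N. w x) \<le> (\<Sum>x\<in>N. w x * sign_avg n (H (Suc p) x)))"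
proof -
  define E where "E = (\<lambda>e. {(x, y). x \<in> N \<and> y \<in> N \<and> d x y < \<sigma> \<and> h \<le> \<bar>u e x - u e y\<bar>})"
  define ok where "ok = (\<lambda>E \<mu>. (\<forall>x y. \<mu> x y = \<mu> y x) \<and> (\<forall>x y. (0::real) \<le> \<mu> x y) \<and>
    (\<forall>x y. \<mu> x y \<noteq> 0 \<longrightarrow> (x, y) \<in> E \<or> (y, x) \<in> E) \<and>
    (\<forall>x\<in>N. (\<Sum>y\<in>N. \<mu> x y) \<le> w x) \<and>
    (\<forall>x y. (x, y) \<in> E \<longrightarrow> (\<Sum>z\<in>N. \<mu> x z) = w x \<or> (\<Sum>z\<in>N. \<mu> y z) = w y))"
  define m where "m = (\<lambda>e. SOME \<mu>. ok (E e) \<mu>)"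
  have "ok (E e) (m e)" for e
  proof -
    have "\<exists>\<mu>. ok (E e) \<mu>"
      unfolding ok_def
    proof (rule maximal_fractional_matching)
      show "finite N" "\<And>x. x \<in> N \<Longrightarrow> 0 \<le> w x"
        using N w by auto
      show "E e \<subseteq> N \<times> N" by (auto simp: E_def)
      show "\<And>x. (x, x) \<notin> E e" using pos by (auto simp: E_def)
    qed
    from someI_ex[OF this] show ?thesis by (simp add: m_def)
  qed
  then have m_sym: "m e x y = m e y x" and m_nonneg: "0 \<le> m e x y"
    and m_supp: "m e x y \<noteq> 0 \<Longrightarrow> (x, y) \<in> E e \<or> (y, x) \<in> E e"
    and m_row: "x \<in> N \<Longrightarrow> (\<Sum>y\<in>N. m e x y) \<le> w x"
    and m_sat: "(x, y) \<in> E e \<Longrightarrow> (\<Sum>z\<in>N. m e x z) = w x \<or> (\<Sum>z\<in>N. m e y z) = w y" for e x y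
    unfolding ok_def by blast+
  have d_sym: "d x y = d y x" if "x \<in> N" "y \<in> N" for x y
    using that by (simp add: d power2_commute)
  have d_self: "d x x = 0" if "x \<in> N" for x
    using that by (simp add: d)
  have u_neg: "u (\<lambda>i. - e i) x = - u e x" for e x
    by (simp add: u_def sum_negf)
  have E_neg: "E (\<lambda>i. - e i) = E e" for e
    by (auto simp: E_def u_neg)
  have m_neg: "m (\<lambda>i. - e i) = m e" for e
    by (simp add: m_def E_neg)
  have u_diff: "sgn_form n (\<lambda>i. f i y - f i x) e = u e y - u e x" for x y e
    by (simp add: u_def left_diff_distrib sum_subtractf)
  have m_edge: "x \<in> N \<and> y \<in> N \<and> d x y < \<sigma> \<and> h \<le> \<bar>u e x - u e y\<bar>" if "m e x y \<noteq> 0" for e x y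
    using m_supp[OF that] d_sym by (auto simp: E_def abs_minus_commute)
  define t where "t = (\<lambda>e x y. if u e x < u e y then m e x y else 0)"
  have t_nonneg: "0 \<le> t e x y" for e x y by (simp add: t_def m_nonneg)
  have t_neg: "t (\<lambda>i. - e i) x y = t e y x" for e x y
    by (simp add: t_def u_neg m_neg m_sym[of e x y])
  have t_sum: "t e x y + t e y x = m e x y" for e x y
  proof (cases "m e x y = 0")
    case True
    then show ?thesis using m_sym[of e x y] by (simp add: t_def)
  next
    case False
    then show ?thesis using m_edge[OF False] pos m_sym[of e x y] by (auto simp: t_def)
  qed
  have t_row: "(\<Sum>y\<in>N. t e x y) \<le> w x" if "x \<in> N" for e x
  proof -
    have "(\<Sum>y\<in>N. t e x y) \<le> (\<Sum>y\<in>N. m e x y)"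
      by (intro sum_mono) (auto simp: t_def m_nonneg)
    then show ?thesis using m_row[OF that, of e] by linarith
  qed
  define sat where "sat = (\<lambda>e. {x. (\<Sum>y\<in>N. m e x y) = w x})"
  have H_ge: "u e y - u e x \<le> H p x e" if "x \<in> N" "y \<in> N" "d x y \<le> real p * \<sigma>" for x y e p
    unfolding H_def u_diff[symmetric] using that N by (intro Max_ge) auto
  have H_attained: "\<exists>y\<in>N. d x y \<le> real p * \<sigma> \<and> H p x e = u e y - u e x" if "x \<in> N" for x e p
  proof -
    have "H p x e \<in> (\<lambda>y. sgn_form n (\<lambda>i. f i y - f i x) e) ` {y \<in> N. d x y \<le> real p * \<sigma>}"
      unfolding H_def using N that pos d_self[OF that] by (intro Max_in) auto
    then show ?thesis by (auto simp: u_diff)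
  qed
  have H_mono: "H p x e \<le> H (Suc p) x e" if x: "x \<in> N" for x e p
  proof -
    obtain y where y: "y \<in> N" "d x y \<le> real p * \<sigma>" "H p x e = u e y - u e x"
      using H_attained[OF x] by blast
    then show ?thesis using H_ge[OF x y(1), of "Suc p" e] pos by (auto simp: algebra_simps)
  qed
  have H_step: "h + H p y e \<le> H (Suc p) x e" if t: "t e x y \<noteq> 0" for e x y p
  proof -
    have *: "m e x y \<noteq> 0" "u e x < u e y" using t by (auto simp: t_def split: if_splits)
    then have xy: "x \<in> N" "y \<in> N" "d x y < \<sigma>" "h \<le> u e y - u e x" using m_edge[OF *(1)] by auto
    obtain z where z: "z \<in> N" "d y z \<le> real p * \<sigma>" "H p y e = u e z - u e y"
      using H_attained[OF xy(2)] by blast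
    have "d x z \<le> real (Suc p) * \<sigma>" using tri[OF xy(1,2) z(1)] xy z by (simp add: algebra_simps)
    from H_ge[OF xy(1) z(1) this, of e] show ?thesis using z xy by simp
  qed
  have "(\<Sum>x\<in>N. w x * sign_avg n (H p x)) + h / 2 * sign_avg n (\<lambda>e. \<Sum>x\<in>N \<inter> sat e. w x)
          - sqrt (2 * (p * \<sigma>)) * (\<Sum>x\<in>N. w x) \<le> (\<Sum>x\<in>N. w x * sign_avg n (H (Suc p) x))" for p
  proof -
    define F where "F = (\<lambda>x. sign_avg n (H p x))"
    define R where "R = (\<lambda>x e. H p x e - F x)"
    define A where "A = (\<lambda>e. \<Sum>x\<in>N. \<Sum>y\<in>N. t e x y * (F y - F x))"
    have A_neg: "A (\<lambda>i. - e i) = - A e" for e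
    proof -
      have "A (\<lambda>i. - e i) = (\<Sum>x\<in>N. \<Sum>y\<in>N. t e y x * (F y - F x))" by (simp add: A_def t_neg)
      also have "\<dots> = (\<Sum>x\<in>N. \<Sum>y\<in>N. t e x y * (F x - F y))" by (rule sum.swap)
      also have "\<dots> = - A e" unfolding A_def sum_negf[symmetric]
        by (intro sum.cong refl) (simp add: algebra_simps)
      finally show ?thesis .
    qed
    \<comment> \<open>The antisymmetry under reversal of all signs replaces a pointwise comparison of the means \<open>F\<close>.\<close>
    have A_avg: "sign_avg n A = 0"
      using sign_avg_neg[of n A] sign_avg_cmult[of n "-1" A] by (simp add: A_neg)
    have pointwise: "(\<Sum>x\<in>N. w x * H p x e) + h / 2 * (\<Sum>x\<in>N \<inter> sat e. w x) + A e
        - (\<Sum>x\<in>N. w x * \<bar>R x e\<bar>) \<le> (\<Sum>x\<in>N. w x * H (Suc p) x e)" for e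
    proof -
      have 1: "w x * H p x e + (\<Sum>y\<in>N. t e x y * (h + H p y e - H p x e)) \<le> w x * H (Suc p) x e"
        if x: "x \<in> N" for x
      proof -
        have "(\<Sum>y\<in>N. t e x y * (h + H p y e)) \<le> (\<Sum>y\<in>N. t e x y * H (Suc p) x e)"
        proof (intro sum_mono)
          fix y show "t e x y * (h + H p y e) \<le> t e x y * H (Suc p) x e"
            using H_step[of e x y p] t_nonneg[of e x y]
            by (cases "t e x y = 0") (auto intro!: mult_left_mono)
        qed
        moreover have "(w x - (\<Sum>y\<in>N. t e x y)) * H p x e \<le> (w x - (\<Sum>y\<in>N. t e x y)) * H (Suc p) x e"
          using t_row[OF x, of e] by (intro mult_left_mono H_mono x) auto
        ultimately show ?thesis
          by (simp add: algebra_simps sum.distrib sum_subtractf sum_distrib_left sum_distrib_right)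
      qed
      have "(\<Sum>x\<in>N. w x * H p x e) + (\<Sum>x\<in>N. \<Sum>y\<in>N. t e x y * (h + H p y e - H p x e))
          \<le> (\<Sum>x\<in>N. w x * H (Suc p) x e)"
        unfolding sum.distrib[symmetric] by (intro sum_mono 1)
      moreover have "(\<Sum>x\<in>N. \<Sum>y\<in>N. t e x y * (h + H p y e - H p x e))
          = h * (\<Sum>x\<in>N. \<Sum>y\<in>N. t e x y) + A e + (\<Sum>x\<in>N. \<Sum>y\<in>N. t e x y * (R y e - R x e))"
        unfolding A_def sum_distrib_left sum.distrib[symmetric]
        by (intro sum.cong refl) (simp add: R_def algebra_simps)
      moreover have "- (\<Sum>x\<in>N. w x * \<bar>R x e\<bar>) \<le> (\<Sum>x\<in>N. \<Sum>y\<in>N. t e x y * (R y e - R x e))"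
      proof -
        have "(\<Sum>x\<in>N. \<Sum>y\<in>N. t e x y * \<bar>R y e\<bar>) = (\<Sum>x\<in>N. \<Sum>y\<in>N. t e y x * \<bar>R x e\<bar>)"
          by (rule sum.swap)
        then have "(\<Sum>x\<in>N. \<Sum>y\<in>N. t e x y * (\<bar>R y e\<bar> + \<bar>R x e\<bar>))
            = (\<Sum>x\<in>N. \<Sum>y\<in>N. (t e x y + t e y x) * \<bar>R x e\<bar>)"
          by (simp add: algebra_simps sum.distrib)
        also have "\<dots> = (\<Sum>x\<in>N. (\<Sum>y\<in>N. m e x y) * \<bar>R x e\<bar>)"
          by (simp add: t_sum sum_distrib_right)
        also have "\<dots> \<le> (\<Sum>x\<in>N. w x * \<bar>R x e\<bar>)"
          by (intro sum_mono mult_right_mono m_row) auto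
        finally have "- (\<Sum>x\<in>N. w x * \<bar>R x e\<bar>) \<le> (\<Sum>x\<in>N. \<Sum>y\<in>N. - (t e x y * (\<bar>R y e\<bar> + \<bar>R x e\<bar>)))"
          by (simp add: sum_negf)
        also have "\<dots> \<le> (\<Sum>x\<in>N. \<Sum>y\<in>N. t e x y * (R y e - R x e))"
        proof (intro sum_mono)
          fix x y
          have "t e x y * (- (\<bar>R y e\<bar> + \<bar>R x e\<bar>)) \<le> t e x y * (R y e - R x e)"
            using t_nonneg by (intro mult_left_mono) auto
          then show "- (t e x y * (\<bar>R y e\<bar> + \<bar>R x e\<bar>)) \<le> t e x y * (R y e - R x e)"
            by (simp add: algebra_simps)
        qed
        finally show ?thesis .
      qed
      moreover have "(\<Sum>x\<in>N \<inter> sat e. w x) \<le> 2 * (\<Sum>x\<in>N. \<Sum>y\<in>N. t e x y)"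
      proof -
        have "(\<Sum>x\<in>N \<inter> sat e. w x) = (\<Sum>x\<in>N \<inter> sat e. \<Sum>y\<in>N. m e x y)"
          by (intro sum.cong) (auto simp: sat_def)
        also have "\<dots> \<le> (\<Sum>x\<in>N. \<Sum>y\<in>N. m e x y)"
          using N by (intro sum_mono2) (auto intro!: sum_nonneg m_nonneg)
        also have "\<dots> = (\<Sum>x\<in>N. \<Sum>y\<in>N. t e x y) + (\<Sum>x\<in>N. \<Sum>y\<in>N. t e y x)"
          by (simp add: sum.distrib flip: t_sum)
        also have "(\<Sum>x\<in>N. \<Sum>y\<in>N. t e y x) = (\<Sum>x\<in>N. \<Sum>y\<in>N. t e x y)" by (rule sum.swap)
        finally show ?thesis by simp
      qed
      then have "h / 2 * (\<Sum>x\<in>N \<inter> sat e. w x) \<le> h * (\<Sum>x\<in>N. \<Sum>y\<in>N. t e x y)"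
        using pos mult_left_mono[of _ "2 * (\<Sum>x\<in>N. \<Sum>y\<in>N. t e x y)" "h / 2"] by simp
      ultimately show ?thesis by linarith
    qed
    have "sign_avg n (\<lambda>e. (\<Sum>x\<in>N. w x * H p x e) + h / 2 * (\<Sum>x\<in>N \<inter> sat e. w x) + A e
        - (\<Sum>x\<in>N. w x * \<bar>R x e\<bar>)) \<le> sign_avg n (\<lambda>e. \<Sum>x\<in>N. w x * H (Suc p) x e)"
      by (intro sign_avg_mono pointwise)
    then have "(\<Sum>x\<in>N. w x * sign_avg n (H p x)) + h / 2 * sign_avg n (\<lambda>e. \<Sum>x\<in>N \<inter> sat e. w x)
        - (\<Sum>x\<in>N. w x * sign_avg n (\<lambda>e. \<bar>R x e\<bar>)) \<le> (\<Sum>x\<in>N. w x * sign_avg n (H (Suc p) x))"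
      unfolding sign_avg_diff sign_avg_add sign_avg_cmult sign_avg_sum A_avg by simp
    moreover have "(\<Sum>x\<in>N. w x * sign_avg n (\<lambda>e. \<bar>R x e\<bar>)) \<le> (\<Sum>x\<in>N. w x * sqrt (2 * (p * \<sigma>)))"
    proof (intro sum_mono mult_left_mono w)
      fix x assume x: "x \<in> N"
      show "sign_avg n (\<lambda>e. \<bar>R x e\<bar>) \<le> sqrt (2 * (p * \<sigma>))"
        unfolding R_def F_def H_def
      proof (rule sign_avg_Max_deviation_le)
        show "finite {y \<in> N. d x y \<le> real p * \<sigma>}" using N by auto
        show "{y \<in> N. d x y \<le> real p * \<sigma>} \<noteq> {}" using x d_self[OF x] pos by auto
        show "(\<Sum>i<n. (f i v - f i x)\<^sup>2) \<le> real p * \<sigma>" if "v \<in> {y \<in> N. d x y \<le> real p * \<sigma>}" for v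
          using that x d[of x v] by (simp add: power2_commute)
      qed
    qed
    moreover have "(\<Sum>x\<in>N. w x * sqrt (2 * (p * \<sigma>))) = sqrt (2 * (p * \<sigma>)) * (\<Sum>x\<in>N. w x)"
      by (subst mult.commute) (simp add: sum_distrib_right)
    ultimately show ?thesis by linarith
  qed
  moreover have "x \<in> sat e \<or> y \<in> sat e"
    if "x \<in> N" "y \<in> N" "d x y < \<sigma>" "h \<le> \<bar>u e x - u e y\<bar>" for e x y
    using m_sat[of x y e] that by (auto simp: E_def sat_def)
  ultimately show ?thesis by (intro exI[of _ sat]) blast
qed

text \<open>A quadratic polynomial in the squared sum lies below the indicator of the event, and its average is
  controlled by the second and fourth moments.\<close>

lemma sign_avg_spread:
  assumes D: "0 < D" "(\<Sum>i<n. (a i)\<^sup>2) = D"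
  shows "1/5 \<le> sign_avg n (\<lambda>e. of_bool (D / 8 \<le> (sgn_form n a e)\<^sup>2 \<and> (sgn_form n a e)\<^sup>2 \<le> 10 * D))"
proof -
  define q where "q = (\<lambda>t::real. (81/8 * (t / D) - (t / D)\<^sup>2 - 5/4) / 25)"
  have q: "q t \<le> of_bool (D / 8 \<le> t \<and> t \<le> 10 * D)" for t
  proof -
    have eq: "q t = - (t / D - 1/8) * (t / D - 10) / 25"
      unfolding q_def by algebra
    show ?thesis
    proof (cases "D / 8 \<le> t \<and> t \<le> 10 * D")
      case True
      have "25 * q t = 6241/256 - (t / D - 81/16)\<^sup>2" unfolding q_def by algebra
      moreover have "0 \<le> (t / D - 81/16)\<^sup>2" by simp
      ultimately have "q t \<le> 1" by linarith
      then show ?thesis using True by simp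
    next
      case False
      then have "t / D \<le> 1/8 \<or> 10 \<le> t / D" using D(1) by (auto simp: field_simps)
      then have "0 \<le> (t / D - 1/8) * (t / D - 10)"
        unfolding zero_le_mult_iff by linarith
      moreover have "q t = (-1/25) * ((t / D - 1/8) * (t / D - 10))" unfolding eq by algebra
      ultimately have "q t \<le> 0" by (simp only: mult_nonpos_nonneg)
      then show ?thesis by (rule order_trans) simp
    qed
  qed
  have "1/5 \<le> (81/8 - 3 - 5/4) / (25::real)" by simp
  also have "\<dots> \<le> sign_avg n (\<lambda>e. q ((sgn_form n a e)\<^sup>2))"
  proof -
    have "sign_avg n (\<lambda>e. q ((sgn_form n a e)\<^sup>2))
        = (81/8 * (sign_avg n (\<lambda>e. (sgn_form n a e)\<^sup>2) / D)
           - sign_avg n (\<lambda>e. (sgn_form n a e) ^ 4) / D\<^sup>2 - 5/4) / 25"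
      unfolding q_def sign_avg_divide sign_avg_diff sign_avg_cmult sign_avg_const power_divide
      by (simp add: power_mult[symmetric])
    moreover have "sign_avg n (\<lambda>e. (sgn_form n a e) ^ 4) / D\<^sup>2 \<le> 3"
      using sign_avg_fourth_moment[of n a] D by (simp add: field_simps)
    ultimately show ?thesis using D by (simp add: sign_avg_second_moment)
  qed
  also have "\<dots> \<le> sign_avg n (\<lambda>e. of_bool (D / 8 \<le> (sgn_form n a e)\<^sup>2 \<and> (sgn_form n a e)\<^sup>2 \<le> 10 * D))"
    by (intro sign_avg_mono q)
  finally show ?thesis .
qed

text \<open>If more than a fortieth of the weight was saturated, each chaining step would increase the average
  gain by \<open>h / 160\<close>, as long as the deviation term is below \<open>h / 160\<close>. Within \<open>4000 \<surd>g\<close>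
  steps the gain would exceed the bound that \<open>sign_avg_Max_le\<close> gives for \<open>4\<^sup>g\<close> points at distance
  at most \<open>\<Delta>\<close>.\<close>

lemma few_saturated:
  fixes d :: "'a \<Rightarrow> 'a \<Rightarrow> real" and f :: "nat \<Rightarrow> 'a \<Rightarrow> real"
  assumes N: "finite N" and w: "\<And>x. x \<in> N \<Longrightarrow> 0 \<le> w x"
    and d: "\<And>x y. x \<in> N \<Longrightarrow> y \<in> N \<Longrightarrow> d x y = (\<Sum>i<n. (f i x - f i y)\<^sup>2)"
    and tri: "\<And>x y z. x \<in> N \<Longrightarrow> y \<in> N \<Longrightarrow> z \<in> N \<Longrightarrow> d x z \<le> d x y + d y z"
    and pos: "0 < \<Delta>" "1 \<le> g"
    and card: "\<And>x. x \<in> N \<Longrightarrow> real (card {y \<in> N. d x y \<le> \<Delta>}) \<le> 4 powr g"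
  defines "u \<equiv> \<lambda>e x. sgn_form n (\<lambda>i. f i x) e"
    and "\<sigma> \<equiv> \<Delta> / (3 * 10 ^ 10 * sqrt g)"
  shows "\<exists>sat. (\<forall>e x y. x \<in> N \<longrightarrow> y \<in> N \<longrightarrow> d x y < \<sigma> \<longrightarrow> sqrt \<Delta> / 12 \<le> \<bar>u e x - u e y\<bar> \<longrightarrow> x \<in> sat e \<or> y \<in> sat e)
    \<and> sign_avg n (\<lambda>e. \<Sum>x\<in>N \<inter> sat e. w x) \<le> (\<Sum>x\<in>N. w x) / 40"
proof -
  define h where "h = sqrt \<Delta> / 12"
  define W where "W = (\<Sum>x\<in>N. w x)"
  define H where "H = (\<lambda>p x e. MAX y \<in> {y \<in> N. d x y \<le> real p * \<sigma>}. sgn_form n (\<lambda>i. f i y - f i x) e)"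
  define \<Phi> where "\<Phi> = (\<lambda>p. \<Sum>x\<in>N. w x * sign_avg n (H p x))"
  have \<sigma>: "0 < \<sigma>" using pos by (simp add: \<sigma>_def)
  have h: "0 < h" using pos by (simp add: h_def)
  have d_self: "d x x = 0" if "x \<in> N" for x using that by (simp add: d)
  obtain sat where sat: "\<And>e x y. x \<in> N \<Longrightarrow> y \<in> N \<Longrightarrow> d x y < \<sigma> \<Longrightarrow> h \<le> \<bar>u e x - u e y\<bar> \<Longrightarrow> x \<in> sat e \<or> y \<in> sat e"
    and step: "\<And>p. \<Phi> p + h / 2 * sign_avg n (\<lambda>e. \<Sum>x\<in>N \<inter> sat e. w x) - sqrt (2 * (p * \<sigma>)) * W \<le> \<Phi> (Suc p)"
  proof -
    have "\<exists>sat. (\<forall>e x y. x \<in> N \<longrightarrow> y \<in> N \<longrightarrow> d x y < \<sigma> \<longrightarrow> h \<le> \<bar>u e x - u e y\<bar> \<longrightarrow> x \<in> sat e \<or> y \<in> sat e)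
      \<and> (\<forall>p. \<Phi> p + h / 2 * sign_avg n (\<lambda>e. \<Sum>x\<in>N \<inter> sat e. w x) - sqrt (2 * (p * \<sigma>)) * W \<le> \<Phi> (Suc p))"
      unfolding \<Phi>_def W_def H_def u_def
      by (rule sign_avg_chaining[where f = f]) (use N w d tri \<sigma> h in auto)
    then show ?thesis using that by blast
  qed
  define s where "s = sign_avg n (\<lambda>e. \<Sum>x\<in>N \<inter> sat e. w x)"
  have "s \<le> W / 40"
  proof (rule ccontr)
    assume "\<not> s \<le> W / 40"
    then have s: "W / 40 < s" by simp
    have W0: "0 \<le> W" unfolding W_def by (intro sum_nonneg w)
    have W: "0 < W"
    proof (rule ccontr)
      assume "\<not> 0 < W"
      then have "W = 0" using W0 by simp
      then have "w x = 0" if "x \<in> N" for x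
        using that N w unfolding W_def by (subst (asm) sum_nonneg_eq_0_iff) auto
      then have "s = 0" unfolding s_def by simp
      then show False using s \<open>W = 0\<close> by simp
    qed
    \<comment> \<open>\<open>P\<close> steps of gain \<open>h / 160 = \<surd>\<Delta> / 1920\<close> exceed the bound \<open>2 \<surd>(g \<Delta>)\<close>, while the constant in \<open>\<sigma>\<close> is so
      large that \<open>2 P \<sigma> \<le> (h / 160)\<^sup>2\<close>.\<close>
    define P where "P = nat \<lceil>4000 * sqrt g\<rceil>"
    have g1: "1 \<le> sqrt g" using pos by simp
    have P_ge: "4000 * sqrt g \<le> P" and P_le: "P \<le> 4001 * sqrt g"
      using g1 unfolding P_def by linarith+
    have P\<sigma>: "P * \<sigma> \<le> \<Delta> / 7372800"
    proof -
      have "P * \<sigma> \<le> (4001 * sqrt g) * \<sigma>" using P_le \<sigma> by (intro mult_right_mono) auto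
      also have "\<dots> = 4001 * \<Delta> / (3 * 10 ^ 10)" using g1 pos by (simp add: \<sigma>_def field_simps)
      also have "\<dots> \<le> \<Delta> / 7372800" using pos by simp
      finally show ?thesis .
    qed
    have grow: "p * (W * (h / 160)) \<le> \<Phi> p" if "p \<le> P" for p
      using that
    proof (induction p)
      case 0
      have "0 \<le> \<Phi> 0" unfolding \<Phi>_def
      proof (intro sum_nonneg mult_nonneg_nonneg w sign_avg_nonneg)
        fix x e assume x: "x \<in> N"
        have "sgn_form n (\<lambda>i. f i x - f i x) e \<le> H 0 x e"
          unfolding H_def using x N d_self by (intro Max_ge imageI finite_imageI) auto
        then show "0 \<le> H 0 x e" by simp
      qed
      then show ?case by simp
    next
      case (Suc p)
      have "sqrt (2 * (p * \<sigma>)) \<le> h / 160"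
      proof (rule real_le_lsqrt)
        have "p * \<sigma> \<le> P * \<sigma>" using Suc.prems \<sigma> by (intro mult_right_mono) auto
        then have "2 * (p * \<sigma>) \<le> \<Delta> / 3686400" using P\<sigma> by simp
        also have "\<dots> = (h / 160)\<^sup>2" using pos by (simp add: h_def power_divide)
        finally show "2 * (p * \<sigma>) \<le> (h / 160)\<^sup>2" .
      qed (use h \<sigma> in auto)
      then have "sqrt (2 * (p * \<sigma>)) * W \<le> h / 160 * W" using W by (intro mult_right_mono) auto
      moreover have "h / 80 * W \<le> h / 2 * s" using s h by (simp add: field_simps)
      ultimately have "\<Phi> p + W * (h / 160) \<le> \<Phi> (Suc p)" using step[of p, folded s_def] by (simp add: mult.commute)
      then show ?case using Suc by (simp add: algebra_simps)
    qed
    have "\<Phi> P \<le> (\<Sum>x\<in>N. w x * (2 * (sqrt g * sqrt \<Delta>)))"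
      unfolding \<Phi>_def
    proof (intro sum_mono mult_left_mono w)
      fix x assume x: "x \<in> N"
      let ?B = "{y \<in> N. d x y \<le> P * \<sigma>}"
      define l where "l = sqrt g / sqrt \<Delta>"
      have l: "0 < l" using pos by (simp add: l_def)
      have ne: "?B \<noteq> {}" using x d_self[OF x] \<sigma> by auto
      have "sign_avg n (H P x) \<le> ln (card ?B) / l + l * \<Delta> / 2"
        unfolding H_def
      proof (rule sign_avg_Max_le)
        show "(\<Sum>i<n. (f i v - f i x)\<^sup>2) \<le> \<Delta>" if "v \<in> ?B" for v
        proof -
          have "(\<Sum>i<n. (f i v - f i x)\<^sup>2) = d x v"
            using that x d[of x v] by (simp add: power2_commute)
          also have "\<dots> \<le> P * \<sigma>" using that by simp
          also have "\<dots> \<le> \<Delta>" using P\<sigma> pos by linarith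
          finally show ?thesis .
        qed
      qed (use N ne l in auto)
      also have "ln (card ?B) \<le> g * 3/2"
      proof -
        have "card ?B \<le> card {y \<in> N. d x y \<le> \<Delta>}"
          using N P\<sigma> pos by (intro card_mono) auto
        then have "real (card ?B) \<le> 4 powr g" using card[OF x] by linarith
        moreover have "0 < card ?B" using ne N by (auto simp: card_gt_0_iff)
        ultimately have "ln (card ?B) \<le> ln (4 powr g)" by (subst ln_le_cancel_iff) auto
        also have "\<dots> = g * (2 * ln 2)"
          using ln_realpow[of "2::real" 2] by (simp add: ln_powr)
        also have "\<dots> \<le> g * (3/2)"
          using pos ln2_le_25_over_36 by (intro mult_left_mono) auto
        finally show ?thesis by simp
      qed
      also have "g * 3 / 2 / l + l * \<Delta> / 2 = 2 * (sqrt g * sqrt \<Delta>)"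
      proof -
        define a b where "a = sqrt g" and "b = sqrt \<Delta>"
        have "g = a * a" "\<Delta> = b * b" "0 < a" "0 < b" using pos by (simp_all add: a_def b_def)
        then show ?thesis unfolding l_def a_def[symmetric] b_def[symmetric]
          by (simp add: field_simps)
      qed
      finally show "sign_avg n (H P x) \<le> 2 * (sqrt g * sqrt \<Delta>)" using l by (simp add: divide_right_mono)
    qed
    also have "\<dots> = W * (2 * (sqrt g * sqrt \<Delta>))" by (simp add: W_def sum_distrib_right)
    finally have "P * (W * (h / 160)) \<le> W * (2 * (sqrt g * sqrt \<Delta>))" using grow[of P] by simp
    then have "W * (P * sqrt \<Delta>) \<le> W * (3840 * sqrt g * sqrt \<Delta>)"
      by (simp add: h_def ac_simps)
    then have "real P \<le> 3840 * sqrt g" using W pos by simp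
    then show False using P_ge g1 by linarith
  qed
  then show ?thesis using sat unfolding s_def W_def h_def by blast
qed

text \<open>The existence for every weighting of the pairs suffices, by \<open>multiplicative_weights\<close>. For a given
  weighting, some sign pattern gives a constant fraction of the weight to pairs that are well spread and
  unsaturated. On unsaturated points, being closer than \<open>\<sigma>\<close> means that the projections
  differ by less than \<open>h\<close>; so the unsaturated points whose projection lies in one of a periodic
  family of intervals of length \<open>h\<close> form a suitable set.\<close>

lemma random_zero_sets:
  fixes d :: "'a \<Rightarrow> 'a \<Rightarrow> real" and f :: "nat \<Rightarrow> 'a \<Rightarrow> real"
  assumes N: "finite N"
    and d: "\<And>x y. x \<in> N \<Longrightarrow> y \<in> N \<Longrightarrow> d x y = (\<Sum>i<n. (f i x - f i y)\<^sup>2)"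
    and tri: "\<And>x y z. x \<in> N \<Longrightarrow> y \<in> N \<Longrightarrow> z \<in> N \<Longrightarrow> d x z \<le> d x y + d y z"
    and pos: "0 < \<Delta>" "1 \<le> g"
    and card: "\<And>x. x \<in> N \<Longrightarrow> real (card {y \<in> N. d x y \<le> \<Delta>}) \<le> 4 powr g"
  defines "\<sigma> \<equiv> \<Delta> / (3 * 10 ^ 10 * sqrt g)"
  shows "\<exists>Zs. Zs \<noteq> [] \<and> (\<forall>Z\<in>set Zs. Z \<subseteq> N) \<and>
    (\<forall>x\<in>N. \<forall>y\<in>N. \<Delta> / 2 \<le> d x y \<longrightarrow> d x y \<le> 3 * \<Delta> \<longrightarrow>
      length Zs / 2000 \<le> length (filter (\<lambda>Z. x \<in> Z \<and> (\<forall>z\<in>Z. \<sigma> \<le> d y z)) Zs))"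
proof -
  define P where "P = {(x, y). x \<in> N \<and> y \<in> N \<and> \<Delta> / 2 \<le> d x y \<and> d x y \<le> 3 * \<Delta>}"
  define good where "good = (\<lambda>Z (x, y). x \<in> Z \<and> (\<forall>z\<in>Z. \<sigma> \<le> d y z))"
  define h where "h = sqrt \<Delta> / 12"
  define u where "u = (\<lambda>e x. sgn_form n (\<lambda>i. f i x) e)"
  define spread where "spread = (\<lambda>e (x, y). d x y / 8 \<le> (u e x - u e y)\<^sup>2 \<and> (u e x - u e y)\<^sup>2 \<le> 10 * d x y)"
  have P_sub: "P \<subseteq> N \<times> N" by (auto simp: P_def)
  then have P: "finite P" using N by (meson finite_SigmaI finite_subset)
  have h: "0 < h" using pos by (simp add: h_def)
  have d_sym: "d x y = d y x" if "x \<in> N" "y \<in> N" for x y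
    using that by (simp add: d power2_commute)
  have avg_spread: "1/5 \<le> sign_avg n (\<lambda>e. of_bool (spread e p))" if p: "p \<in> P" for p
  proof -
    obtain x y where xy: "p = (x, y)" "x \<in> N" "y \<in> N" "\<Delta> / 2 \<le> d x y"
      using p by (auto simp: P_def)
    have *: "u e x - u e y = sgn_form n (\<lambda>i. f i x - f i y) e" for e
      by (simp add: u_def left_diff_distrib sum_subtractf)
    have "0 < d x y" using xy pos by linarith
    from sign_avg_spread[OF this d[OF xy(2,3), symmetric]] show ?thesis
      by (simp add: spread_def xy(1) *)
  qed
  have "\<exists>Z. Z \<subseteq> N \<and> 1/500 * sum \<nu> P \<le> sum \<nu> {p \<in> P. good Z p}"
    if \<nu>: "\<And>p. 0 \<le> \<nu> p" for \<nu> :: "'a \<times> 'a \<Rightarrow> real"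
  proof -
    define w where "w = (\<lambda>x. \<Sum>p\<in>P. \<nu> p * (of_bool (fst p = x) + of_bool (snd p = x)))"
    have w_sum: "(\<Sum>x\<in>N \<inter> A. w x) = (\<Sum>p\<in>P. \<nu> p * (of_bool (fst p \<in> A) + of_bool (snd p \<in> A)))" for A
    proof -
      have "(\<Sum>x\<in>N \<inter> A. w x) = (\<Sum>p\<in>P. \<Sum>x\<in>N \<inter> A. \<nu> p * (of_bool (fst p = x) + of_bool (snd p = x)))"
        unfolding w_def by (rule sum.swap)
      also have "\<dots> = (\<Sum>p\<in>P. \<nu> p * (of_bool (fst p \<in> A) + of_bool (snd p \<in> A)))"
      proof (intro sum.cong refl)
        fix p assume "p \<in> P"
        then have "fst p \<in> N" "snd p \<in> N" using P_sub by auto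
        moreover have "(\<Sum>x\<in>N \<inter> A. of_bool (c = x) :: real) = of_bool (c \<in> A)" if "c \<in> N" for c
          using that N by (simp add: of_bool_def sum.delta)
        ultimately show "(\<Sum>x\<in>N \<inter> A. \<nu> p * (of_bool (fst p = x) + of_bool (snd p = x)))
            = \<nu> p * (of_bool (fst p \<in> A) + of_bool (snd p \<in> A))"
          by (simp add: sum.distrib flip: sum_distrib_left)
      qed
      finally show ?thesis .
    qed
    have w_nonneg: "0 \<le> w x" for x
      unfolding w_def using \<nu> by (intro sum_nonneg mult_nonneg_nonneg) auto
    have "\<exists>sat. (\<forall>e x y. x \<in> N \<longrightarrow> y \<in> N \<longrightarrow> d x y < \<sigma> \<longrightarrow> h \<le> \<bar>u e x - u e y\<bar> \<longrightarrow> x \<in> sat e \<or> y \<in> sat e)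
      \<and> sign_avg n (\<lambda>e. \<Sum>x\<in>N \<inter> sat e. w x) \<le> (\<Sum>x\<in>N. w x) / 40"
      unfolding \<sigma>_def h_def u_def
      by (rule few_saturated[where f = f]) (use N w_nonneg d tri pos card in auto)
    then obtain sat where
      sat: "\<And>e x y. x \<in> N \<Longrightarrow> y \<in> N \<Longrightarrow> d x y < \<sigma> \<Longrightarrow> h \<le> \<bar>u e x - u e y\<bar> \<Longrightarrow> x \<in> sat e \<or> y \<in> sat e"
      and few: "sign_avg n (\<lambda>e. \<Sum>x\<in>N \<inter> sat e. w x) \<le> (\<Sum>x\<in>N. w x) / 40"
      by blast
    have "(\<Sum>x\<in>N. w x) = 2 * sum \<nu> P"
      using w_sum[of UNIV] by (simp flip: sum_distrib_right)
    then have few': "sign_avg n (\<lambda>e. \<Sum>x\<in>N \<inter> sat e. w x) \<le> sum \<nu> P / 20" using few by simp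
    define S where "S = (\<lambda>e. {p \<in> P. spread e p \<and> fst p \<notin> sat e \<and> snd p \<notin> sat e})"
    have "sum \<nu> P / 5 - sum \<nu> P / 20 \<le> sign_avg n (\<lambda>e. (\<Sum>p\<in>P. \<nu> p * of_bool (spread e p)) - (\<Sum>x\<in>N \<inter> sat e. w x))"
    proof -
      have "sum \<nu> P / 5 = (\<Sum>p\<in>P. \<nu> p * (1/5))" by (simp add: sum_divide_distrib)
      also have "\<dots> \<le> (\<Sum>p\<in>P. \<nu> p * sign_avg n (\<lambda>e. of_bool (spread e p)))"
        by (intro sum_mono mult_left_mono avg_spread \<nu>)
      finally show ?thesis
        using few' by (simp add: sign_avg_diff sign_avg_sum sign_avg_cmult)
    qed
    also have "\<dots> \<le> sign_avg n (\<lambda>e. sum \<nu> (S e))"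
    proof (rule sign_avg_mono)
      fix e
      have "(\<Sum>p\<in>P. \<nu> p * of_bool (spread e p)) - (\<Sum>x\<in>N \<inter> sat e. w x)
          = (\<Sum>p\<in>P. \<nu> p * (of_bool (spread e p) - (of_bool (fst p \<in> sat e) + of_bool (snd p \<in> sat e))))"
        by (simp add: w_sum right_diff_distrib sum_subtractf)
      also have "\<dots> \<le> (\<Sum>p\<in>P. if p \<in> S e then \<nu> p else 0)"
        using \<nu> by (intro sum_mono) (auto simp: S_def)
      also have "\<dots> = sum \<nu> (S e)"
        using P by (simp add: S_def sum.inter_filter)
      finally show "(\<Sum>p\<in>P. \<nu> p * of_bool (spread e p)) - (\<Sum>x\<in>N \<inter> sat e. w x) \<le> sum \<nu> (S e)" .
    qed
    finally have "sum \<nu> P * 3 / 20 \<le> sign_avg n (\<lambda>e. sum \<nu> (S e))" by simp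
    then obtain e where e: "sum \<nu> P * 3 / 20 \<le> sum \<nu> (S e)"
      using exists_ge_sign_avg[of n "\<lambda>e. sum \<nu> (S e)"] order_trans by blast
    define c where "c = (\<lambda>z. \<lfloor>u e z / h\<rfloor>)"
    \<comment> \<open>A spread pair has projections between \<open>3 h\<close> and \<open>66 h\<close> apart. The points closer than \<open>\<sigma>\<close> to \<open>y\<close> then
      differ from \<open>x\<close> by 1 to 68 intervals of length \<open>h\<close>, so the period 70 keeps them out of the class of \<open>x\<close>.\<close>
    define Z where "Z = (\<lambda>r. {z \<in> N. z \<notin> sat e \<and> c z mod 70 = r})"
    have good: "good (Z (c (fst p) mod 70)) p" if p: "p \<in> S e" for p
    proof -
      obtain x y where xy: "p = (x, y)" "x \<in> N" "y \<in> N" "\<Delta> / 2 \<le> d x y" "d x y \<le> 3 * \<Delta>"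
        "x \<notin> sat e" "y \<notin> sat e" "spread e (x, y)"
        using p by (auto simp: S_def P_def)
      have h2: "\<Delta> = 144 * h\<^sup>2" using pos by (simp add: h_def power_divide)
      have "(3 * h)\<^sup>2 \<le> \<bar>u e x - u e y\<bar>\<^sup>2" "\<bar>u e x - u e y\<bar>\<^sup>2 \<le> (66 * h)\<^sup>2"
        using xy h2 unfolding spread_def by (auto simp: power_mult_distrib)
      then have sep: "3 * h \<le> \<bar>u e x - u e y\<bar>" "\<bar>u e x - u e y\<bar> \<le> 66 * h"
        using h by (auto intro: power2_le_imp_le)
      have "3 \<le> \<bar>u e x / h - u e y / h\<bar>" "\<bar>u e x / h - u e y / h\<bar> \<le> 66"
        using sep h by (auto simp: abs_if field_simps split: if_splits)
      then have cxy: "2 \<le> \<bar>c x - c y\<bar>" "\<bar>c x - c y\<bar> \<le> 67"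
        unfolding c_def by linarith+
      have "\<sigma> \<le> d y z" if z: "z \<in> Z (c x mod 70)" for z
      proof (rule ccontr)
        assume "\<not> \<sigma> \<le> d y z"
        then have "\<bar>u e y - u e z\<bar> < h"
          using sat[of y z e] z xy by (force simp: Z_def)
        then have "\<bar>u e y / h - u e z / h\<bar> < 1"
          using h by (auto simp: abs_if field_simps split: if_splits)
        then have "\<bar>c y - c z\<bar> \<le> 1" unfolding c_def by linarith
        then have "c x \<noteq> c z" "\<bar>c x - c z\<bar> < 70" using cxy by linarith+
        moreover have "70 dvd c x - c z" using z by (auto simp: Z_def mod_eq_dvd_iff dvd_diff_commute)
        ultimately show False using dvd_imp_le_int[of "c x - c z" 70] by simp
      qed
      moreover have "x \<in> Z (c x mod 70)" using xy by (auto simp: Z_def)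
      ultimately show ?thesis by (auto simp: good_def xy)
    qed
    have "\<exists>r\<in>{0..<70::int}. 1/500 * sum \<nu> P \<le> sum \<nu> {p \<in> P. good (Z r) p}"
    proof (rule ccontr)
      assume neg: "\<not> ?thesis"
      then have less: "sum \<nu> {p \<in> P. good (Z r) p} \<le> 1/500 * sum \<nu> P" if "r \<in> {0..<70}" for r
        using that by force
      have "sum \<nu> (S e) \<le> (\<Sum>p\<in>S e. \<Sum>r\<in>{0..<70}. if good (Z r) p then \<nu> p else 0)"
      proof (rule sum_mono)
        fix p assume p: "p \<in> S e"
        have "\<nu> p = (if good (Z (c (fst p) mod 70)) p then \<nu> p else 0)"
          using good[OF p] by simp
        also have "\<dots> \<le> (\<Sum>r\<in>{0..<70}. if good (Z r) p then \<nu> p else 0)"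
          using \<nu> by (intro member_le_sum[where f = "\<lambda>r. if good (Z r) p then \<nu> p else 0"]) auto
        finally show "\<nu> p \<le> (\<Sum>r\<in>{0..<70}. if good (Z r) p then \<nu> p else 0)" .
      qed
      also have "\<dots> \<le> (\<Sum>p\<in>P. \<Sum>r\<in>{0..<70}. if good (Z r) p then \<nu> p else 0)"
        using P \<nu> by (intro sum_mono2) (auto simp: S_def intro!: sum_nonneg)
      also have "\<dots> = (\<Sum>r\<in>{0..<70}. sum \<nu> {p \<in> P. good (Z r) p})"
        using P by (subst sum.swap) (simp add: sum.inter_filter)
      also have "\<dots> \<le> (\<Sum>r\<in>{0..<70::int}. 1/500 * sum \<nu> P)" by (intro sum_mono less) auto
      also have "\<dots> = 70/500 * sum \<nu> P" by simp
      finally have "sum \<nu> P * 3 / 20 \<le> 70/500 * sum \<nu> P" using e by linarith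
      moreover have "0 \<le> sum \<nu> P" by (intro sum_nonneg \<nu>)
      ultimately have 0: "sum \<nu> P = 0" by linarith
      have "\<not> 1/500 * sum \<nu> P \<le> sum \<nu> {p \<in> P. good (Z 0) p}"
        using neg by auto
      moreover have "0 \<le> sum \<nu> {p \<in> P. good (Z 0) p}" by (intro sum_nonneg \<nu>)
      ultimately show False using 0 by simp
    qed
    then obtain r where "1/500 * sum \<nu> P \<le> sum \<nu> {p \<in> P. good (Z r) p}" by blast
    then show ?thesis by (intro exI[of _ "Z r"]) (auto simp: Z_def)
  qed
  from multiplicative_weights[where Q = "\<lambda>Z. Z \<subseteq> N" and good = good, OF P _ _ this]
  obtain Zs where "Zs \<noteq> []" "\<forall>Z\<in>set Zs. Z \<subseteq> N"
    "\<forall>p\<in>P. 1/500 / 4 * length Zs \<le> length (filter (\<lambda>Z. good Z p) Zs)"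
    by auto
  then show ?thesis
    by (intro exI[of _ Zs]) (auto simp: P_def good_def)
qed

section \<open>Finite metric spaces of negative type\<close>

text \<open>Concatenating lists of coordinates adds the squared distances, so a list can represent a
  sum of embeddings without any index bookkeeping.\<close>

definition sq_dist :: "('a \<Rightarrow> real) list \<Rightarrow> 'a \<Rightarrow> 'a \<Rightarrow> real" where
  "sq_dist fs x y = (\<Sum>\<phi>\<leftarrow>fs. (\<phi> x - \<phi> y)\<^sup>2)"

lemma sq_dist_nonneg: "0 \<le> sq_dist fs x y"
  by (auto simp: sq_dist_def intro!: sum_list_nonneg)

lemma sq_dist_commute: "sq_dist fs x y = sq_dist fs y x"
  by (simp add: sq_dist_def power2_commute)

lemma exists_sum_sq_dist:
  assumes "finite A"
  shows "\<exists>fs. \<forall>x y. sq_dist fs x y = (\<Sum>a\<in>A. sq_dist (F a) x y)"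
  using assms
proof (induction A rule: finite_induct)
  case empty
  show ?case by (intro exI[of _ "[]"]) (simp add: sq_dist_def)
next
  case (insert a A)
  then obtain fs where "\<forall>x y. sq_dist fs x y = (\<Sum>a\<in>A. sq_dist (F a) x y)" by blast
  with insert.hyps show ?case by (intro exI[of _ "F a @ fs"]) (simp add: sq_dist_def)
qed

lemma sum_list_ge_count:
  fixes F :: "'a \<Rightarrow> real"
  assumes "\<And>x. 0 \<le> F x" "\<And>x. x \<in> set xs \<Longrightarrow> Q x \<Longrightarrow> c \<le> F x"
  shows "c * length (filter Q xs) \<le> sum_list (map F xs)"
  using assms(2)
proof (induction xs)
  case (Cons x xs)
  then have "c * length (filter Q xs) \<le> sum_list (map F xs)" by auto
  then show ?case using Cons.prems[of x] assms(1)[of x] by (auto simp: algebra_simps)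
qed simp

lemma abs_min_diff_le: "\<bar>a - a'\<bar> \<le> K \<Longrightarrow> \<bar>b - b'\<bar> \<le> K \<Longrightarrow> \<bar>min a b - min a' b'\<bar> \<le> (K :: real)"
  by linarith

lemma abs_max_0_diff_le: "\<bar>a - b\<bar> \<le> K \<Longrightarrow> \<bar>max 0 a - max 0 b\<bar> \<le> (K :: real)"
  by linarith

lemma card_powers_between:
  fixes a b :: real
  assumes "0 < a" "a \<le> b"
  shows "finite {k :: int. a < 2 powr k \<and> 2 powr k < b}"
    and "card {k :: int. a < 2 powr k \<and> 2 powr k < b} \<le> log 2 (b / a) + 1"
proof -
  let ?S = "{k :: int. a < 2 powr k \<and> 2 powr k < b}"
  have sub: "?S \<subseteq> {\<lfloor>log 2 a\<rfloor> + 1 .. \<lceil>log 2 b\<rceil> - 1}"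
  proof
    fix k :: int assume k: "k \<in> ?S"
    then have "log 2 a < k" "k < log 2 b" using assms by (auto simp: log_less_iff less_log_iff)
    then show "k \<in> {\<lfloor>log 2 a\<rfloor> + 1 .. \<lceil>log 2 b\<rceil> - 1}" by auto linarith+
  qed
  then show "finite ?S" by (rule finite_subset) simp
  have "card ?S \<le> card {\<lfloor>log 2 a\<rfloor> + 1 .. \<lceil>log 2 b\<rceil> - 1}" using sub by (intro card_mono) auto
  also have "real \<dots> \<le> max 0 (log 2 b - log 2 a + 1)"
    by simp linarith
  also have "\<dots> = log 2 (b / a) + 1"
    using assms by (simp add: log_divide)
  finally show "card ?S \<le> log 2 (b / a) + 1" by simp
qed

text \<open>The powers of two that a cardinality passes through while growing by the factor \<open>2\<^sup>j\<close>.\<close>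

lemma card_powers_of_two_between:
  assumes "1 \<le> lo" "2 ^ j * lo \<le> (hi :: nat)"
  shows "finite {t. lo < 2 ^ t \<and> 2 ^ t \<le> hi}" "j \<le> card {t. lo < 2 ^ t \<and> 2 ^ t \<le> hi}"
proof -
  have "{t. lo < 2 ^ t \<and> 2 ^ t \<le> hi} \<subseteq> {..<hi}"
    using less_le_trans[OF less_exp] by auto
  then show fin: "finite {t. lo < 2 ^ t \<and> 2 ^ t \<le> hi}" by (rule finite_subset) simp
  define t0 where "t0 = (LEAST t. lo < 2 ^ t)"
  have t0: "lo < 2 ^ t0" unfolding t0_def by (rule LeastI[of _ lo]) (rule less_exp)
  then have "t0 \<noteq> 0" using assms by (intro notI) simp
  then obtain s where s: "t0 = Suc s" by (cases t0) auto
  have "\<not> lo < 2 ^ s" using not_less_Least[of s "\<lambda>t. lo < 2 ^ t"] s by (simp add: t0_def)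
  then have t0_le: "2 ^ t0 \<le> 2 * lo" by (simp add: s)
  have "{t0..<t0 + j} \<subseteq> {t. lo < 2 ^ t \<and> 2 ^ t \<le> hi}"
  proof
    fix t assume t: "t \<in> {t0..<t0 + j}"
    then obtain i where i: "t = t0 + i" "i < j" by (auto simp: le_iff_add)
    then have "2 ^ t \<le> 2 * lo * 2 ^ i" using t0_le by (simp add: power_add mult_right_mono)
    also have "\<dots> = 2 ^ Suc i * lo" by simp
    also have "\<dots> \<le> 2 ^ j * lo" using i by (intro mult_right_mono power_increasing) auto
    finally have "2 ^ t \<le> hi" using assms by simp
    moreover have "lo < 2 ^ t" using t0 t by (auto intro: less_le_trans power_increasing)
    ultimately show "t \<in> {t. lo < 2 ^ t \<and> 2 ^ t \<le> hi}" by simp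
  qed
  then have "card {t0..<t0 + j} \<le> card {t. lo < 2 ^ t \<and> 2 ^ t \<le> hi}" using fin by (rule card_mono[rotated])
  then show "j \<le> card {t. lo < 2 ^ t \<and> 2 ^ t \<le> hi}" by simp
qed

text \<open>A finite metric of negative type is a metric that is the square of a Euclidean distance; \<open>f\<close>
  gives the Euclidean coordinates.\<close>

locale negative_type_space =
  fixes X :: "'a set" and d :: "'a \<Rightarrow> 'a \<Rightarrow> real" and n :: nat and f :: "nat \<Rightarrow> 'a \<Rightarrow> real"
  assumes finite_space: "finite X"
    and dist_eq: "\<And>x y. x \<in> X \<Longrightarrow> y \<in> X \<Longrightarrow> d x y = (\<Sum>i<n. (f i x - f i y)\<^sup>2)"
    and tri: "\<And>x y z. x \<in> X \<Longrightarrow> y \<in> X \<Longrightarrow> z \<in> X \<Longrightarrow> d x z \<le> d x y + d y z"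
    and sep: "\<And>x y. x \<in> X \<Longrightarrow> y \<in> X \<Longrightarrow> d x y = 0 \<Longrightarrow> x = y"
begin

lemma sym: "x \<in> X \<Longrightarrow> y \<in> X \<Longrightarrow> d x y = d y x"
  by (simp add: dist_eq power2_commute)

lemma nonneg: "x \<in> X \<Longrightarrow> y \<in> X \<Longrightarrow> 0 \<le> d x y"
  by (simp add: dist_eq sum_nonneg)

lemma self: "x \<in> X \<Longrightarrow> d x x = 0"
  by (simp add: dist_eq)

definition ball_card :: "'a \<Rightarrow> real \<Rightarrow> nat" where
  "ball_card x r = card {z \<in> X. d x z \<le> r}"

lemma ball_card_mono: "{z \<in> X. d x z \<le> r} \<subseteq> {z \<in> X. d y z \<le> s} \<Longrightarrow> ball_card x r \<le> ball_card y s"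
  unfolding ball_card_def using finite_space by (intro card_mono) auto

lemma ball_card_pos: "x \<in> X \<Longrightarrow> 0 \<le> r \<Longrightarrow> 1 \<le> ball_card x r"
  unfolding ball_card_def using finite_space self[of x] by (auto simp: Suc_le_eq card_gt_0_iff)

lemma ball_card_shift: "x \<in> X \<Longrightarrow> y \<in> X \<Longrightarrow> r + d x y \<le> s \<Longrightarrow> ball_card x r \<le> ball_card y s"
  using tri[of y x] sym[of x y] by (intro ball_card_mono) fastforce

text \<open>The radius at which the ball around \<open>x\<close> reaches \<open>2\<^sup>t\<close> points. It is meaningful for
  \<open>2\<^sup>t \<le> card X\<close>, when the set is nonempty.\<close>

definition fill_radius :: "nat \<Rightarrow> 'a \<Rightarrow> real" where
  "fill_radius t x = Min (d x ` {z \<in> X. 2 ^ t \<le> ball_card x (d x z)})"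

lemma fill_radius_le_iff:
  assumes x: "x \<in> X" and t: "2 ^ t \<le> card X"
  shows "fill_radius t x \<le> r \<longleftrightarrow> 2 ^ t \<le> ball_card x r"
proof -
  let ?S = "{z \<in> X. 2 ^ t \<le> ball_card x (d x z)}"
  have ex: "\<exists>z\<in>?S. d x z \<le> r" if r: "2 ^ t \<le> ball_card x r" for r
  proof -
    let ?B = "{z \<in> X. d x z \<le> r}"
    have "?B \<noteq> {}"
    proof
      assume "?B = {}"
      then have "ball_card x r = 0" unfolding ball_card_def by (metis card.empty)
      then show False using r by simp
    qed
    moreover have "finite ?B" using finite_space by simp
    ultimately have fin: "finite (d x ` ?B)" "d x ` ?B \<noteq> {}" by blast+
    from Max_in[OF this] obtain z where "z \<in> ?B" "Max (d x ` ?B) = d x z" by blast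
    with Max_ge[OF fin(1)] have z: "z \<in> ?B" "\<And>v. v \<in> ?B \<Longrightarrow> d x v \<le> d x z"
      by (metis (no_types, lifting) imageI)+
    then have "ball_card x r \<le> ball_card x (d x z)" by (intro ball_card_mono) auto
    then show ?thesis using z r by auto
  qed
  have "ball_card x (Max (d x ` X)) = card X"
    unfolding ball_card_def using finite_space x by (intro arg_cong[of _ _ card]) auto
  then have ne: "?S \<noteq> {}" using ex[of "Max (d x ` X)"] t by auto
  have fin: "finite ?S" using finite_space by simp
  show ?thesis
  proof
    assume "fill_radius t x \<le> r"
    moreover have "fill_radius t x \<in> d x ` ?S"
      unfolding fill_radius_def using fin ne by (intro Min_in) auto
    ultimately obtain z where "z \<in> ?S" "d x z \<le> r" by auto
    then show "2 ^ t \<le> ball_card x r" using ball_card_mono[of x "d x z" x r] by fastforce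
  next
    assume "2 ^ t \<le> ball_card x r"
    from ex[OF this] obtain z where z: "z \<in> ?S" "d x z \<le> r" by auto
    then have "fill_radius t x \<le> d x z" unfolding fill_radius_def using fin by (intro Min_le) auto
    then show "fill_radius t x \<le> r" using z by simp
  qed
qed

lemma fill_radius_lipschitz:
  assumes x: "x \<in> X" and y: "y \<in> X" and t: "2 ^ t \<le> card X"
  shows "\<bar>fill_radius t x - fill_radius t y\<bar> \<le> d x y"
proof -
  have "fill_radius t v \<le> fill_radius t u + d u v" if "u \<in> X" "v \<in> X" for u v
  proof -
    have "2 ^ t \<le> ball_card u (fill_radius t u)" using fill_radius_le_iff[OF that(1) t, of "fill_radius t u"] by blast
    also have "\<dots> \<le> ball_card v (fill_radius t u + d u v)" using that by (intro ball_card_shift) auto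
    finally show ?thesis using fill_radius_le_iff[OF that(2) t] by blast
  qed
  from this[OF x y] this[OF y x] sym[OF x y] show ?thesis by linarith
qed

text \<open>The constant value for the empty set keeps the function Lipschitz.\<close>

definition set_dist :: "real \<Rightarrow> 'a set \<Rightarrow> 'a \<Rightarrow> real" where
  "set_dist c Z x = (if Z = {} then c else Min (d x ` Z))"

lemma set_dist_lipschitz:
  assumes Z: "Z \<subseteq> X" and x: "x \<in> X" and y: "y \<in> X"
  shows "\<bar>set_dist c Z x - set_dist c Z y\<bar> \<le> d x y"
proof (cases "Z = {}")
  case True
  then show ?thesis using nonneg[OF x y] by (simp add: set_dist_def)
next
  case False
  have fin: "finite Z" using Z finite_space finite_subset by blast
  have "Min (d v ` Z) \<le> Min (d u ` Z) + d u v" if uv: "u \<in> X" "v \<in> X" for u v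
  proof -
    have "Min (d u ` Z) \<in> d u ` Z" using fin False by (intro Min_in) auto
    then obtain z where z: "z \<in> Z" "Min (d u ` Z) = d u z" by auto
    have "Min (d v ` Z) \<le> d v z" using fin z by (intro Min_le) auto
    also have "\<dots> \<le> d v u + d u z" using tri uv z Z by blast
    finally show ?thesis using z sym[OF uv] by simp
  qed
  from this[OF x y] this[OF y x] sym[OF x y] show ?thesis
    using False by (auto simp: set_dist_def)
qed

lemma set_dist_le: "Z \<subseteq> X \<Longrightarrow> z \<in> Z \<Longrightarrow> set_dist c Z x \<le> d x z"
  using finite_subset[OF _ finite_space] by (auto simp: set_dist_def)

lemma set_dist_ge:
  assumes "Z \<subseteq> X" "Z \<noteq> {}" "\<And>z. z \<in> Z \<Longrightarrow> r \<le> d x z"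
  shows "r \<le> set_dist c Z x"
  using assms finite_subset[OF _ finite_space] by (auto simp: set_dist_def)

lemma exists_net:
  assumes "Y \<subseteq> X" "0 \<le> r"
  shows "\<exists>N\<subseteq>Y. (\<forall>u\<in>N. \<forall>v\<in>N. u \<noteq> v \<longrightarrow> r < d u v) \<and> (\<forall>y\<in>Y. \<exists>v\<in>N. d y v \<le> r)"
proof -
  have "finite Y" using assms finite_space finite_subset by blast
  then show ?thesis using assms(1)
  proof (induction Y rule: finite_induct)
    case (insert y Y)
    then obtain N where N: "N \<subseteq> Y" "\<forall>u\<in>N. \<forall>v\<in>N. u \<noteq> v \<longrightarrow> r < d u v" "\<forall>y\<in>Y. \<exists>v\<in>N. d y v \<le> r"
      by auto
    show ?case
    proof (cases "\<exists>v\<in>N. d y v \<le> r")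
      case True
      then show ?thesis using N by (intro exI[of _ N]) auto
    next
      case False
      have yX: "y \<in> X" "N \<subseteq> X" using insert.prems N by auto
      have far: "r < d y v" "r < d v y" if "v \<in> N" for v
        using False that sym[of y v] yX by force+
      show ?thesis
        using N far self[OF yX(1)] assms(2) by (intro exI[of _ "insert y N"]) auto
    qed
  qed auto
qed

section \<open>Euclidean embedding of a single scale\<close>

text \<open>Pairs at distance about \<open>\<Delta>\<close> will be separated at this order, if balls grow by about the factor
  \<open>2\<^sup>g\<close> with \<open>g = 2\<^sup>\<gamma>\<close> between the radii \<open>gap \<gamma> \<Delta>\<close> and \<open>6 \<Delta>\<close>. It is a tenth of the separation in
  \<open>random_zero_sets\<close>.\<close>

definition gap :: "nat \<Rightarrow> real \<Rightarrow> real" where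
  "gap \<gamma> \<Delta> = \<Delta> / (3 * 10 ^ 11 * sqrt (2 ^ \<gamma>))"

lemma gap_pos: "0 < \<Delta> \<Longrightarrow> 0 < gap \<gamma> \<Delta>"
  by (simp add: gap_def)

lemma gap_le: "0 < \<Delta> \<Longrightarrow> gap \<gamma> \<Delta> \<le> \<Delta> / 100"
proof -
  assume \<Delta>: "0 < \<Delta>"
  have "100 \<le> 3 * 10 ^ 11 * sqrt (2 ^ \<gamma>)"
    using mult_mono[of 100 "3 * 10 ^ 11" 1 "sqrt (2 ^ \<gamma>)"] by simp
  then show ?thesis using \<Delta> unfolding gap_def by (intro divide_left_mono) auto
qed

text \<open>The coordinates for scale \<open>\<Delta>\<close> and cardinality \<open>2\<^sup>t\<close> will vanish at all points that are not active.\<close>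

definition active :: "nat \<Rightarrow> nat \<Rightarrow> real \<Rightarrow> 'a \<Rightarrow> bool" where
  "active \<gamma> t \<Delta> z \<longleftrightarrow> gap \<gamma> \<Delta> / 2 < fill_radius t z \<and> fill_radius t z < 12 * \<Delta>"

text \<open>The points around which balls of radii from \<open>gap \<gamma> \<Delta>\<close> to \<open>6 \<Delta>\<close> have cardinality within the factor
  \<open>2\<^sup>g\<close> of \<open>2\<^sup>t\<close>. This uniformity is what bounds the size of a net locally.\<close>

definition level :: "nat \<Rightarrow> nat \<Rightarrow> real \<Rightarrow> 'a set" where
  "level \<gamma> t \<Delta> = {z \<in> X. 2 ^ t \<le> 2 ^ 2 ^ \<gamma> * ball_card z (gap \<gamma> \<Delta>) \<and> ball_card z (6 * \<Delta>) \<le> 2 ^ (t + 2 ^ \<gamma>)}"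

text \<open>Disjoint balls around the points of the net each contain at least \<open>2\<^sup>t / 2\<^sup>g\<close> points, and all of them
  lie in a ball with at most \<open>2\<^sup>t 2\<^sup>g\<close> points.\<close>

lemma card_level_net_le:
  assumes \<Delta>: "0 < \<Delta>" and N: "N \<subseteq> level \<gamma> t \<Delta>"
    and apart: "\<And>u v. u \<in> N \<Longrightarrow> v \<in> N \<Longrightarrow> u \<noteq> v \<Longrightarrow> 2 * gap \<gamma> \<Delta> < d u v" and x: "x \<in> N"
  shows "real (card {v \<in> N. d x v \<le> \<Delta>}) \<le> 4 powr real (2 ^ \<gamma>)"
proof -
  let ?\<delta> = "gap \<gamma> \<Delta>" and ?g = "2 ^ \<gamma> :: nat" and ?A = "{v \<in> N. d x v \<le> \<Delta>}"
  have NX: "N \<subseteq> X" using N by (auto simp: level_def)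
  have fin: "finite ?A" using NX finite_space finite_subset by fastforce
  have "2 ^ t * card ?A = (\<Sum>v\<in>?A. 2 ^ t)" by simp
  also have "\<dots> \<le> (\<Sum>v\<in>?A. 2 ^ ?g * ball_card v ?\<delta>)"
    using N by (intro sum_mono) (auto simp: level_def)
  also have "\<dots> = 2 ^ ?g * (\<Sum>v\<in>?A. card {z \<in> X. d v z \<le> ?\<delta>})"
    by (simp add: ball_card_def sum_distrib_left)
  also have "(\<Sum>v\<in>?A. card {z \<in> X. d v z \<le> ?\<delta>}) = card (\<Union>v\<in>?A. {z \<in> X. d v z \<le> ?\<delta>})"
  proof (rule card_UN_disjoint[symmetric])
    show "\<forall>u\<in>?A. \<forall>v\<in>?A. u \<noteq> v \<longrightarrow> {z \<in> X. d u z \<le> ?\<delta>} \<inter> {z \<in> X. d v z \<le> ?\<delta>} = {}"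
    proof (intro ballI impI, rule ccontr)
      fix u v assume uv: "u \<in> ?A" "v \<in> ?A" "u \<noteq> v" "{z \<in> X. d u z \<le> ?\<delta>} \<inter> {z \<in> X. d v z \<le> ?\<delta>} \<noteq> {}"
      then obtain z where z: "z \<in> X" "d u z \<le> ?\<delta>" "d v z \<le> ?\<delta>" by blast
      have "u \<in> X" "v \<in> X" using uv NX by auto
      then have "d u v \<le> 2 * ?\<delta>" using tri[of u z v] sym[of v z] z by simp
      then show False using apart[of u v] uv by auto
    qed
  qed (use fin finite_space in auto)
  also have "\<dots> \<le> ball_card x (6 * \<Delta>)"
    unfolding ball_card_def
  proof (rule card_mono)
    show "(\<Union>v\<in>?A. {z \<in> X. d v z \<le> ?\<delta>}) \<subseteq> {z \<in> X. d x z \<le> 6 * \<Delta>}"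
    proof
      fix z assume "z \<in> (\<Union>v\<in>?A. {z \<in> X. d v z \<le> ?\<delta>})"
      then obtain v where v: "v \<in> N" "d x v \<le> \<Delta>" "z \<in> X" "d v z \<le> ?\<delta>" by auto
      then have "d x z \<le> \<Delta> + ?\<delta>" using tri[of x v z] x NX by fastforce
      also have "\<dots> \<le> 6 * \<Delta>" using gap_le[OF \<Delta>, of \<gamma>] \<Delta> by simp
      finally show "z \<in> {z \<in> X. d x z \<le> 6 * \<Delta>}" using v by simp
    qed
  qed (use finite_space in auto)
  also have "\<dots> \<le> 2 ^ (t + ?g)" using N x by (auto simp: level_def)
  finally have "2 ^ t * card ?A \<le> 2 ^ t * (2 ^ ?g * 2 ^ ?g)" by (simp add: power_add)
  then have "card ?A \<le> 2 ^ ?g * 2 ^ ?g" by simp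
  also have "\<dots> = 4 ^ ?g" by (simp flip: power_mult_distrib)
  finally have "real (card ?A) \<le> real (4 ^ ?g)" by (simp only: of_nat_le_iff)
  also have "\<dots> = 4 powr real ?g" by (subst powr_realpow) auto
  finally show ?thesis .
qed

text \<open>Zero sets are chosen in a net of the level set rather than in the space itself, so that the number
  \<open>4\<^sup>g\<close> of competing points is governed by the growth of balls. The coordinates are the distances to
  the zero sets, cut off where \<open>fill_radius\<close> is not comparable to the scale. The cutoff takes
  place over the length \<open>gap \<gamma> \<Delta>\<close>, which is also the order of the separation, so it
  preserves the Lipschitz condition up to a constant.\<close>

lemma single_scale_embedding:
  assumes \<Delta>: "0 < \<Delta>" and t: "2 ^ t \<le> card X"
  shows "\<exists>fs. (\<forall>x\<in>X. \<forall>y\<in>X. sq_dist fs x y \<le> 256 * (d x y)\<^sup>2) \<and>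
    (\<forall>x\<in>X. \<forall>y\<in>X. \<not> active \<gamma> t \<Delta> x \<longrightarrow> \<not> active \<gamma> t \<Delta> y \<longrightarrow> sq_dist fs x y = 0) \<and>
    (\<forall>x\<in>level \<gamma> t \<Delta>. \<forall>y\<in>level \<gamma> t \<Delta>. \<Delta> \<le> d x y \<longrightarrow> d x y \<le> 2 * \<Delta> \<longrightarrow>
      gap \<gamma> \<Delta> < fill_radius t y \<longrightarrow> fill_radius t y \<le> 9 * \<Delta> \<longrightarrow> (gap \<gamma> \<Delta>)\<^sup>2 / 100 \<le> sq_dist fs x y)"
proof -
  define \<delta> where "\<delta> = gap \<gamma> \<Delta>"
  have \<delta>: "0 < \<delta>" "\<delta> \<le> \<Delta> / 100" using gap_pos[OF \<Delta>] gap_le[OF \<Delta>] by (auto simp: \<delta>_def)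
  have LX: "level \<gamma> t \<Delta> \<subseteq> X" by (auto simp: level_def)
  obtain N where N: "N \<subseteq> level \<gamma> t \<Delta>" "\<forall>u\<in>N. \<forall>v\<in>N. u \<noteq> v \<longrightarrow> 2 * \<delta> < d u v"
    "\<forall>y\<in>level \<gamma> t \<Delta>. \<exists>v\<in>N. d y v \<le> 2 * \<delta>"
    using exists_net[OF LX, of "2 * \<delta>"] \<delta> by auto
  have NX: "N \<subseteq> X" using N LX by auto
  have "finite N" using NX finite_space finite_subset by blast
  have 10: "\<Delta> / (3 * 10 ^ 10 * sqrt (real (2 ^ \<gamma>))) = 10 * \<delta>"
    by (simp add: \<delta>_def gap_def)
  have "\<exists>Zs. Zs \<noteq> [] \<and> (\<forall>Z\<in>set Zs. Z \<subseteq> N) \<and>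
    (\<forall>x\<in>N. \<forall>y\<in>N. \<Delta> / 2 \<le> d x y \<longrightarrow> d x y \<le> 3 * \<Delta> \<longrightarrow>
      length Zs / 2000 \<le> length (filter (\<lambda>Z. x \<in> Z \<and> (\<forall>z\<in>Z. 10 * \<delta> \<le> d y z)) Zs))"
    unfolding 10[symmetric]
  proof (rule random_zero_sets[where f = f and n = n])
    show "d x y = (\<Sum>i<n. (f i x - f i y)\<^sup>2)" if "x \<in> N" "y \<in> N" for x y
      using dist_eq that NX by auto
    show "d x z \<le> d x y + d y z" if "x \<in> N" "y \<in> N" "z \<in> N" for x y z
      using tri that NX by auto
    show "real (card {y \<in> N. d x y \<le> \<Delta>}) \<le> 4 powr real (2 ^ \<gamma>)" if "x \<in> N" for x
      using card_level_net_le[OF \<Delta> N(1) _ that] N(2) by (auto simp: \<delta>_def)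
  qed (use \<open>finite N\<close> \<Delta> in auto)
  then obtain Zs where Zs: "Zs \<noteq> []" "\<forall>Z\<in>set Zs. Z \<subseteq> N"
    "\<forall>x\<in>N. \<forall>y\<in>N. \<Delta> / 2 \<le> d x y \<longrightarrow> d x y \<le> 3 * \<Delta> \<longrightarrow>
      length Zs / 2000 \<le> length (filter (\<lambda>Z. x \<in> Z \<and> (\<forall>z\<in>Z. 10 * \<delta> \<le> d y z)) Zs)"
    by (elim exE conjE) (rule that)
  \<comment> \<open>The slope 16 lets the cutoff rise to \<open>8 \<delta>\<close> between \<open>\<delta> / 2\<close> and \<open>\<delta>\<close>, well above the value at most \<open>2 \<delta>\<close> that
    the function has at points represented in \<open>Z\<close>.\<close>
  define \<Psi> where "\<Psi> = (\<lambda>Z z. max 0 (min (set_dist \<Delta> Z z) (min (16 * (fill_radius t z - \<delta> / 2)) (12 * \<Delta> - fill_radius t z))))"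
  define M where "M = real (length Zs)"
  have M: "0 < M" using Zs(1) by (simp add: M_def)
  define fs where "fs = map (\<lambda>Z z. \<Psi> Z z / sqrt M) Zs"
  have sq: "sq_dist fs x y = (\<Sum>Z\<leftarrow>Zs. (\<Psi> Z x - \<Psi> Z y)\<^sup>2) / M" for x y
  proof -
    have "(\<Psi> Z x / sqrt M - \<Psi> Z y / sqrt M)\<^sup>2 = (1 / M) * (\<Psi> Z x - \<Psi> Z y)\<^sup>2" for Z
      using M by (simp add: power_divide flip: diff_divide_distrib)
    then have "sq_dist fs x y = (1 / M) * (\<Sum>Z\<leftarrow>Zs. (\<Psi> Z x - \<Psi> Z y)\<^sup>2)"
      by (simp add: fs_def sq_dist_def comp_def sum_list_const_mult del: times_divide_eq_left)
    then show ?thesis by simp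
  qed
  have lip: "\<bar>\<Psi> Z x - \<Psi> Z y\<bar> \<le> 16 * d x y" if "Z \<in> set Zs" "x \<in> X" "y \<in> X" for Z x y
  proof -
    have Z: "Z \<subseteq> X" using Zs(2) that(1) NX by blast
    have rad_lip: "\<bar>fill_radius t x - fill_radius t y\<bar> \<le> d x y" by (rule fill_radius_lipschitz[OF that(2,3) t])
    have set_lip: "\<bar>set_dist \<Delta> Z x - set_dist \<Delta> Z y\<bar> \<le> d x y"
      by (rule set_dist_lipschitz[OF Z that(2,3)])
    have pos: "0 \<le> d x y" using nonneg that by simp
    have "\<bar>min (set_dist \<Delta> Z x) (min (16 * (fill_radius t x - \<delta> / 2)) (12 * \<Delta> - fill_radius t x))
        - min (set_dist \<Delta> Z y) (min (16 * (fill_radius t y - \<delta> / 2)) (12 * \<Delta> - fill_radius t y))\<bar> \<le> 16 * d x y"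
    proof (intro abs_min_diff_le)
      show "\<bar>set_dist \<Delta> Z x - set_dist \<Delta> Z y\<bar> \<le> 16 * d x y" using set_lip pos by linarith
      have "16 * (fill_radius t x - \<delta> / 2) - 16 * (fill_radius t y - \<delta> / 2) = 16 * (fill_radius t x - fill_radius t y)" by simp
      then show "\<bar>16 * (fill_radius t x - \<delta> / 2) - 16 * (fill_radius t y - \<delta> / 2)\<bar> \<le> 16 * d x y"
        using rad_lip by (simp add: abs_mult)
      show "\<bar>12 * \<Delta> - fill_radius t x - (12 * \<Delta> - fill_radius t y)\<bar> \<le> 16 * d x y" using rad_lip pos by linarith
    qed
    then show ?thesis unfolding \<Psi>_def by (rule abs_max_0_diff_le)
  qed
  have upper: "sq_dist fs x y \<le> 256 * (d x y)\<^sup>2" if xy: "x \<in> X" "y \<in> X" for x y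
  proof -
    have "(\<Sum>Z\<leftarrow>Zs. (\<Psi> Z x - \<Psi> Z y)\<^sup>2) \<le> (\<Sum>Z\<leftarrow>Zs. (16 * d x y)\<^sup>2)"
    proof (rule sum_list_mono)
      fix Z assume "Z \<in> set Zs"
      from power_mono[OF lip[OF this xy], of 2] show "(\<Psi> Z x - \<Psi> Z y)\<^sup>2 \<le> (16 * d x y)\<^sup>2" by simp
    qed
    also have "\<dots> = M * (256 * (d x y)\<^sup>2)" by (simp add: sum_list_triv M_def power_mult_distrib)
    finally show ?thesis using M unfolding sq by (simp add: field_simps)
  qed
  have inactive: "\<Psi> Z z = 0" if "\<not> active \<gamma> t \<Delta> z" for Z z
  proof -
    have "16 * (fill_radius t z - \<delta> / 2) \<le> 0 \<or> 12 * \<Delta> - fill_radius t z \<le> 0"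
      using that unfolding active_def \<delta>_def by argo
    then have "min (set_dist \<Delta> Z z) (min (16 * (fill_radius t z - \<delta> / 2)) (12 * \<Delta> - fill_radius t z)) \<le> 0"
      unfolding min_le_iff_disj by blast
    then show ?thesis unfolding \<Psi>_def by (rule max_absorb1)
  qed
  have lower: "\<delta>\<^sup>2 / 100 \<le> sq_dist fs x y"
    if x: "x \<in> level \<gamma> t \<Delta>" and y: "y \<in> level \<gamma> t \<Delta>" and xy: "\<Delta> \<le> d x y" "d x y \<le> 2 * \<Delta>"
      and r: "\<delta> < fill_radius t y" "fill_radius t y \<le> 9 * \<Delta>" for x y
  proof -
    obtain x' where x': "x' \<in> N" "d x x' \<le> 2 * \<delta>" using N(3) x by blast
    obtain y' where y': "y' \<in> N" "d y y' \<le> 2 * \<delta>" using N(3) y by blast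
    have X: "x \<in> X" "y \<in> X" "x' \<in> X" "y' \<in> X" using x y x' y' LX NX by auto
    have "d x y \<le> d x x' + d x' y" "d x' y \<le> d x' y' + d y' y"
      "d x' y' \<le> d x' x + d x y'" "d x y' \<le> d x y + d y y'"
      using tri[of x x' y] tri[of x' y' y] tri[of x' x y'] tri[of x y y'] X by blast+
    then have far: "\<Delta> / 2 \<le> d x' y'" "d x' y' \<le> 3 * \<Delta>"
      using xy \<delta> x' y' sym[of y y'] sym[of x x'] X by auto
    let ?good = "\<lambda>Z. x' \<in> Z \<and> (\<forall>z\<in>Z. 10 * \<delta> \<le> d y' z)"
    have good: "(6 * \<delta>)\<^sup>2 \<le> (\<Psi> Z x - \<Psi> Z y)\<^sup>2" if Z: "Z \<in> set Zs" and g: "?good Z" for Z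
    proof -
      have ZX: "Z \<subseteq> X" using Zs(2) Z NX by blast
      have "set_dist \<Delta> Z x \<le> 2 * \<delta>" using set_dist_le[OF ZX, of x' \<Delta> x] g x' by auto
      then have "\<Psi> Z x \<le> 2 * \<delta>"
        using \<delta> unfolding \<Psi>_def max.bounded_iff min_le_iff_disj by argo
      moreover have "8 * \<delta> \<le> set_dist \<Delta> Z y"
      proof (rule set_dist_ge[OF ZX])
        fix z assume z: "z \<in> Z"
        have "d y' z \<le> d y' y + d y z" using tri X z ZX by blast
        then show "8 * \<delta> \<le> d y z" using g z y' sym[of y y'] X by fastforce
      qed (use g in auto)
      then have "8 * \<delta> \<le> \<Psi> Z y"
        using r \<delta> unfolding \<Psi>_def le_max_iff_disj min.bounded_iff by argo
      ultimately have "6 * \<delta> \<le> \<bar>\<Psi> Z x - \<Psi> Z y\<bar>" by linarith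
      then have "(6 * \<delta>)\<^sup>2 \<le> \<bar>\<Psi> Z x - \<Psi> Z y\<bar>\<^sup>2" using \<delta> by (intro power_mono) auto
      then show ?thesis by simp
    qed
    have "\<delta>\<^sup>2 / 100 * M \<le> (6 * \<delta>)\<^sup>2 * (length Zs / 2000)"
      using M \<delta> by (simp add: M_def power_mult_distrib)
    also have "\<dots> \<le> (6 * \<delta>)\<^sup>2 * length (filter ?good Zs)"
      using Zs(3) x'(1) y'(1) far by (intro mult_left_mono) auto
    also have "\<dots> \<le> (\<Sum>Z\<leftarrow>Zs. (\<Psi> Z x - \<Psi> Z y)\<^sup>2)"
      by (intro sum_list_ge_count good) auto
    finally show ?thesis unfolding sq using M by (simp add: field_simps)
  qed
  have "sq_dist fs x y = 0" if "\<not> active \<gamma> t \<Delta> x" "\<not> active \<gamma> t \<Delta> y" for x y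
    unfolding sq by (simp add: inactive that)
  then show ?thesis
    using upper lower unfolding \<delta>_def by (intro exI[of _ fs]) blast
qed

section \<open>Euclidean embedding of all scales\<close>

text \<open>Activity confines \<open>2\<^sup>k\<close> to an interval around \<open>fill_radius t z\<close> whose endpoints have a ratio of order
  \<open>\<surd>(2\<^sup>\<gamma>)\<close>.\<close>

lemma card_active_scales_le:
  "finite {k :: int. active \<gamma> t (2 powr k) z}"
  "card {k :: int. active \<gamma> t (2 powr k) z} \<le> 44 + real \<gamma>"
proof -
  define B where "B = 6 * 10 ^ 11 * sqrt (2 ^ \<gamma>)"
  have B: "1 \<le> B" using mult_mono[of 1 "6 * 10 ^ 11" 1 "sqrt (2 ^ \<gamma>)"] by (simp add: B_def)
  have act: "active \<gamma> t (2 powr k) z \<longleftrightarrow> fill_radius t z / 12 < 2 powr k \<and> 2 powr k < B * fill_radius t z" for k :: int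
    unfolding active_def gap_def B_def by (auto simp: field_simps)
  have "finite {k :: int. active \<gamma> t (2 powr k) z} \<and> card {k :: int. active \<gamma> t (2 powr k) z} \<le> 44 + real \<gamma>"
  proof (cases "0 < fill_radius t z")
    case False
    have "\<not> active \<gamma> t (2 powr k) z" for k :: int
    proof
      assume "active \<gamma> t (2 powr k) z"
      then have "0 < B * fill_radius t z" unfolding act using powr_gt_zero[of 2 "real_of_int k"] by linarith
      then show False using False B by (simp add: zero_less_mult_iff)
    qed
    then show ?thesis by simp
  next
    case True
    have le: "fill_radius t z / 12 \<le> B * fill_radius t z"
      using True B mult_right_mono[of "1/12" B "fill_radius t z"] by simp
    have "B * fill_radius t z / (fill_radius t z / 12) = 12 * B" using True by simp
    moreover have "log 2 (12 * B) \<le> log 2 (2 ^ (43 + \<gamma>))"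
    proof (subst log_le_cancel_iff)
      have "sqrt (2 ^ \<gamma>) \<le> 2 ^ \<gamma>" by (rule real_le_lsqrt) (auto simp: power2_eq_square)
      then have "12 * B \<le> 72 * 10 ^ 11 * 2 ^ \<gamma>" by (simp add: B_def)
      also have "\<dots> \<le> 2 ^ 43 * 2 ^ \<gamma>" by (intro mult_right_mono) auto
      finally show "12 * B \<le> 2 ^ (43 + \<gamma>)" by (simp add: power_add)
    qed (use B in auto)
    ultimately show ?thesis
      using card_powers_between[OF _ le] True unfolding act
      by (simp add: log_nat_power mult.commute)
  qed
  then show "finite {k :: int. active \<gamma> t (2 powr k) z}"
    "card {k :: int. active \<gamma> t (2 powr k) z} \<le> 44 + real \<gamma>" by auto
qed

text \<open>All coordinates for \<open>\<gamma> \<le> \<Gamma>\<close>, \<open>1 \<le> t \<le> T\<close> and all scales are used, where \<open>T\<close> is about \<open>log\<^sub>2 |X|\<close> and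
  \<open>\<Gamma>\<close> about \<open>log\<^sub>2 T\<close>. Upper bound: a point is active for at most \<open>44 + \<gamma>\<close> scales for each of the
  \<open>(\<Gamma> + 1) T\<close> pairs \<open>(\<gamma>, t)\<close>. Lower bound: for a pair at distance about \<open>\<Delta>\<close>, take the \<open>\<gamma>\<close> that fits the growth
  of balls around it; then about \<open>2\<^sup>\<gamma>\<close> values of \<open>t\<close> contribute \<open>(gap \<gamma> \<Delta>)\<^sup>2\<close> each, up to a constant,
  which is of order \<open>\<Delta>\<^sup>2\<close> in total.\<close>

theorem euclidean_embedding:
  assumes K: "ln (card X) \<le> K" "0 \<le> K"
  shows "\<exists>fs. \<forall>x\<in>X. \<forall>y\<in>X. (d x y)\<^sup>2 \<le> 10 ^ 26 * sq_dist fs x y \<and>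
    sq_dist fs x y \<le> 200000 * (1 + K) * (1 + ln (1 + K))\<^sup>2 * (d x y)\<^sup>2"
proof (cases "X = {}")
  case False
  then have "1 \<le> card X" using finite_space by (simp add: Suc_le_eq card_gt_0_iff)
  then obtain T where T: "2 ^ T \<le> card X" "card X < 2 ^ (T + 1)"
    using ex_power_ivl1[of 2 "card X"] by auto
  obtain m where m: "2 ^ m \<le> T + 1" "T + 1 < 2 ^ (m + 1)"
    using ex_power_ivl1[of 2 "T + 1"] by auto
  define \<Gamma> where "\<Gamma> = m + 1"
  define Ks where "Ks = (\<lambda>(x, y). \<lfloor>log 2 (d x y)\<rfloor>) ` (X \<times> X)"
  have Ks: "finite Ks" using finite_space by (simp add: Ks_def)
  define ok where "ok = (\<lambda>\<gamma> t \<Delta> fs. (\<forall>x\<in>X. \<forall>y\<in>X. sq_dist fs x y \<le> 256 * (d x y)\<^sup>2) \<and>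
    (\<forall>x\<in>X. \<forall>y\<in>X. \<not> active \<gamma> t \<Delta> x \<longrightarrow> \<not> active \<gamma> t \<Delta> y \<longrightarrow> sq_dist fs x y = 0) \<and>
    (\<forall>x\<in>level \<gamma> t \<Delta>. \<forall>y\<in>level \<gamma> t \<Delta>. \<Delta> \<le> d x y \<longrightarrow> d x y \<le> 2 * \<Delta> \<longrightarrow>
      gap \<gamma> \<Delta> < fill_radius t y \<longrightarrow> fill_radius t y \<le> 9 * \<Delta> \<longrightarrow> (gap \<gamma> \<Delta>)\<^sup>2 / 100 \<le> sq_dist fs x y))"
  define F where "F = (\<lambda>\<gamma> t (k::int). SOME fs. ok \<gamma> t (2 powr real_of_int k) fs)"
  have F: "ok \<gamma> t (2 powr real_of_int k) (F \<gamma> t k)" if "t \<le> T" for \<gamma> t k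
  proof -
    from that have "2 ^ t \<le> card X" using T(1) power_increasing[of t T "2 :: nat"] by linarith
    then have "\<exists>fs. ok \<gamma> t (2 powr real_of_int k) fs"
      unfolding ok_def by (intro single_scale_embedding) auto
    then show ?thesis unfolding F_def by (rule someI_ex)
  qed
  obtain fs where fs: "\<And>x y. sq_dist fs x y
      = (\<Sum>a\<in>{0..\<Gamma>} \<times> {1..T} \<times> Ks. sq_dist (case a of (\<gamma>, t, k) \<Rightarrow> F \<gamma> t k) x y)"
    using exists_sum_sq_dist[of "{0..\<Gamma>} \<times> {1..T} \<times> Ks" "\<lambda>a. case a of (\<gamma>, t, k) \<Rightarrow> F \<gamma> t k"] Ks
    by blast
  have fs_eq: "sq_dist fs x y = (\<Sum>\<gamma>\<in>{0..\<Gamma>}. \<Sum>t\<in>{1..T}. \<Sum>k\<in>Ks. sq_dist (F \<gamma> t k) x y)" for x y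
    unfolding fs by (simp add: sum.cartesian_product case_prod_beta)
  have upper: "sq_dist fs x y \<le> 200000 * (1 + K) * (1 + ln (1 + K))\<^sup>2 * (d x y)\<^sup>2"
    if xy: "x \<in> X" "y \<in> X" for x y
  proof -
    have scales: "(\<Sum>k\<in>Ks. sq_dist (F \<gamma> t k) x y) \<le> 2 * (44 + real \<Gamma>) * (256 * (d x y)\<^sup>2)"
      if \<gamma>: "\<gamma> \<le> \<Gamma>" and t: "t \<le> T" for \<gamma> t
    proof -
      define A where "A = {k. active \<gamma> t (2 powr real_of_int k) x} \<union> {k. active \<gamma> t (2 powr real_of_int k) y}"
      have "real (card A) \<le> card {k. active \<gamma> t (2 powr real_of_int k) x} + card {k. active \<gamma> t (2 powr real_of_int k) y}"
        unfolding A_def by (simp only: of_nat_add[symmetric] of_nat_le_iff card_Un_le)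
      also have "\<dots> \<le> (44 + real \<gamma>) + (44 + real \<gamma>)"
        using card_active_scales_le by (simp only: of_nat_add add_mono)
      finally have A: "real (card A) \<le> 2 * (44 + real \<Gamma>)" using \<gamma> by simp
      have fin: "finite A" unfolding A_def using card_active_scales_le by simp
      have zero: "sq_dist (F \<gamma> t k) x y = 0" if "k \<notin> A" for k
        using F[OF t, of \<gamma> k] xy that unfolding ok_def A_def by blast
      have "(\<Sum>k\<in>Ks. sq_dist (F \<gamma> t k) x y) = (\<Sum>k\<in>Ks \<inter> A. sq_dist (F \<gamma> t k) x y)"
        using Ks zero by (intro sum.mono_neutral_right) auto
      also have "\<dots> \<le> (\<Sum>k\<in>A. sq_dist (F \<gamma> t k) x y)"
        using fin by (intro sum_mono2) (auto simp: sq_dist_nonneg)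
      also have "\<dots> \<le> (\<Sum>k\<in>A. 256 * (d x y)\<^sup>2)"
        using F[OF t] xy unfolding ok_def by (intro sum_mono) blast
      also have "\<dots> = card A * (256 * (d x y)\<^sup>2)" by simp
      also have "\<dots> \<le> 2 * (44 + real \<Gamma>) * (256 * (d x y)\<^sup>2)"
        using A by (intro mult_right_mono) auto
      finally show ?thesis .
    qed
    have "sq_dist fs x y \<le> (\<Sum>\<gamma>\<in>{0..\<Gamma>}. \<Sum>t\<in>{1..T}. 2 * (44 + real \<Gamma>) * (256 * (d x y)\<^sup>2))"
      unfolding fs_eq by (intro sum_mono scales) auto
    also have "\<dots> = (real \<Gamma> + 1) * (real T * ((44 + real \<Gamma>) * (512 * (d x y)\<^sup>2)))"
      by (simp add: algebra_simps)
    also have "\<dots> \<le> (3 * (1 + ln (1 + K))) * ((3/2 * (1 + K)) * ((46 * (1 + ln (1 + K))) * (512 * (d x y)\<^sup>2)))"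
    proof -
      define l where "l = ln (1 + K)"
      have l: "0 \<le> l" using K by (simp add: l_def)
      have "T * ln 2 = ln (2 ^ T)" by (simp add: ln_realpow)
      also have "\<dots> \<le> ln (card X)"
        using T(1) by (subst ln_le_cancel_iff) (auto simp flip: of_nat_le_iff intro: less_le_trans[of _ "2 ^ T"])
      finally have "T * ln 2 \<le> K" using K by simp
      moreover have "T * (2/3) \<le> T * ln 2" using ln2_ge_two_thirds by (intro mult_left_mono) auto
      ultimately have TK: "T \<le> 3/2 * K" by simp
      have "m * ln 2 = ln (2 ^ m)" by (simp add: ln_realpow)
      also have "\<dots> \<le> ln (3/2 * (1 + K))"
      proof (subst ln_le_cancel_iff)
        have "(2::real) ^ m \<le> T + 1" using m(1) by (metis of_nat_le_iff of_nat_numeral of_nat_power)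
        then show "2 ^ m \<le> 3/2 * (1 + K)" using TK by simp
      qed (use K in auto)
      also have "\<dots> \<le> 1/2 + l"
        using K ln_le_minus_one[of "3/2"] by (subst ln_mult) (auto simp: l_def)
      finally have "m * ln 2 \<le> 1/2 + l" .
      moreover have "m * (2/3) \<le> m * ln 2" using ln2_ge_two_thirds by (intro mult_left_mono) auto
      ultimately have m_le: "m \<le> 3/4 + 3/2 * l" by simp
      have "real \<Gamma> + 1 \<le> 3 * (1 + l)" "44 + real \<Gamma> \<le> 46 * (1 + l)"
        using m_le l by (simp_all add: \<Gamma>_def)
      moreover have "T \<le> 3/2 * (1 + K)" using TK by simp
      ultimately show ?thesis unfolding l_def[symmetric]
        using l K by (intro mult_mono mult_right_mono) auto
    qed
    also have "\<dots> = 105984 * ((1 + K) * (1 + ln (1 + K))\<^sup>2 * (d x y)\<^sup>2)"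
    proof -
      have "(3 * a) * ((3/2 * b) * ((46 * a) * (512 * c))) = 105984 * (b * a\<^sup>2 * c)" for a b c :: real
        by (simp add: power2_eq_square)
      then show ?thesis .
    qed
    also have "\<dots> \<le> 200000 * ((1 + K) * (1 + ln (1 + K))\<^sup>2 * (d x y)\<^sup>2)"
      using K by (intro mult_right_mono) auto
    finally show ?thesis by (simp only: mult.assoc)
  qed
  \<comment> \<open>The point \<open>y\<close> with the sparser small ball takes the role of the point far from the zero set: it is the one
    whose cutoff must not vanish.\<close>
  have half: "(gap \<gamma> \<Delta>)\<^sup>2 / 100 * (2 ^ \<gamma> / 2) \<le> (\<Sum>t\<in>{1..T}. sq_dist (F \<gamma> t k) x y)"
    if xy: "x \<in> X" "y \<in> X" and \<Delta>: "\<Delta> = 2 powr real_of_int k" "\<Delta> \<le> d x y" "d x y \<le> 2 * \<Delta>"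
      and le: "ball_card y (gap \<gamma> \<Delta>) \<le> ball_card x (gap \<gamma> \<Delta>)"
      and hi: "hi = max (ball_card x (6 * \<Delta>)) (ball_card y (6 * \<Delta>))"
      and small: "hi \<le> 2 ^ 2 ^ \<gamma> * ball_card y (gap \<gamma> \<Delta>)"
      and minimal: "\<gamma> = 0 \<or> 2 ^ 2 ^ (\<gamma> - 1) * ball_card y (gap \<gamma> \<Delta>) \<le> hi"
    for x y \<Delta> k \<gamma> hi
  proof -
    define \<delta> where "\<delta> = gap \<gamma> \<Delta>"
    have \<Delta>0: "0 < \<Delta>" using \<Delta> by simp
    have \<delta>: "0 < \<delta>" "\<delta> \<le> \<Delta> / 100" using gap_pos[OF \<Delta>0] gap_le[OF \<Delta>0] by (auto simp: \<delta>_def)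
    define lo where "lo = ball_card y \<delta>"
    have lo: "1 \<le> lo" using ball_card_pos[OF xy(2)] \<delta> by (simp add: lo_def)
    define j where "j = (if \<gamma> = 0 then 1 else 2 ^ (\<gamma> - 1) :: nat)"
    have j: "(2::real) ^ \<gamma> / 2 \<le> j" by (cases \<gamma>) (auto simp: j_def)
    \<comment> \<open>Two disjoint balls fit into the large one; this serves the case \<open>\<gamma> = 0\<close>.\<close>
    have "2 * lo \<le> hi"
    proof -
      have "ball_card x \<delta> + ball_card y \<delta> = card ({z \<in> X. d x z \<le> \<delta>} \<union> {z \<in> X. d y z \<le> \<delta>})"
        unfolding ball_card_def
      proof (rule card_Un_disjoint[symmetric])
        show "{z \<in> X. d x z \<le> \<delta>} \<inter> {z \<in> X. d y z \<le> \<delta>} = {}"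
        proof (rule ccontr)
          assume "\<not> ?thesis"
          then obtain z where z: "z \<in> X" "d x z \<le> \<delta>" "d y z \<le> \<delta>" by blast
          then have "d x y \<le> \<delta> + \<delta>" using tri[of x z y] sym[of y z] xy by fastforce
          then show False using \<Delta> \<delta> \<Delta>0 by linarith
        qed
      qed (use finite_space in auto)
      also have "\<dots> \<le> ball_card y (6 * \<Delta>)"
        unfolding ball_card_def
      proof (rule card_mono)
        show "{z \<in> X. d x z \<le> \<delta>} \<union> {z \<in> X. d y z \<le> \<delta>} \<subseteq> {z \<in> X. d y z \<le> 6 * \<Delta>}"
        proof
          fix z assume "z \<in> {z \<in> X. d x z \<le> \<delta>} \<union> {z \<in> X. d y z \<le> \<delta>}"
          then have z: "z \<in> X" "d x z \<le> \<delta> \<or> d y z \<le> \<delta>" by auto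
          then have "d y z \<le> 2 * \<Delta> + \<delta>"
            using tri[of y x z] sym[of x y] xy \<Delta> \<Delta>0 by auto
          then show "z \<in> {z \<in> X. d y z \<le> 6 * \<Delta>}" using z \<delta> \<Delta>0 by auto
        qed
      qed (use finite_space in auto)
      finally show ?thesis using le unfolding lo_def hi \<delta>_def by linarith
    qed
    then have jlo: "2 ^ j * lo \<le> hi"
      using minimal unfolding j_def lo_def \<delta>_def by auto
    define J where "J = {t. lo < 2 ^ t \<and> 2 ^ t \<le> hi}"
    have J: "finite J" "j \<le> card J"
      unfolding J_def using card_powers_of_two_between[OF lo jlo] by auto
    have hi_card: "hi \<le> card X"
      unfolding hi ball_card_def using finite_space by (auto intro: card_mono)
    have J_sub: "J \<subseteq> {1..T}"
    proof
      fix t assume t: "t \<in> J"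
      have "2 ^ t < (2::nat) ^ (T + 1)" using t hi_card T(2) by (simp add: J_def)
      then have "t < T + 1" using power_less_imp_less_exp[of "2::nat" t "T + 1"] by simp
      moreover have "t \<noteq> 0" using t lo by (intro notI) (simp add: J_def)
      ultimately show "t \<in> {1..T}" by auto
    qed
    have each: "\<delta>\<^sup>2 / 100 \<le> sq_dist (F \<gamma> t k) x y" if t: "t \<in> J" for t
    proof -
      have tT: "t \<le> T" using t J_sub by auto
      have tX: "2 ^ t \<le> card X" using t hi_card by (simp add: J_def)
      have "2 ^ t \<le> 2 ^ 2 ^ \<gamma> * lo" "hi \<le> 2 ^ (t + 2 ^ \<gamma>)"
      proof -
        show "2 ^ t \<le> 2 ^ 2 ^ \<gamma> * lo" using t small by (simp add: J_def lo_def \<delta>_def)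
        have "hi \<le> 2 ^ 2 ^ \<gamma> * lo" using small by (simp add: lo_def \<delta>_def)
        also have "\<dots> \<le> 2 ^ 2 ^ \<gamma> * 2 ^ t" using t by (intro mult_left_mono) (auto simp: J_def)
        finally show "hi \<le> 2 ^ (t + 2 ^ \<gamma>)" by (simp add: power_add mult.commute)
      qed
      moreover have "lo \<le> ball_card x \<delta>" using le by (simp add: lo_def \<delta>_def)
      ultimately have "x \<in> level \<gamma> t \<Delta>" "y \<in> level \<gamma> t \<Delta>"
        using xy unfolding level_def \<delta>_def[symmetric] lo_def hi
        by (auto intro: order_trans mult_left_mono)
      moreover have "\<delta> < fill_radius t y"
        using fill_radius_le_iff[OF xy(2) tX, of \<delta>] t by (auto simp: J_def lo_def not_le[symmetric])
      moreover have "fill_radius t y \<le> 9 * \<Delta>"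
      proof -
        have "ball_card x (6 * \<Delta>) \<le> ball_card y (9 * \<Delta>)" "ball_card y (6 * \<Delta>) \<le> ball_card y (9 * \<Delta>)"
          using xy \<Delta> \<Delta>0 self[OF xy(2)] by (auto intro!: ball_card_shift)
        then have "2 ^ t \<le> ball_card y (9 * \<Delta>)" using t by (auto simp: J_def hi)
        then show ?thesis using fill_radius_le_iff[OF xy(2) tX] by blast
      qed
      ultimately show ?thesis
        using F[OF tT, of \<gamma> k] \<Delta> unfolding ok_def \<delta>_def by blast
    qed
    have "\<delta>\<^sup>2 / 100 * (2 ^ \<gamma> / 2) \<le> \<delta>\<^sup>2 / 100 * card J"
      using j J by (intro mult_left_mono) auto
    also have "\<dots> = (\<Sum>t\<in>J. \<delta>\<^sup>2 / 100)" by simp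
    also have "\<dots> \<le> (\<Sum>t\<in>J. sq_dist (F \<gamma> t k) x y)" by (intro sum_mono each)
    also have "\<dots> \<le> (\<Sum>t\<in>{1..T}. sq_dist (F \<gamma> t k) x y)"
      using J_sub by (intro sum_mono2) (auto simp: sq_dist_nonneg)
    finally show ?thesis by (simp add: \<delta>_def)
  qed
  have lower: "(d x y)\<^sup>2 \<le> 10 ^ 26 * sq_dist fs x y" if xy: "x \<in> X" "y \<in> X" for x y
  proof (cases "x = y")
    case True
    then show ?thesis using self[OF xy(1)] by (simp add: sq_dist_nonneg)
  next
    case False
    then have D: "0 < d x y" using sep[OF xy] nonneg[OF xy] by fastforce
    define k where "k = \<lfloor>log 2 (d x y)\<rfloor>"
    have kK: "k \<in> Ks" using xy by (force simp: k_def Ks_def)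
    define \<Delta> where "\<Delta> = 2 powr real_of_int k"
    have "\<Delta> \<le> 2 powr log 2 (d x y)" unfolding \<Delta>_def k_def by (intro powr_mono) auto
    then have \<Delta>_le: "\<Delta> \<le> d x y" using D by simp
    have "2 powr log 2 (d x y) \<le> 2 powr (real_of_int k + 1)"
      unfolding k_def by (intro powr_mono) (linarith, simp)
    then have \<Delta>_ge: "d x y \<le> 2 * \<Delta>" using D by (simp add: \<Delta>_def powr_add)
    define hi where "hi = max (ball_card x (6 * \<Delta>)) (ball_card y (6 * \<Delta>))"
    define lo where "lo = (\<lambda>\<gamma>. min (ball_card x (gap \<gamma> \<Delta>)) (ball_card y (gap \<gamma> \<Delta>)))"
    \<comment> \<open>The least \<open>\<gamma>\<close> makes the growth between \<open>gap \<gamma> \<Delta>\<close> and \<open>6 \<Delta>\<close> at most \<open>2\<^sup>g\<close> with \<open>g = 2\<^sup>\<gamma>\<close>, and at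
      least \<open>2\<^bsup>g/2\<^esup>\<close>. The radius \<open>gap \<gamma> \<Delta>\<close> itself depends on \<open>\<gamma>\<close>, and decreases with it.\<close>
    define \<gamma> where "\<gamma> = (LEAST \<gamma>. hi \<le> 2 ^ 2 ^ \<gamma> * lo \<gamma>)"
    have \<Delta>0: "0 < \<Delta>" by (simp add: \<Delta>_def)
    have "hi \<le> card X"
      unfolding hi_def ball_card_def using finite_space by (auto intro: card_mono)
    also have "\<dots> \<le> 2 ^ (T + 1)" using T by simp
    also have "\<dots> \<le> 2 ^ 2 ^ \<Gamma>" using m by (intro power_increasing) (auto simp: \<Gamma>_def)
    also have "\<dots> \<le> 2 ^ 2 ^ \<Gamma> * lo \<Gamma>"
      using ball_card_pos gap_pos[OF \<Delta>0, of \<Gamma>] xy by (simp add: lo_def)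
    finally have "hi \<le> 2 ^ 2 ^ \<Gamma> * lo \<Gamma>" .
    then have \<gamma>: "hi \<le> 2 ^ 2 ^ \<gamma> * lo \<gamma>" "\<gamma> \<le> \<Gamma>"
      unfolding \<gamma>_def by (rule LeastI, rule Least_le)
    have min: "\<gamma> = 0 \<or> 2 ^ 2 ^ (\<gamma> - 1) * lo \<gamma> \<le> hi"
    proof (cases "\<gamma> = 0")
      case False
      then have "\<not> hi \<le> 2 ^ 2 ^ (\<gamma> - 1) * lo (\<gamma> - 1)"
        unfolding \<gamma>_def by (intro not_less_Least) simp
      moreover have "lo \<gamma> \<le> lo (\<gamma> - 1)"
      proof -
        have "sqrt (2 ^ (\<gamma> - 1)) \<le> sqrt (2 ^ \<gamma>)" by simp
        then have "gap \<gamma> \<Delta> \<le> gap (\<gamma> - 1) \<Delta>"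
          unfolding gap_def using \<Delta>0 by (intro divide_left_mono) auto
        then have "ball_card z (gap \<gamma> \<Delta>) \<le> ball_card z (gap (\<gamma> - 1) \<Delta>)" for z by (intro ball_card_mono) auto
        then show ?thesis unfolding lo_def by (meson min.mono)
      qed
      then have "2 ^ 2 ^ (\<gamma> - 1) * lo \<gamma> \<le> 2 ^ 2 ^ (\<gamma> - 1) * lo (\<gamma> - 1)" by simp
      ultimately show ?thesis by linarith
    qed simp
    have "(gap \<gamma> \<Delta>)\<^sup>2 / 100 * (2 ^ \<gamma> / 2) \<le> (\<Sum>t\<in>{1..T}. sq_dist (F \<gamma> t k) x y)"
    proof (cases "ball_card y (gap \<gamma> \<Delta>) \<le> ball_card x (gap \<gamma> \<Delta>)")
      case True
      then have "lo \<gamma> = ball_card y (gap \<gamma> \<Delta>)" by (simp add: lo_def)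
      then show ?thesis
        using half[OF xy \<Delta>_def \<Delta>_le \<Delta>_ge True hi_def] \<gamma> min by simp
    next
      case False
      then have "lo \<gamma> = ball_card x (gap \<gamma> \<Delta>)" by (simp add: lo_def)
      moreover have "hi = max (ball_card y (6 * \<Delta>)) (ball_card x (6 * \<Delta>))" by (simp add: hi_def max.commute)
      ultimately show ?thesis
        using half[OF xy(2,1) \<Delta>_def, of \<gamma> hi] \<gamma> min False \<Delta>_le \<Delta>_ge sym[OF xy]
        by (simp add: sq_dist_commute[of _ x y])
    qed
    also have "\<dots> \<le> (\<Sum>t\<in>{1..T}. \<Sum>k\<in>Ks. sq_dist (F \<gamma> t k) x y)"
      using Ks kK by (intro sum_mono member_le_sum) (auto simp: sq_dist_nonneg)
    also have "\<dots> \<le> sq_dist fs x y"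
      unfolding fs_eq using \<gamma>(2)
      by (intro member_le_sum[where f = "\<lambda>\<gamma>. \<Sum>t\<in>{1..T}. \<Sum>k\<in>Ks. sq_dist (F \<gamma> t k) x y"])
         (auto intro!: sum_nonneg simp: sq_dist_nonneg)
    finally have "(gap \<gamma> \<Delta>)\<^sup>2 / 100 * (2 ^ \<gamma> / 2) \<le> sq_dist fs x y" .
    also have "(gap \<gamma> \<Delta>)\<^sup>2 / 100 * (2 ^ \<gamma> / 2) = \<Delta>\<^sup>2 / (18 * 10 ^ 24)"
      by (simp add: gap_def power_divide power_mult_distrib)
    finally have "\<Delta>\<^sup>2 \<le> (18 * 10 ^ 24) * sq_dist fs x y" by (simp add: field_simps)
    moreover have "(d x y)\<^sup>2 \<le> 4 * \<Delta>\<^sup>2"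
      using power_mono[OF \<Delta>_ge, of 2] D by (simp add: power_mult_distrib)
    moreover have "(72 * 10 ^ 24) * sq_dist fs x y \<le> 10 ^ 26 * sq_dist fs x y"
      by (intro mult_right_mono sq_dist_nonneg) simp
    ultimately show ?thesis by linarith
  qed
  show ?thesis using upper lower by blast
qed simp

end

section \<open>Finite subsets of the sequence space and embeddings into integrable functions\<close>

lemma sq_dist_append: "sq_dist (fs @ gs) x y = sq_dist fs x y + sq_dist gs x y"
  by (simp add: sq_dist_def)

lemma sq_dist_comp: "sq_dist (map (\<lambda>\<phi> x. \<phi> (h x)) fs) x y = sq_dist fs (h x) (h y)"
  by (simp add: sq_dist_def comp_def)

text \<open>The points are inserted in increasing order. A new largest point agrees with the previous largest point
  \<open>m\<close> in all old coordinates, and one new coordinate, the square root of the excess over \<open>m\<close>, adds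
  exactly the missing length.\<close>

lemma real_line_negative_type:
  assumes "finite (V :: real set)"
  shows "\<exists>fs. \<forall>a\<in>V. \<forall>b\<in>V. sq_dist fs a b = \<bar>a - b\<bar>"
  using assms
proof (induction V rule: finite_linorder_max_induct)
  case empty
  show ?case by simp
next
  case (insert b A)
  then obtain fs where fs: "\<forall>x\<in>A. \<forall>y\<in>A. sq_dist fs x y = \<bar>x - y\<bar>" by blast
  show ?case
  proof (cases "A = {}")
    case True
    then show ?thesis by (intro exI[of _ "[]"]) (simp add: sq_dist_def)
  next
    case False
    define m where "m = Max A"
    have m: "m \<in> A" "m < b" "\<And>x. x \<in> A \<Longrightarrow> x \<le> m"
      using insert.hyps False by (auto simp: m_def)
    define gs where "gs = map (\<lambda>\<phi> x. \<phi> (min x m)) fs @ [\<lambda>x. sqrt (max 0 (x - m))]"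
    have gs: "sq_dist gs x y = sq_dist fs (min x m) (min y m) + (sqrt (max 0 (x - m)) - sqrt (max 0 (y - m)))\<^sup>2" for x y
      by (simp add: gs_def sq_dist_append sq_dist_comp[of "\<lambda>x. min x m"]) (simp add: sq_dist_def)
    have old: "sq_dist gs x y = \<bar>x - y\<bar>" if "x \<in> A" "y \<in> A" for x y
      using that m(3) fs by (simp add: gs)
    have new: "sq_dist gs x b = \<bar>x - b\<bar>" if "x \<in> A" for x
    proof -
      have "x \<le> m" "x < b" using m(2) m(3)[OF that] by linarith+
      then show ?thesis using that m(1,2) fs by (simp add: gs)
    qed
    show ?thesis
    proof (intro exI[of _ gs] ballI)
      fix x y assume "x \<in> insert b A" "y \<in> insert b A"
      then show "sq_dist gs x y = \<bar>x - y\<bar>"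
        using old new[of x] new[of y] sq_dist_commute[of gs x y]
        by (auto simp: sq_dist_def abs_minus_commute)
    qed
  qed
qed

text \<open>Finitely many coordinates determine all the distances in a finite set up to the factor 2.\<close>

lemma ell1_truncation:
  assumes X: "finite X" "X \<subseteq> ell1"
  shows "\<exists>N. \<forall>x\<in>X. \<forall>y\<in>X. ell1_dist x y \<le> 2 * (\<Sum>i<N. \<bar>x i - y i\<bar>) \<and> (\<Sum>i<N. \<bar>x i - y i\<bar>) \<le> ell1_dist x y"
proof -
  have sums: "(\<lambda>i. \<bar>x i - y i\<bar>) sums ell1_dist x y" if "x \<in> X" "y \<in> X" for x y
    using has_sum_imp_sums[OF has_sum_infsum[OF ell1_diff_summable]] that X
    unfolding ell1_dist_def ell1_norm_def by blast
  have "\<forall>\<^sub>F N in sequentially. ell1_dist x y \<le> 2 * (\<Sum>i<N. \<bar>x i - y i\<bar>)" if xy: "x \<in> X" "y \<in> X" for x y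
  proof (cases "ell1_dist x y \<le> 0")
    case True
    then show ?thesis
      by (intro always_eventually allI) (meson order_trans mult_nonneg_nonneg sum_nonneg abs_ge_zero zero_le_numeral)
  next
    case False
    then have "ell1_dist x y / 2 < ell1_dist x y" by simp
    with sums[OF xy] have "\<forall>\<^sub>F N in sequentially. ell1_dist x y / 2 < (\<Sum>i<N. \<bar>x i - y i\<bar>)"
      unfolding sums_def by (rule order_tendstoD(1))
    then show ?thesis by eventually_elim simp
  qed
  then have "\<forall>\<^sub>F N in sequentially. \<forall>x\<in>X. \<forall>y\<in>X. ell1_dist x y \<le> 2 * (\<Sum>i<N. \<bar>x i - y i\<bar>)"
    using X by (intro eventually_ball_finite ballI) auto
  then obtain N where N: "\<forall>x\<in>X. \<forall>y\<in>X. ell1_dist x y \<le> 2 * (\<Sum>i<N. \<bar>x i - y i\<bar>)"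
    using eventually_happens'[OF sequentially_bot] by blast
  have "(\<Sum>i<N. \<bar>x i - y i\<bar>) \<le> ell1_dist x y" if xy: "x \<in> X" "y \<in> X" for x y
    using sum_le_suminf[OF sums_summable[OF sums[OF xy]], of "{..<N}"] sums_unique[OF sums[OF xy]] by simp
  with N show ?thesis by blast
qed

definition abs_dist :: "('a \<Rightarrow> real) list \<Rightarrow> 'a \<Rightarrow> 'a \<Rightarrow> real" where
  "abs_dist fs x y = (\<Sum>\<phi>\<leftarrow>fs. \<bar>\<phi> x - \<phi> y\<bar>)"

lemma abs_dist_append: "abs_dist (fs @ gs) x y = abs_dist fs x y + abs_dist gs x y"
  by (simp add: abs_dist_def)

lemma abs_dist_comp: "abs_dist (map (\<lambda>\<phi> x. \<phi> (h x)) fs) x y = abs_dist fs (h x) (h y)"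
  by (simp add: abs_dist_def comp_def)

lemma exists_sum_abs_dist:
  assumes "finite A"
  shows "\<exists>fs. \<forall>x y. abs_dist fs x y = (\<Sum>a\<in>A. abs_dist (F a) x y)"
  using assms
proof (induction A rule: finite_induct)
  case empty
  show ?case by (intro exI[of _ "[]"]) (simp add: abs_dist_def)
next
  case (insert a A)
  then obtain fs where "\<forall>x y. abs_dist fs x y = (\<Sum>a\<in>A. abs_dist (F a) x y)" by blast
  with insert.hyps show ?case by (intro exI[of _ "F a @ fs"]) (simp add: abs_dist_append)
qed

lemma sq_dist_nth: "sq_dist fs x y = (\<Sum>i<length fs. ((fs ! i) x - (fs ! i) y)\<^sup>2)"
  by (simp add: sq_dist_def sum_list_sum_nth atLeast0LessThan)

lemma abs_dist_nth: "abs_dist fs x y = (\<Sum>i<length fs. \<bar>(fs ! i) x - (fs ! i) y\<bar>)"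
  by (simp add: abs_dist_def sum_list_sum_nth atLeast0LessThan)

lemma finite_ell1_abs_dist:
  assumes X: "finite X" "X \<subseteq> ell1"
  shows "\<exists>gs. \<forall>x\<in>X. \<forall>y\<in>X. ell1_dist x y \<le> 2 * abs_dist gs x y \<and> abs_dist gs x y \<le> ell1_dist x y"
proof -
  obtain N where N: "\<forall>x\<in>X. \<forall>y\<in>X. ell1_dist x y \<le> 2 * (\<Sum>i<N. \<bar>x i - y i\<bar>) \<and> (\<Sum>i<N. \<bar>x i - y i\<bar>) \<le> ell1_dist x y"
    using ell1_truncation[OF X] by blast
  have "abs_dist (map (\<lambda>i x. x i) [0..<N]) x y = (\<Sum>i<N. \<bar>x i - y i\<bar>)" for x y :: "nat \<Rightarrow> real"
    by (simp add: abs_dist_nth)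
  with N show ?thesis by (intro exI[of _ "map (\<lambda>i x. x i) [0..<N]"]) simp
qed

lemma finite_ell1_sq_dist:
  assumes X: "finite X" "X \<subseteq> ell1" and K: "ln (card X) \<le> K" "0 \<le> K"
  shows "\<exists>fs. \<forall>x\<in>X. \<forall>y\<in>X. (ell1_dist x y)\<^sup>2 \<le> 4 * 10 ^ 26 * sq_dist fs x y \<and>
    sq_dist fs x y \<le> 200000 * (1 + K) * (1 + ln (1 + K))\<^sup>2 * (ell1_dist x y)\<^sup>2"
proof -
  obtain N where "\<forall>x\<in>X. \<forall>y\<in>X. ell1_dist x y \<le> 2 * (\<Sum>i<N. \<bar>x i - y i\<bar>) \<and> (\<Sum>i<N. \<bar>x i - y i\<bar>) \<le> ell1_dist x y"
    using ell1_truncation[OF X] by blast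
  then have N: "ell1_dist x y \<le> 2 * (\<Sum>i<N. \<bar>x i - y i\<bar>)" "(\<Sum>i<N. \<bar>x i - y i\<bar>) \<le> ell1_dist x y"
    if "x \<in> X" "y \<in> X" for x y using that by blast+
  define d where "d = (\<lambda>x y :: nat \<Rightarrow> real. \<Sum>i<N. \<bar>x i - y i\<bar>)"
  have "\<exists>hs. \<forall>i. \<forall>a\<in>(\<lambda>x. x i) ` X. \<forall>b\<in>(\<lambda>x. x i) ` X. sq_dist (hs i) a b = \<bar>a - b\<bar>"
    using X by (intro choice allI real_line_negative_type) auto
  then obtain hs where hs: "\<And>i x y. x \<in> X \<Longrightarrow> y \<in> X \<Longrightarrow> sq_dist (hs i) (x i) (y i) = \<bar>x i - y i\<bar>"
    by blast
  obtain gs where gs: "\<And>x y. sq_dist gs x y = (\<Sum>i<N. sq_dist (map (\<lambda>\<phi> x. \<phi> (x i)) (hs i)) x y)"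
    using exists_sum_sq_dist[of "{..<N}" "\<lambda>i. map (\<lambda>\<phi> x. \<phi> (x i)) (hs i)"] by blast
  have d: "d x y = sq_dist gs x y" if "x \<in> X" "y \<in> X" for x y
  proof -
    have "sq_dist gs x y = (\<Sum>i<N. sq_dist (hs i) (x i) (y i))"
      unfolding gs by (intro sum.cong refl sq_dist_comp)
    then show ?thesis using that by (simp add: d_def hs)
  qed
  interpret negative_type_space X d "length gs" "\<lambda>i. gs ! i"
  proof
    show "d x y = (\<Sum>i<length gs. ((gs ! i) x - (gs ! i) y)\<^sup>2)" if "x \<in> X" "y \<in> X" for x y
      using d[OF that] by (simp add: sq_dist_nth)
    show "d x z \<le> d x y + d y z" if "x \<in> X" "y \<in> X" "z \<in> X" for x y z
      unfolding d_def sum.distrib[symmetric] by (intro sum_mono) linarith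
    show "x = y" if xy: "x \<in> X" "y \<in> X" and "d x y = 0" for x y
    proof -
      have "ell1_dist x y \<le> 0" using N(1)[OF xy] that by (simp add: d_def)
      moreover have "0 \<le> ell1_dist x y" using Metric_space.nonneg[OF Metric_space_ell1] .
      ultimately show ?thesis using Metric_space.zero[OF Metric_space_ell1] xy X by fastforce
    qed
  qed (rule X)
  obtain fs where fs: "\<forall>x\<in>X. \<forall>y\<in>X. (d x y)\<^sup>2 \<le> 10 ^ 26 * sq_dist fs x y \<and>
    sq_dist fs x y \<le> 200000 * (1 + K) * (1 + ln (1 + K))\<^sup>2 * (d x y)\<^sup>2"
    using euclidean_embedding[OF K] by blast
  have "(ell1_dist x y)\<^sup>2 \<le> 4 * 10 ^ 26 * sq_dist fs x y \<and>
    sq_dist fs x y \<le> 200000 * (1 + K) * (1 + ln (1 + K))\<^sup>2 * (ell1_dist x y)\<^sup>2"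
    if xy: "x \<in> X" "y \<in> X" for x y
  proof
    have "(ell1_dist x y)\<^sup>2 \<le> (2 * d x y)\<^sup>2"
      using N(1)[OF xy] Metric_space.nonneg[OF Metric_space_ell1] unfolding d_def by (intro power_mono) auto
    also have "\<dots> = 4 * (d x y)\<^sup>2" by (simp add: power_mult_distrib)
    also have "\<dots> \<le> 4 * (10 ^ 26 * sq_dist fs x y)" using fs xy by (intro mult_left_mono) auto
    finally show "(ell1_dist x y)\<^sup>2 \<le> 4 * 10 ^ 26 * sq_dist fs x y" by simp
    have "sq_dist fs x y \<le> 200000 * (1 + K) * (1 + ln (1 + K))\<^sup>2 * (d x y)\<^sup>2" using fs xy by blast
    also have "\<dots> \<le> 200000 * (1 + K) * (1 + ln (1 + K))\<^sup>2 * (ell1_dist x y)\<^sup>2"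
      using N(2)[OF xy] K unfolding d_def by (intro mult_left_mono power_mono) (auto intro: sum_nonneg)
    finally show "sq_dist fs x y \<le> 200000 * (1 + K) * (1 + ln (1 + K))\<^sup>2 * (ell1_dist x y)\<^sup>2" .
  qed
  then show ?thesis by blast
qed

text \<open>Khintchine's inequality with the constant 1/2. With \<open>t\<close> the absolute value of the sum divided by its
  standard deviation, \<open>t \<ge> 3/4 t\<^sup>2 - 1/16 t\<^sup>4\<close>, because the difference is \<open>t (t - 2)\<^sup>2 (t + 4) / 16\<close>; and
  the average of the right side is at least \<open>3/4 - 3/16\<close>.\<close>

lemma sign_avg_abs_ge:
  "sqrt (\<Sum>i<n. (a i)\<^sup>2) / 2 \<le> sign_avg n (\<lambda>e. \<bar>sgn_form n a e\<bar>)"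
proof (cases "(\<Sum>i<n. (a i)\<^sup>2) = 0")
  case True
  then show ?thesis by (simp add: sign_avg_nonneg)
next
  case False
  define r where "r = sqrt (\<Sum>i<n. (a i)\<^sup>2)"
  have r: "0 < r" "r\<^sup>2 = (\<Sum>i<n. (a i)\<^sup>2)"
    using False sum_nonneg[of "{..<n}" "\<lambda>i. (a i)\<^sup>2"] by (auto simp: r_def less_le)
  have bound: "3 / (4 * r) * s\<^sup>2 - 1 / (16 * r ^ 3) * s ^ 4 \<le> \<bar>s\<bar>" for s
  proof -
    define t where "t = \<bar>s\<bar> / r"
    have t: "0 \<le> t" "\<bar>s\<bar> = r * t" using r by (auto simp: t_def)
    have "s\<^sup>2 = (r * t)\<^sup>2" "s ^ 4 = (r * t) ^ 4"
      unfolding t(2)[symmetric] by (simp_all add: power_even_abs)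
    then have "3 / (4 * r) * s\<^sup>2 - 1 / (16 * r ^ 3) * s ^ 4 = r * (3/4 * t\<^sup>2 - 1/16 * t ^ 4)"
      using r(1) by (simp add: field_simps power2_eq_square power4_eq_xxxx power3_eq_cube)
    also have "\<dots> \<le> r * t"
    proof (intro mult_left_mono)
      have "t - (3/4 * t\<^sup>2 - 1/16 * t ^ 4) = t * ((t - 2)\<^sup>2 * (t + 4)) / 16"
        by (simp add: field_simps power2_eq_square power4_eq_xxxx)
      moreover have "0 \<le> t * ((t - 2)\<^sup>2 * (t + 4)) / 16" using t by simp
      ultimately show "3/4 * t\<^sup>2 - 1/16 * t ^ 4 \<le> t" by linarith
    qed (use r in auto)
    finally show ?thesis using t by simp
  qed
  have "r / 2 \<le> 3 / (4 * r) * r\<^sup>2 - 1 / (16 * r ^ 3) * (3 * (r\<^sup>2)\<^sup>2)"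
    using r(1) by (simp add: field_simps power2_eq_square power3_eq_cube)
  also have "\<dots> \<le> sign_avg n (\<lambda>e. 3 / (4 * r) * (sgn_form n a e)\<^sup>2 - 1 / (16 * r ^ 3) * (sgn_form n a e) ^ 4)"
    unfolding sign_avg_diff sign_avg_cmult sign_avg_second_moment r(2)[symmetric]
    using sign_avg_fourth_moment[of n a] r
    by (intro diff_left_mono mult_left_mono) auto
  also have "\<dots> \<le> sign_avg n (\<lambda>e. \<bar>sgn_form n a e\<bar>)" by (intro sign_avg_mono bound)
  finally show ?thesis by (simp add: r_def)
qed

lemma sq_dist_embeds_abs_dist:
  "\<exists>gs. \<forall>x y. sqrt (sq_dist fs x y) / 2 \<le> abs_dist gs x y \<and> abs_dist gs x y \<le> sqrt (sq_dist fs x y)"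
proof -
  define n where "n = length fs"
  define gs where "gs = map (\<lambda>e x. (\<Sum>i<n. (fs ! i) x * e i) / 2 ^ n) (signs n)"
  have gs: "abs_dist gs x y = sign_avg n (\<lambda>e. \<bar>sgn_form n (\<lambda>i. (fs ! i) x - (fs ! i) y) e\<bar>)" for x y
  proof -
    have "\<bar>(\<Sum>i<n. (fs ! i) x * e i) / 2 ^ n - (\<Sum>i<n. (fs ! i) y * e i) / 2 ^ n\<bar>
        = (1 / 2 ^ n) * \<bar>sgn_form n (\<lambda>i. (fs ! i) x - (fs ! i) y) e\<bar>" for e
      by (simp add: left_diff_distrib sum_subtractf flip: diff_divide_distrib)
    then have "abs_dist gs x y = (1 / 2 ^ n) * (\<Sum>e\<leftarrow>signs n. \<bar>sgn_form n (\<lambda>i. (fs ! i) x - (fs ! i) y) e\<bar>)"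
      by (simp add: abs_dist_def gs_def comp_def sum_list_const_mult del: times_divide_eq_left)
    then show ?thesis by (simp add: sign_avg_def)
  qed
  have "abs_dist gs x y \<le> sqrt (sq_dist fs x y)" for x y
  proof (rule real_le_rsqrt)
    have "(abs_dist gs x y)\<^sup>2 \<le> sign_avg n (\<lambda>e. \<bar>sgn_form n (\<lambda>i. (fs ! i) x - (fs ! i) y) e\<bar>\<^sup>2)"
      unfolding gs by (rule sign_avg_power2_le)
    then show "(abs_dist gs x y)\<^sup>2 \<le> sq_dist fs x y"
      by (simp add: sign_avg_second_moment sq_dist_nth n_def)
  qed
  moreover have "sqrt (sq_dist fs x y) / 2 \<le> abs_dist gs x y" for x y
    unfolding gs sq_dist_nth n_def by (rule sign_avg_abs_ge)
  ultimately show ?thesis by blast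
qed

text \<open>Coordinate \<open>i\<close> is spread over the \<open>i\<close>-th of \<open>n\<close> equal subintervals, with its value scaled by \<open>n\<close>.\<close>

lemma abs_dist_embeds_L1:
  "\<exists>f. \<forall>x y. f x \<in> L1 \<and> L1_dist (f x) (f y) = abs_dist gs x y"
proof -
  define n where "n = length gs"
  define I where "I = (\<lambda>i. {real i / real n <..< (real i + 1) / real n})"
  define f where "f = (\<lambda>x t. \<Sum>i<n. (real n * (gs ! i) x) * indicator (I i) t)"
  have I_sub: "I i \<subseteq> {0<..<1}" if "i < n" for i
  proof
    fix t assume "t \<in> I i"
    moreover have "0 \<le> real i / real n" "(real i + 1) / real n \<le> 1"
      using that by (simp_all add: divide_le_eq)
    ultimately show "t \<in> {0<..<1}" unfolding I_def greaterThanLessThan_iff by linarith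
  qed
  have int_I: "integrable (lebesgue_on {0<..<1}) (indicator (I i) :: real \<Rightarrow> real)" if "i < n" for i
  proof (rule integrable_real_indicator)
    show "I i \<in> sets (lebesgue_on {0<..<1})"
      using I_sub[OF that] by (auto simp: sets_restrict_space_iff I_def)
    have "emeasure (lebesgue_on {0<..<1}) (I i) = emeasure lebesgue (I i)"
      using I_sub[OF that] by (intro emeasure_restrict_space) auto
    also have "\<dots> < \<infinity>"
      using that by (simp add: I_def divide_right_mono)
    finally show "emeasure (lebesgue_on {0<..<1}) (I i) < \<infinity>" .
  qed
  have val_I: "(LINT t|lebesgue_on {0<..<1}. indicator (I i) t) = 1 / real n" if "i < n" for i
  proof -
    have "(LINT t|lebesgue_on {0<..<1}. indicator (I i) t) = measure (lebesgue_on {0<..<1}) (I i \<inter> {0<..<1})"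
      by simp
    also have "\<dots> = measure lebesgue (I i)"
      using I_sub[OF that] by (subst measure_restrict_space) (auto simp: Int_absorb2)
    also have "\<dots> = 1 / real n"
      using that by (simp add: I_def divide_right_mono field_simps)
    finally show ?thesis .
  qed
  have disj: "i = j" if "t \<in> I i" "t \<in> I j" "i < n" "j < n" for i j t
  proof -
    have "real i / real n < (real j + 1) / real n" "real j / real n < (real i + 1) / real n"
      using that by (auto simp: I_def)
    then show ?thesis using that by (simp add: divide_less_cancel)
  qed
  have abs_f: "\<bar>f x t - f y t\<bar> = (\<Sum>i<n. (real n * \<bar>(gs ! i) x - (gs ! i) y\<bar>) * indicator (I i) t)" for x y t
  proof -
    define c where "c = (\<lambda>i. real n * ((gs ! i) x - (gs ! i) y))"
    have "f x t - f y t = (\<Sum>i<n. c i * indicator (I i) t)"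
      by (simp add: f_def c_def sum_subtractf[symmetric] algebra_simps)
    moreover have "\<bar>\<Sum>i<n. c i * indicator (I i) t\<bar> = (\<Sum>i<n. \<bar>c i\<bar> * indicator (I i) t)"
    proof (cases "\<exists>i<n. t \<in> I i")
      case True
      then obtain i where i: "i < n" "t \<in> I i" by blast
      have one: "(\<Sum>j<n. b j * indicator (I j) t) = b i" for b :: "nat \<Rightarrow> real"
      proof -
        have "(\<Sum>j<n. b j * indicator (I j) t) = (\<Sum>j<n. if j = i then b i else 0)"
        proof (intro sum.cong refl)
          fix j assume "j \<in> {..<n}"
          then have "t \<notin> I j" if "j \<noteq> i" using disj[of t j i] that i by blast
          then show "b j * indicator (I j) t = (if j = i then b i else 0)" using i by simp
        qed
        then show ?thesis using i by simp
      qed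
      show ?thesis unfolding one ..
    next
      case False
      then show ?thesis by (simp add: indicator_def)
    qed
    ultimately show ?thesis by (simp add: c_def abs_mult)
  qed
  have "f x \<in> L1" for x
    unfolding L1_def f_def mem_Collect_eq
    by (intro Bochner_Integration.integrable_sum integrable_mult_right int_I) auto
  moreover have "L1_dist (f x) (f y) = abs_dist gs x y" for x y
  proof -
    have "L1_dist (f x) (f y)
        = (\<Sum>i<n. (real n * \<bar>(gs ! i) x - (gs ! i) y\<bar>) * (LINT t|lebesgue_on {0<..<1}. indicator (I i) t))"
      unfolding L1_dist_def abs_f using int_I by (subst Bochner_Integration.integral_sum) auto
    also have "\<dots> = (\<Sum>i<n. \<bar>(gs ! i) x - (gs ! i) y\<bar>)"
    proof (intro sum.cong refl)
      fix i assume "i \<in> {..<n}"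
      then have i: "i < n" by simp
      show "(real n * \<bar>(gs ! i) x - (gs ! i) y\<bar>) * (LINT t|lebesgue_on {0<..<1}. indicator (I i) t)
          = \<bar>(gs ! i) x - (gs ! i) y\<bar>"
        unfolding val_I[OF i] using i by simp
    qed
    finally show ?thesis by (simp add: abs_dist_nth n_def)
  qed
  ultimately show ?thesis by blast
qed

lemma c1_le:
  assumes \<alpha>: "0 < \<alpha>" "\<alpha> \<le> \<beta>"
    and "\<And>x y. x \<in> S \<Longrightarrow> y \<in> S \<Longrightarrow> \<alpha> * d x y \<le> abs_dist gs x y"
    and "\<And>x y. x \<in> S \<Longrightarrow> y \<in> S \<Longrightarrow> abs_dist gs x y \<le> \<beta> * d x y"
  shows "c1 S d \<le> ereal (\<beta> / \<alpha>)"
proof -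
  obtain f where f: "\<And>x. f x \<in> L1" "\<And>x y. L1_dist (f x) (f y) = abs_dist gs x y"
    using abs_dist_embeds_L1[of gs] by blast
  have "f ` S \<subseteq> L1 \<and> (\<forall>x\<in>S. \<forall>y\<in>S. \<alpha> * d x y \<le> L1_dist (f x) (f y) \<and>
      L1_dist (f x) (f y) \<le> \<beta> / \<alpha> * \<alpha> * d x y)"
    using assms f by auto
  moreover have "1 \<le> \<beta> / \<alpha>" using \<alpha> by simp
  ultimately show ?thesis
    unfolding c1_def using \<alpha>(1) by (intro Inf_lower) blast
qed

section \<open>Products\<close>

text \<open>The threshold \<open>K\<close> balances the cost \<open>\<surd>|big|\<close> of the large factors against the cost \<open>\<surd>E2\<close> of the small
  ones: both are \<open>O((\<surd>L l)\<^bsup>1/2\<^esup>)\<close>.\<close>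

lemma c1_product_le:
  fixes X :: "nat \<Rightarrow> (nat \<Rightarrow> real) set"
  assumes X: "\<And>j. j \<in> {1..n} \<Longrightarrow> X j \<subseteq> ell1 \<and> finite (X j)"
    and S: "S = (\<Pi>\<^sub>E j\<in>{1..n}. X j)" and card: "card S \<ge> 3"
  defines "L \<equiv> ln (real (card S))"
  shows "c1 S (ell2_ell1_dist n) \<le> ereal (10 ^ 18 * sqrt (sqrt L * (1 + ln L)))"
proof -
  have L1: "1 \<le> L"
  proof -
    have "1 \<le> ln (3::real)" using ln3_gt_1 by simp
    also have "\<dots> \<le> L" unfolding L_def using card by (subst ln_le_cancel_iff) auto
    finally show ?thesis .
  qed
  define l where "l = 1 + ln L"
  have l: "1 \<le> l" using L1 by (simp add: l_def)
  define K where "K = sqrt L / l"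
  have K0: "0 < K" using L1 l by (simp add: K_def)
  have K: "1 \<le> 2 * K" "K \<le> sqrt L"
  proof -
    have "ln L = 2 * ln (sqrt L)" using L1 by (simp add: ln_sqrt)
    also have "\<dots> \<le> 2 * (sqrt L - 1)" using L1 by (intro mult_left_mono ln_le_minus_one) auto
    finally have "l \<le> 2 * sqrt L" by (simp add: l_def)
    then show "1 \<le> 2 * K" using l by (simp add: K_def field_simps)
    have "sqrt L * 1 \<le> sqrt L * l" using l L1 by (intro mult_left_mono) auto
    then show "K \<le> sqrt L" using l by (simp add: K_def field_simps)
  qed
  define big where "big = {j \<in> {1..n}. K < ln (card (X j))}"
  define small where "small = {1..n} - big"
  have fin: "finite big" "finite small" by (auto simp: big_def small_def)
  have split: "sum h {1..n} = sum h big + sum h small" for h :: "nat \<Rightarrow> real"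
    unfolding small_def by (subst sum.subset_diff[of big]) (auto simp: big_def)
  have "card S = (\<Prod>j\<in>{1..n}. card (X j))" unfolding S by (simp add: card_PiE)
  moreover from this have "card (X j) \<noteq> 0" if "j \<in> {1..n}" for j
    using card that by (metis finite_atLeastAtMost not_numeral_le_zero prod_zero_iff)
  ultimately have L_eq: "L = (\<Sum>j\<in>{1..n}. ln (card (X j)))" and card_pos: "\<And>j. j \<in> {1..n} \<Longrightarrow> 1 \<le> card (X j)"
  proof -
    assume *: "card S = (\<Prod>j\<in>{1..n}. card (X j))" and nz: "\<And>j. j \<in> {1..n} \<Longrightarrow> card (X j) \<noteq> 0"
    show "1 \<le> card (X j)" if "j \<in> {1..n}" for j using nz[OF that] by simp
    have "L = ln (\<Prod>j\<in>{1..n}. real (card (X j)))" unfolding L_def * by simp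
    also have "\<dots> = (\<Sum>j\<in>{1..n}. ln (card (X j)))"
      using nz by (intro ln_prod) (simp_all del: One_nat_def)
    finally show "L = (\<Sum>j\<in>{1..n}. ln (card (X j)))" .
  qed
  have big_card: "card big \<le> sqrt L * l"
  proof -
    have "card big * K \<le> (\<Sum>j\<in>big. ln (card (X j)))"
      using sum_mono[of big "\<lambda>_. K" "\<lambda>j. ln (card (X j))"] by (auto simp: big_def)
    also have "\<dots> \<le> L"
      unfolding L_eq using card_pos by (intro sum_mono2) (auto simp: big_def intro!: ln_ge_zero)
    also have "L = sqrt L * l * K" using l L1 by (simp add: K_def)
    finally show ?thesis using K0 by simp
  qed
  define E2 where "E2 = 200000 * (1 + K) * (1 + ln (1 + K))\<^sup>2"
  have E2: "E2 \<le> 5400000 * (sqrt L * l)"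
  proof -
    have "ln (1 + K) \<le> ln (L * 3)"
    proof (subst ln_le_cancel_iff)
      have "sqrt L \<le> L" using L1 by (intro real_le_lsqrt) (auto simp: power2_eq_square)
      then show "1 + K \<le> L * 3" using K L1 by simp
    qed (use K0 L1 in auto)
    also have "\<dots> \<le> ln L + 2"
      using L1 ln_le_minus_one[of 3] by (subst ln_mult) auto
    finally have "1 + ln (1 + K) \<le> 3 * l" using l by (simp add: l_def)
    then have "(1 + ln (1 + K))\<^sup>2 \<le> (3 * l)\<^sup>2" using K0 by (intro power_mono) auto
    then have "E2 \<le> 200000 * (3 * K) * (3 * l)\<^sup>2"
      unfolding E2_def using K K0 by (intro mult_mono) auto
    also have "\<dots> = 5400000 * (sqrt L * l)"
      using l by (simp add: K_def power2_eq_square)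
    finally show ?thesis by simp
  qed
  have "\<exists>gs. \<forall>x\<in>X j. \<forall>y\<in>X j. ell1_dist x y \<le> 2 * abs_dist gs x y \<and> abs_dist gs x y \<le> ell1_dist x y"
    if "j \<in> big" for j
    using X[of j] that by (intro finite_ell1_abs_dist) (auto simp: big_def)
  then obtain G where G: "\<And>j. j \<in> big \<Longrightarrow> \<forall>x\<in>X j. \<forall>y\<in>X j. ell1_dist x y \<le> 2 * abs_dist (G j) x y \<and> abs_dist (G j) x y \<le> ell1_dist x y"
    by metis
  have "\<exists>fs. \<forall>x\<in>X j. \<forall>y\<in>X j. (ell1_dist x y)\<^sup>2 \<le> 4 * 10 ^ 26 * sq_dist fs x y \<and> sq_dist fs x y \<le> E2 * (ell1_dist x y)\<^sup>2"
    if "j \<in> small" for j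
    unfolding E2_def using X[of j] that K0
    by (intro finite_ell1_sq_dist) (auto simp: small_def big_def not_less)
  then obtain F where F: "\<And>j. j \<in> small \<Longrightarrow> \<forall>x\<in>X j. \<forall>y\<in>X j. (ell1_dist x y)\<^sup>2 \<le> 4 * 10 ^ 26 * sq_dist (F j) x y \<and> sq_dist (F j) x y \<le> E2 * (ell1_dist x y)\<^sup>2"
    by metis
  obtain GS where GS: "\<forall>x y. abs_dist GS x y = (\<Sum>j\<in>big. abs_dist (map (\<lambda>\<phi> x. \<phi> (x j)) (G j)) x y)"
    using exists_sum_abs_dist[OF fin(1), of "\<lambda>j. map (\<lambda>\<phi> x. \<phi> (x j)) (G j)"] by blast
  obtain FS where FS: "\<forall>x y. sq_dist FS x y = (\<Sum>j\<in>small. sq_dist (map (\<lambda>\<phi> x. \<phi> (x j)) (F j)) x y)"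
    using exists_sum_sq_dist[OF fin(2), of "\<lambda>j. map (\<lambda>\<phi> x. \<phi> (x j)) (F j)"] by blast
  obtain HS where HS: "\<forall>x y. sqrt (sq_dist FS x y) / 2 \<le> abs_dist HS x y \<and> abs_dist HS x y \<le> sqrt (sq_dist FS x y)"
    using sq_dist_embeds_abs_dist[of FS] by blast
  define \<alpha> :: real where "\<alpha> = 1 / (4 * 10 ^ 13)"
  define P where "P = sqrt (sqrt L * l)"
  have P: "1 \<le> P" using L1 l mult_mono[of 1 "sqrt L" 1 l] by (simp add: P_def)
  define \<beta> where "\<beta> = sqrt (card big) + sqrt E2 + \<alpha>"
  have E2_nonneg: "0 \<le> E2" using K0 by (simp add: E2_def)
  have "c1 S (ell2_ell1_dist n) \<le> ereal (\<beta> / \<alpha>)"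
  proof (rule c1_le)
    show "0 < \<alpha>" by (simp add: \<alpha>_def)
    show "\<alpha> \<le> \<beta>" using E2_nonneg by (simp add: \<beta>_def)
    fix x y assume xy: "x \<in> S" "y \<in> S"
    have mem: "x j \<in> X j" "y j \<in> X j" if "j \<in> {1..n}" for j
      using xy that unfolding S by (auto simp: PiE_iff)
    have mem_big: "x j \<in> X j" "y j \<in> X j" if "j \<in> big" for j
      using mem that by (auto simp: big_def)
    have mem_small: "x j \<in> X j" "y j \<in> X j" if "j \<in> small" for j
      using mem that by (auto simp: small_def)
    define e where "e = (\<lambda>j. ell1_dist (x j) (y j))"
    have e: "0 \<le> e j" for j using Metric_space.nonneg[OF Metric_space_ell1] by (simp add: e_def)
    define D where "D = ell2_ell1_dist n x y"
    have D: "D = sqrt ((\<Sum>j\<in>big. (e j)\<^sup>2) + (\<Sum>j\<in>small. (e j)\<^sup>2))"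
      unfolding D_def ell2_ell1_dist_def e_def split ..
    have nonneg: "0 \<le> (\<Sum>j\<in>big. (e j)\<^sup>2)" "0 \<le> (\<Sum>j\<in>small. (e j)\<^sup>2)" by (auto intro: sum_nonneg)
    have G_eq: "abs_dist GS x y = (\<Sum>j\<in>big. abs_dist (G j) (x j) (y j))"
      using GS by (simp add: abs_dist_comp)
    have F_eq: "sq_dist FS x y = (\<Sum>j\<in>small. sq_dist (F j) (x j) (y j))"
      using FS by (simp add: sq_dist_comp)
    have G_low: "sqrt (\<Sum>j\<in>big. (e j)\<^sup>2) \<le> 2 * abs_dist GS x y"
    proof -
      have "sqrt (\<Sum>j\<in>big. (e j)\<^sup>2) \<le> (\<Sum>j\<in>big. e j)"
        using L2_set_le_sum[of big e] e by (simp add: L2_set_def)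
      also have "\<dots> \<le> (\<Sum>j\<in>big. 2 * abs_dist (G j) (x j) (y j))"
        unfolding e_def using G mem_big by (intro sum_mono) blast
      finally show ?thesis by (simp add: G_eq sum_distrib_left)
    qed
    have G_up: "abs_dist GS x y \<le> sqrt (card big) * D"
    proof -
      have "abs_dist GS x y \<le> (\<Sum>j\<in>big. \<bar>1\<bar> * \<bar>e j\<bar>)"
        unfolding G_eq using G mem_big e by (intro sum_mono) (auto simp: e_def)
      also have "\<dots> \<le> L2_set (\<lambda>_. 1) big * L2_set e big" by (rule L2_set_mult_ineq)
      also have "\<dots> \<le> sqrt (card big) * D"
        unfolding D L2_set_def using nonneg by (intro mult_mono) auto
      finally show ?thesis .
    qed
    have H_low: "sqrt (\<Sum>j\<in>small. (e j)\<^sup>2) \<le> 4 * 10 ^ 13 * abs_dist HS x y"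
    proof -
      have "(\<Sum>j\<in>small. (e j)\<^sup>2) \<le> (\<Sum>j\<in>small. 4 * 10 ^ 26 * sq_dist (F j) (x j) (y j))"
        unfolding e_def using F mem_small by (intro sum_mono) blast
      also have "\<dots> = (2 * 10 ^ 13)\<^sup>2 * sq_dist FS x y"
        by (simp add: F_eq sum_distrib_left)
      finally have "sqrt (\<Sum>j\<in>small. (e j)\<^sup>2) \<le> sqrt ((2 * 10 ^ 13)\<^sup>2 * sq_dist FS x y)"
        by (rule real_sqrt_le_mono)
      also have "\<dots> = 2 * 10 ^ 13 * sqrt (sq_dist FS x y)" by (simp only: real_sqrt_mult real_sqrt_abs) simp
      also have "\<dots> \<le> 2 * 10 ^ 13 * (2 * abs_dist HS x y)"
        using HS by (intro mult_left_mono) (auto simp: field_simps)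
      finally show ?thesis by simp
    qed
    have H_up: "abs_dist HS x y \<le> sqrt E2 * D"
    proof -
      have "sq_dist FS x y \<le> (\<Sum>j\<in>small. E2 * (e j)\<^sup>2)"
        unfolding F_eq e_def using F mem_small by (intro sum_mono) blast
      also have "\<dots> \<le> E2 * ((\<Sum>j\<in>big. (e j)\<^sup>2) + (\<Sum>j\<in>small. (e j)\<^sup>2))"
        using E2_nonneg nonneg by (simp add: sum_distrib_left[symmetric] mult_left_mono)
      finally have "sqrt (sq_dist FS x y) \<le> sqrt E2 * D"
        unfolding D real_sqrt_mult[symmetric] by (rule real_sqrt_le_mono)
      then show ?thesis using HS order_trans by blast
    qed
    have D0: "0 \<le> D" unfolding D using nonneg by simp
    show "abs_dist (GS @ HS) x y \<le> \<beta> * ell2_ell1_dist n x y"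
      using G_up H_up D0 unfolding D_def[symmetric] \<beta>_def abs_dist_append
      by (simp add: \<alpha>_def algebra_simps)
    have "D \<le> sqrt (\<Sum>j\<in>big. (e j)\<^sup>2) + sqrt (\<Sum>j\<in>small. (e j)\<^sup>2)"
      unfolding D using nonneg by (rule sqrt_add_le_add_sqrt)
    also have "\<dots> \<le> 4 * 10 ^ 13 * abs_dist (GS @ HS) x y"
    proof -
      have "0 \<le> abs_dist GS x y" using G_low real_sqrt_ge_zero[OF nonneg(1)] by linarith
      then show ?thesis using G_low H_low by (simp add: abs_dist_append)
    qed
    finally show "\<alpha> * ell2_ell1_dist n x y \<le> abs_dist (GS @ HS) x y"
      by (simp add: \<alpha>_def D_def)
  qed
  also have "\<beta> / \<alpha> \<le> 10 ^ 18 * P"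
  proof -
    have "sqrt (card big) \<le> P" unfolding P_def using big_card by (rule real_sqrt_le_mono)
    moreover have "sqrt E2 \<le> 3000 * P"
    proof -
      have "0 \<le> sqrt L * l" using L1 l by simp
      then have "E2 \<le> 3000\<^sup>2 * (sqrt L * l)" using E2 by simp
      then have "sqrt E2 \<le> sqrt (3000\<^sup>2 * (sqrt L * l))" by (rule real_sqrt_le_mono)
      also have "\<dots> = 3000 * P" unfolding P_def by (simp add: real_sqrt_mult)
      finally show ?thesis .
    qed
    ultimately have "\<beta> \<le> 3001 * P + \<alpha>" by (simp add: \<beta>_def)
    then show ?thesis using P by (simp add: \<alpha>_def)
  qed
  finally show ?thesis by (simp add: P_def l_def)
qed

text \<open>Since \<open>card S \<ge> 3\<close>, \<open>ln (ln (card S))\<close> is bounded below by \<open>ln (ln 3) > 0\<close>, which absorbs the summand 1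
  of \<open>c1_product_le\<close> into the constant. For the second part, \<open>\<epsilon>\<close> is defined by solving
  \<open>(ln N) powr \<epsilon> N = C \<surd>(ln (ln N))\<close>.\<close>

theorem lemma1p3:
  shows "(\<exists>C::real. C > 0 \<and>
      (\<forall>(n::nat) (X :: nat \<Rightarrow> (nat \<Rightarrow> real) set) S.
         n \<ge> 1 \<longrightarrow>
         (\<forall>j\<in>{1..n}. X j \<subseteq> ell1 \<and> finite (X j)) \<longrightarrow>
         S = (\<Pi>\<^sub>E j\<in>{1..n}. X j) \<longrightarrow>
         card S \<ge> 3 \<longrightarrow>
         c1 S (ell2_ell1_dist n)
           \<le> ereal (C * root 4 (ln (real (card S))) * sqrt (ln (ln (real (card S)))))))
    \<and>
    (\<exists>\<epsilon> :: nat \<Rightarrow> real. \<epsilon> \<longlonglongrightarrow> 0 \<and>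
      (\<forall>(n::nat) (X :: nat \<Rightarrow> (nat \<Rightarrow> real) set) S.
         n \<ge> 1 \<longrightarrow>
         (\<forall>j\<in>{1..n}. X j \<subseteq> ell1 \<and> finite (X j)) \<longrightarrow>
         S = (\<Pi>\<^sub>E j\<in>{1..n}. X j) \<longrightarrow>
         card S \<ge> 3 \<longrightarrow>
         c1 S (ell2_ell1_dist n)
           \<le> ereal (ln (real (card S)) powr (1/4 + \<epsilon> (card S)))))"
proof -
  define a where "a = ln (ln (3::real))"
  have a: "0 < a" unfolding a_def using ln3_gt_1 by simp
  have lnln: "a \<le> ln (ln (real N))" "1 < ln (real N)" if "3 \<le> N" for N :: nat
  proof -
    have *: "ln 3 \<le> ln (real N)" using that by (subst ln_le_cancel_iff) auto
    then show "1 < ln (real N)" using ln3_gt_1 by linarith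
    show "a \<le> ln (ln (real N))" unfolding a_def using * ln3_gt_1 by (subst ln_le_cancel_iff) auto
  qed
  define C where "C = 10 ^ 18 * sqrt (1 + 1 / a)"
  have C: "0 < C" using a by (simp add: C_def add_pos_pos)
  have bound: "c1 S (ell2_ell1_dist n) \<le> ereal (C * root 4 (ln (real (card S))) * sqrt (ln (ln (real (card S)))))"
    if X: "\<forall>j\<in>{1..n}. X j \<subseteq> ell1 \<and> finite (X j)" and S: "S = (\<Pi>\<^sub>E j\<in>{1..n}. X j)" "3 \<le> card S"
    for n S and X :: "nat \<Rightarrow> (nat \<Rightarrow> real) set"
  proof -
    define L where "L = ln (real (card S))"
    have L: "1 < L" "a \<le> ln L" using lnln[OF S(2)] by (auto simp: L_def)
    have "c1 S (ell2_ell1_dist n) \<le> ereal (10 ^ 18 * sqrt (sqrt L * (1 + ln L)))"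
      unfolding L_def by (rule c1_product_le[of n X]) (use X S in auto)
    also have "10 ^ 18 * sqrt (sqrt L * (1 + ln L)) \<le> C * root 4 L * sqrt (ln L)"
    proof -
      have "1 + ln L \<le> (1 + 1 / a) * ln L"
        using L a by (simp add: field_simps)
      then have "sqrt (1 + ln L) \<le> sqrt ((1 + 1 / a) * ln L)" by (rule real_sqrt_le_mono)
      then have "sqrt (sqrt L) * sqrt (1 + ln L) \<le> sqrt (sqrt L) * (sqrt (1 + 1 / a) * sqrt (ln L))"
        using L by (intro mult_left_mono) (auto simp: real_sqrt_mult)
      moreover have "sqrt (sqrt L) = root 4 L"
        using real_root_mult_exp[of 2 2 L] by (simp add: sqrt_def)
      ultimately show ?thesis by (simp add: C_def real_sqrt_mult mult_ac)
    qed
    finally show ?thesis by (simp add: L_def)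
  qed
  define \<epsilon> where "\<epsilon> = (\<lambda>N::nat. ln (C * sqrt (ln (ln (real N)))) / ln (ln (real N)))"
  have "\<epsilon> \<longlonglongrightarrow> 0"
  proof -
    have "((\<lambda>x. ln C * inverse x + (ln x / x) / 2) \<longlongrightarrow> ln C * 0 + 0 / 2) at_top"
      by (intro tendsto_intros tendsto_inverse_0_at_top filterlim_ident ln_x_over_x_tendsto_0) simp
    moreover have "\<forall>\<^sub>F x in at_top. ln C * inverse x + (ln x / x) / 2 = ln (C * sqrt x) / x"
      using eventually_gt_at_top[of 0]
    proof eventually_elim
      case (elim x)
      then show ?case using C by (simp add: ln_mult ln_sqrt field_simps)
    qed
    ultimately have "((\<lambda>x. ln (C * sqrt x) / x) \<longlongrightarrow> ln C * 0 + 0 / 2) at_top"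
      by (rule Lim_transform_eventually)
    then have "((\<lambda>x. ln (C * sqrt x) / x) \<longlongrightarrow> 0) at_top" by simp
    moreover have "filterlim (\<lambda>N::nat. ln (ln (real N))) at_top sequentially"
      by (intro filterlim_compose[OF ln_at_top] filterlim_real_sequentially)
    ultimately show ?thesis unfolding \<epsilon>_def by (rule filterlim_compose)
  qed
  moreover have "C * root 4 (ln (real N)) * sqrt (ln (ln (real N))) = ln (real N) powr (1/4 + \<epsilon> N)"
    if "3 \<le> N" for N :: nat
  proof -
    define L where "L = ln (real N)"
    have L: "1 < L" "0 < ln L" using lnln[OF that] a by (auto simp: L_def)
    have "L powr \<epsilon> N = exp (ln (C * sqrt (ln L)))"
      using L by (simp add: powr_def \<epsilon>_def L_def[symmetric])
    also have "\<dots> = C * sqrt (ln L)" using L C by simp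
    finally show ?thesis
      using L by (simp add: L_def[symmetric] powr_add root_powr_inverse mult_ac)
  qed
  ultimately show ?thesis using C bound by (intro conjI exI[of _ C] exI[of _ \<epsilon>]) auto
qed

end
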